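(* Let $F, D \in B^a(H_{\mathcal A})$. Suppose that $\mathbf M_C^{\mathcal A} = \begin{pmatrix} F & C \\ 0 & D\end{pmatrix}$ belongs to $\mathcal M\Phi(H_{\mathcal A}\oplus H_{\mathcal A})$ for some $C \in B^a(H_{\mathcal A})$. Then $F \in \mathcal M\Phi_+(H_{\mathcal A})$, $D \in \mathcal M\Phi_-(H_{\mathcal A})$, and for all decompositions $$H_{\mathcal A} = M_1 \tilde\oplus N_1 \stackrel{F}{\longrightarrow} M_2 \tilde\oplus N_2 = H_{\mathcal A}, \qquad H_{\mathcal A} = M_1' \tilde\oplus N_1' \stackrel{D}{\longrightarrow} M_2' \tilde\oplus N_2' = H_{\mathcal A}$$ with respect to which $F, D$ have the matrices $\begin{pmatrix} F_1 & 0\\ 0 & F_4\end{pmatrix}$, $\begin{pmatrix} D_1 & 0\\ 0 & D_4\end{pmatrix}$, respectively, where $F_1, D_1$ are isomorphisms and $N_1, N_2'$ are finitely generated, there exist closed submodules $\tilde N_1', \tilde{\tilde N}_1', \tilde N_2, \tilde{\tilde N}_2$ of $H_{\mathcal A}$ such that $N_2 \cong \tilde N_2$, $N_1' \cong \tilde N_1'$, $\tilde{\tilde N}_2$ and $\tilde{\tilde N}_1'$ are finitely generated, and $$\tilde N_2 \tilde\oplus \tilde{\tilde N}_2 \cong \tilde N_1' \tilde\oplus \tilde{\tilde N}_1'.$$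
   Context: $\mathcal A$ is a unital $C^*$-algebra and $H_{\mathcal A} = \ell^2(\mathcal A)$ is the standard Hilbert $\mathcal A$-module. For a Hilbert $\mathcal A$-module $H$, $B^a(H)$ denotes the bounded adjointable $\mathcal A$-linear operators on $H$. $H_{\mathcal A}\oplus H_{\mathcal A}$ is the (orthogonal) Hilbert module direct sum, on which $2\times2$ operator matrices act. $\tilde\oplus$ denotes a direct sum of closed submodules that need not be orthogonal (every element of the whole is uniquely a sum of elements of the summands, which are closed and have zero intersection). A Hilbert module is finitely generated if it equals the linear span (over $\mathbb C$ and $\mathcal A$) of a finite subset. An isomorphism is a bounded $\mathcal A$-linear bijection with bounded inverse, and $\cong$ means existence of an isomorphism. For a decomposition $H = M_1\tilde\oplus N_1 \stackrel{F}{\longrightarrow} M_2\tilde\oplus N_2 = H$ into closed submodules, saying $F$ has matrix $\begin{pmatrix} F_1 & 0\\ 0& F_4\end{pmatrix}$ means $F(M_1)\subseteq M_2$, $F(N_1)\subseteq N_2$, $F_1 = F|_{M_1}: M_1\to M_2$, $F_4 = F|_{N_1}: N_1\to N_2$. For $H = H_{\mathcal A}$ or $H_{\mathcal A}\oplus H_{\mathcal A}$: $F\in B^a(H)$ is upper semi-$\mathcal A$-Fredholm, $F\in\mathcal M\Phi_+(H)$, if there is such a decomposition with diagonal matrix, $F_1$ an isomorphism and $N_1$ finitely generated; lower semi-$\mathcal A$-Fredholm, $F\in\mathcal M\Phi_-(H)$, if the same holds with $N_2$ (instead of $N_1$) finitely generated; $\mathcal A$-Fredholm, $F\in\mathcal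 M\Phi(H)$, if the same holds with both $N_1$ and $N_2$ finitely generated. *)

theory Defs
  imports "HOL-Analysis.Analysis" "HOL-Library.Function_Algebras"
begin

section \<open>Unital C*-algebras\<close>

text \<open>
  The base class already demands \<open>norm 1 = 1\<close>; for a nonzero unital algebra this follows from the
  C*-identity, so the only algebra excluded is the zero algebra.
\<close>

class unital_cstar_algebra = real_normed_algebra_1 + banach +
  fixes scaleC :: "complex \<Rightarrow> 'a \<Rightarrow> 'a"
    and star :: "'a \<Rightarrow> 'a"
  assumes scaleC_add_right: "scaleC c (x + y) = scaleC c x + scaleC c y"
    and scaleC_add_left: "scaleC (c + d) x = scaleC c x + scaleC d x"
    and scaleC_scaleC: "scaleC c (scaleC d x) = scaleC (c * d) x"
    and scaleC_of_real: "scaleC (complex_of_real r) x = scaleR r x"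
    and mult_scaleC_left: "scaleC c x * y = scaleC c (x * y)"
    and mult_scaleC_right: "x * scaleC c y = scaleC c (x * y)"
    and norm_scaleC: "norm (scaleC c x) = cmod c * norm x"
    and star_star: "star (star x) = x"
    and star_add: "star (x + y) = star x + star y"
    and star_scaleC: "star (scaleC c x) = scaleC (cnj c) (star x)"
    and star_mult: "star (x * y) = star y * star x"
    and cstar_identity: "norm (star x * x) = (norm x)\<^sup>2"

instantiation complex :: unital_cstar_algebra
begin

definition scaleC_complex :: "complex \<Rightarrow> complex \<Rightarrow> complex"
  where "scaleC_complex = (*)"

definition star_complex :: "complex \<Rightarrow> complex"
  where "star_complex = cnj"

instance
  by standard
    (simp_all add: scaleC_complex_def star_complex_def algebra_simps norm_mult
      scaleR_conv_of_real power2_eq_square)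

end


section \<open>Hilbert modules and the standard module\<close>

text \<open>
  Right modules with carrier; the inner product is conjugate linear in the first argument.
  Addition is that of the ambient type. No separate complex scalar multiplication is recorded:
  over a unital algebra \<open>c\<close> acts on \<open>x\<close> as \<open>act x (scaleC c 1)\<close>, so submodules, linear maps and
  spans over the algebra are automatically complex ones. Operators are functions on the ambient
  type whose values outside the carrier are irrelevant.
\<close>

record ('a, 'h) hilbert_mod =
  hcarrier :: "'h set"
  act :: "'h \<Rightarrow> 'a \<Rightarrow> 'h"
  hinner :: "'h \<Rightarrow> 'h \<Rightarrow> 'a"

definition ell2 :: "('a::unital_cstar_algebra, nat \<Rightarrow> 'a) hilbert_mod" where
  "ell2 = \<lparr> hcarrier = {x. summable (\<lambda>n. star (x n) * x n)},
            act = (\<lambda>x a n. x n * a),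
            hinner = (\<lambda>x y. \<Sum>n. star (x n) * y n) \<rparr>"

definition orth_sum ::
  "('a::unital_cstar_algebra, 'h) hilbert_mod \<Rightarrow> ('a, 'k) hilbert_mod
    \<Rightarrow> ('a, 'h \<times> 'k) hilbert_mod" where
  "orth_sum H K =
    \<lparr> hcarrier = hcarrier H \<times> hcarrier K,
      act = (\<lambda>p a. (act H (fst p) a, act K (snd p) a)),
      hinner = (\<lambda>p q. hinner H (fst p) (fst q) + hinner K (snd p) (snd q)) \<rparr>"

definition hnorm :: "('a::unital_cstar_algebra, 'h) hilbert_mod \<Rightarrow> 'h \<Rightarrow> real" where
  "hnorm H x = sqrt (norm (hinner H x x))"


section \<open>Submodules and direct sums\<close>

definition submod ::
  "('a::unital_cstar_algebra, 'h::ab_group_add) hilbert_mod \<Rightarrow> 'h set \<Rightarrow> bool" where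
  "submod H M \<longleftrightarrow> M \<subseteq> hcarrier H \<and> 0 \<in> M \<and> (\<forall>x\<in>M. \<forall>y\<in>M. x + y \<in> M)
    \<and> (\<forall>x\<in>M. \<forall>a. act H x a \<in> M)"

definition closed_submod ::
  "('a::unital_cstar_algebra, 'h::ab_group_add) hilbert_mod \<Rightarrow> 'h set \<Rightarrow> bool" where
  "closed_submod H M \<longleftrightarrow> submod H M
    \<and> (\<forall>s x. (\<forall>n. s n \<in> M) \<and> x \<in> hcarrier H \<and> (\<lambda>n. hnorm H (s n - x)) \<longlonglongrightarrow> 0
          \<longrightarrow> x \<in> M)"

definition fin_gen ::
  "('a::unital_cstar_algebra, 'h::ab_group_add) hilbert_mod \<Rightarrow> 'h set \<Rightarrow> bool" where
  "fin_gen H M \<longleftrightarrow> (\<exists>S. finite S \<and> S \<subseteq> M \<and> M = {\<Sum>s\<in>S. act H s (a s) | a. True})"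

text \<open>
  \<open>direct_sum H W M N\<close>: \<open>W\<close> is the not necessarily orthogonal direct sum of \<open>M\<close> and \<open>N\<close>. The whole
  \<open>W\<close> is itself required to be a Hilbert module, i.e. closed in \<open>H\<close>.
\<close>

definition direct_sum ::
  "('a::unital_cstar_algebra, 'h::ab_group_add) hilbert_mod \<Rightarrow> 'h set \<Rightarrow> 'h set \<Rightarrow> 'h set \<Rightarrow> bool"
  where
  "direct_sum H W M N \<longleftrightarrow> closed_submod H W \<and> closed_submod H M \<and> closed_submod H N
    \<and> M \<inter> N = {0} \<and> W = {x + y | x y. x \<in> M \<and> y \<in> N}"


section \<open>Operators\<close>

definition linear_on_mod ::
  "('a::unital_cstar_algebra, 'h::ab_group_add) hilbert_mod \<Rightarrow> 'h set \<Rightarrow> ('h \<Rightarrow> 'h) \<Rightarrow> bool" where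
  "linear_on_mod H M f \<longleftrightarrow> (\<forall>x\<in>M. \<forall>y\<in>M. f (x + y) = f x + f y)
    \<and> (\<forall>x\<in>M. \<forall>a. f (act H x a) = act H (f x) a)"

definition bounded_on_mod ::
  "('a::unital_cstar_algebra, 'h) hilbert_mod \<Rightarrow> 'h set \<Rightarrow> ('h \<Rightarrow> 'h) \<Rightarrow> bool" where
  "bounded_on_mod H M f \<longleftrightarrow> (\<exists>K. \<forall>x\<in>M. hnorm H (f x) \<le> K * hnorm H x)"

definition adjointable_ops ::
  "('a::unital_cstar_algebra, 'h::ab_group_add) hilbert_mod \<Rightarrow> ('h \<Rightarrow> 'h) set" where
  "adjointable_ops H = {F. F \<in> hcarrier H \<rightarrow> hcarrier H
    \<and> linear_on_mod H (hcarrier H) F \<and> bounded_on_mod H (hcarrier H) F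
    \<and> (\<exists>G \<in> hcarrier H \<rightarrow> hcarrier H.
          \<forall>x\<in>hcarrier H. \<forall>y\<in>hcarrier H. hinner H (F x) y = hinner H x (G y))}"

definition mod_iso ::
  "('a::unital_cstar_algebra, 'h::ab_group_add) hilbert_mod \<Rightarrow> 'h set \<Rightarrow> 'h set \<Rightarrow> ('h \<Rightarrow> 'h) \<Rightarrow> bool"
  where
  "mod_iso H M N f \<longleftrightarrow> bij_betw f M N \<and> linear_on_mod H M f
    \<and> bounded_on_mod H M f \<and> bounded_on_mod H N (inv_into M f)"

definition isomorphic ::
  "('a::unital_cstar_algebra, 'h::ab_group_add) hilbert_mod \<Rightarrow> 'h set \<Rightarrow> 'h set \<Rightarrow> bool" where
  "isomorphic H M N \<longleftrightarrow> (\<exists>f. mod_iso H M N f)"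

definition op_matrix ::
  "('h \<Rightarrow> 'h) \<Rightarrow> ('k \<Rightarrow> 'h) \<Rightarrow> ('h \<Rightarrow> 'k) \<Rightarrow> ('k \<Rightarrow> 'k) \<Rightarrow> 'h \<times> 'k \<Rightarrow> 'h::plus \<times> 'k::plus" where
  "op_matrix P Q R S = (\<lambda>(x, y). (P x + Q y, R x + S y))"


section \<open>Semi-Fredholm operators\<close>

text \<open>
  \<open>diag_decomp H F M\<^sub>1 N\<^sub>1 M\<^sub>2 N\<^sub>2\<close>: with respect to the decompositions of the domain into
  \<open>M\<^sub>1\<close>, \<open>N\<^sub>1\<close> and of the codomain into \<open>M\<^sub>2\<close>, \<open>N\<^sub>2\<close>, the operator \<open>F\<close> has a diagonal matrix
  whose upper left entry is an isomorphism.
\<close>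

definition diag_decomp ::
  "('a::unital_cstar_algebra, 'h::ab_group_add) hilbert_mod \<Rightarrow> ('h \<Rightarrow> 'h)
    \<Rightarrow> 'h set \<Rightarrow> 'h set \<Rightarrow> 'h set \<Rightarrow> 'h set \<Rightarrow> bool" where
  "diag_decomp H F M\<^sub>1 N\<^sub>1 M\<^sub>2 N\<^sub>2 \<longleftrightarrow>
    direct_sum H (hcarrier H) M\<^sub>1 N\<^sub>1 \<and> direct_sum H (hcarrier H) M\<^sub>2 N\<^sub>2
    \<and> F ` M\<^sub>1 \<subseteq> M\<^sub>2 \<and> F ` N\<^sub>1 \<subseteq> N\<^sub>2 \<and> mod_iso H M\<^sub>1 M\<^sub>2 F"

definition upper_semi_fredholm ::
  "('a::unital_cstar_algebra, 'h::ab_group_add) hilbert_mod \<Rightarrow> ('h \<Rightarrow> 'h) set" where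
  "upper_semi_fredholm H = {F \<in> adjointable_ops H.
    \<exists>M\<^sub>1 N\<^sub>1 M\<^sub>2 N\<^sub>2. diag_decomp H F M\<^sub>1 N\<^sub>1 M\<^sub>2 N\<^sub>2 \<and> fin_gen H N\<^sub>1}"

definition lower_semi_fredholm ::
  "('a::unital_cstar_algebra, 'h::ab_group_add) hilbert_mod \<Rightarrow> ('h \<Rightarrow> 'h) set" where
  "lower_semi_fredholm H = {F \<in> adjointable_ops H.
    \<exists>M\<^sub>1 N\<^sub>1 M\<^sub>2 N\<^sub>2. diag_decomp H F M\<^sub>1 N\<^sub>1 M\<^sub>2 N\<^sub>2 \<and> fin_gen H N\<^sub>2}"

definition fredholm ::
  "('a::unital_cstar_algebra, 'h::ab_group_add) hilbert_mod \<Rightarrow> ('h \<Rightarrow> 'h) set" where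
  "fredholm H = {F \<in> adjointable_ops H.
    \<exists>M\<^sub>1 N\<^sub>1 M\<^sub>2 N\<^sub>2. diag_decomp H F M\<^sub>1 N\<^sub>1 M\<^sub>2 N\<^sub>2 \<and> fin_gen H N\<^sub>1 \<and> fin_gen H N\<^sub>2}"

end

theory Submission
  imports Defs
begin

text \<open>
  Write \<open>T\<close> for the triangular operator. A diagonal decomposition of \<open>T\<close> yields a bounded module map \<open>B\<close>
  such that \<open>1 - B T\<close> and \<open>1 - T B\<close> are projections onto finitely generated submodules. Comparing
  corners, \<open>F\<close> has a left inverse and \<open>D\<close> a right inverse modulo maps with finitely generated range.
  By the open mapping theorem such maps are norm limits of their truncations to finitely many
  coordinates, and a Neumann series turns the one-sided inverses into diagonal decompositions.

  For the last claim, suppose \<open>T\<close> maps \<open>t\<^sub>1 \<oplus> u\<^sub>1\<close> to \<open>t\<^sub>2 \<oplus> u\<^sub>2\<close> diagonally. The module of all pairs \<open>(x, v)\<close> with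
  \<open>v \<in> u\<^sub>2\<close> and \<open>T x + v \<in> N\<^sub>2 \<times> N\<^sub>2'\<close> is isomorphic both to \<open>N\<^sub>2 \<oplus> N\<^sub>2' \<oplus> u\<^sub>1\<close>, through \<open>T x + v\<close> and the
  \<open>u\<^sub>1\<close>-component of \<open>x\<close>, and to \<open>u\<^sub>2 \<oplus> N\<^sub>1 \<oplus> N\<^sub>1'\<close>, through \<open>v\<close> and the components of \<open>x\<close> in \<open>N\<^sub>1\<close> and \<open>N\<^sub>1'\<close>.
\<close>

section \<open>Positivity in C*-algebras\<close>

text \<open>Square summability in \<open>ell2\<close> means norm convergence of the series of
  \<open>star (x n) * x n\<close>. Already its closure under addition rests on the Cauchy-Schwarz
  inequality over the algebra, hence on positivity of \<open>star x * x\<close>. This is developed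
  from the C*-identity, with a norm condition in place of the spectrum.

  Two obstacles shape the operator part. A diagonal decomposition does not come with bounded
  projections; the open mapping theorem, applied to one sum map, yields the generalised inverse
  together with its bound. And the image of a finitely generated closed submodule under a coordinate
  projection need not be closed, so truncation errors are estimated on submodules of the double
  module, before projecting.

  The isomorphism of the last claim lives in four copies of the standard module, while the
  submodules asked for lie in one. Interleaving coordinates gives an embedding with a bounded left
  inverse, under which closed submodules stay closed. The module of pairs (x, v) remains implicit:
  its two parametrisations are composed, and only the composites appear.\<close>

lemma norm_star: "norm (star x) = norm (x::'a::unital_cstar_algebra)"
proof -
  have le: "norm y \<le> norm (star y)" for y :: 'a
  proof (cases "norm y = 0")
    case False
    have "(norm y)^2 \<le> norm (star y) * norm y"
      using norm_mult_ineq[of "star y" y] by (simp add: cstar_identity)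
    then show ?thesis using False by (simp add: power2_eq_square)
  qed simp
  show ?thesis using le[of x] le[of "star x"] by (simp add: star_star)
qed

lemma star_scaleR: "star (r *\<^sub>R x) = r *\<^sub>R star (x::'a::unital_cstar_algebra)"
  by (metis complex_cnj_complex_of_real scaleC_of_real star_scaleC)

lemma bounded_linear_star: "bounded_linear (star :: 'a::unital_cstar_algebra \<Rightarrow> 'a)"
  by (rule bounded_linear_intro[where K = 1]) (auto simp: star_add star_scaleR norm_star)

lemmas star_zero [simp] = linear_0[OF bounded_linear.linear[OF bounded_linear_star]]
lemmas star_diff = linear_diff[OF bounded_linear.linear[OF bounded_linear_star]]
lemmas star_minus = linear_neg[OF bounded_linear.linear[OF bounded_linear_star]]
lemmas star_sum = linear_sum[OF bounded_linear.linear[OF bounded_linear_star]]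

lemma star_one [simp]: "star 1 = (1::'a::unital_cstar_algebra)"
  by (metis mult_1_right star_mult star_star)

text \<open>The C*-identity for a self-adjoint element doubles the exponent, so exact norms are
  available along the powers of two. This subsequence is enough to replace the spectral radius
  formula in \<open>norm_one_plus_swap\<close>.\<close>

lemma norm_selfadjoint_power:
  fixes a :: "'a::unital_cstar_algebra"
  assumes "star a = a"
  shows "norm (a ^ (2 ^ k)) = norm a ^ (2 ^ k)"
proof (induction k)
  case (Suc k)
  have sa: "star (a ^ n) = a ^ n" for n
    by (induction n) (simp_all add: star_mult assms power_commutes)
  have "a ^ (2 ^ Suc k) = star (a ^ (2 ^ k)) * a ^ (2 ^ k)"
    by (simp only: sa power_add[symmetric]) (simp add: mult_2)
  then have "norm (a ^ (2 ^ Suc k)) = (norm (a ^ (2 ^ k)))^2"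
    by (simp only: cstar_identity)
  also have "\<dots> = norm a ^ (2 ^ Suc k)"
    by (simp add: Suc.IH power_mult[symmetric] mult.commute)
  finally show ?case .
qed simp

text \<open>The limit \<open>y\<close> solves \<open>(1 - y)\<^sup>2 = 1 - x\<close>. The real sequence for \<open>x = 1\<close> dominates the increments
  for all \<open>x\<close> in the unit ball.\<close>

primrec visser :: "'a::real_normed_algebra_1 \<Rightarrow> nat \<Rightarrow> 'a" where
  "visser x 0 = 0"
| "visser x (Suc n) = (1/2) *\<^sub>R (x + visser x n * visser x n)"

lemma visser_one: "0 \<le> visser (1::real) n \<and> visser (1::real) n \<le> 1 \<and> visser (1::real) n \<le> visser 1 (Suc n)"
proof (induction n)
  case (Suc n)
  then have "visser (1::real) n * visser 1 n \<le> visser 1 (Suc n) * visser 1 (Suc n)"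
    by (intro mult_mono) auto
  moreover have "visser (1::real) n * visser 1 n \<le> 1 * 1"
    using Suc by (intro mult_mono) auto
  ultimately show ?case using Suc by auto
qed simp

lemma convergent_visser:
  fixes x :: "'a::{real_normed_algebra_1,banach}"
  assumes "norm x \<le> 1"
  shows "convergent (visser x)" "norm (visser x n) \<le> 1"
proof -
  have bnd: "norm (visser x n) \<le> visser 1 n" for n
  proof (induction n)
    case (Suc n)
    have "norm (visser x n * visser x n) \<le> visser 1 n * visser 1 n"
      using Suc norm_mult_ineq[of "visser x n" "visser x n"] mult_mono[OF Suc Suc] visser_one[of n]
      by force
    then have "norm (x + visser x n * visser x n) \<le> 1 + visser 1 n * visser 1 n"
      using assms norm_triangle_ineq[of x "visser x n * visser x n"] by linarith
    then show ?case by simp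
  qed simp
  then show "norm (visser x n) \<le> 1" using visser_one[of n] order_trans by blast
  have step: "norm (visser x (Suc n) - visser x n) \<le> visser 1 (Suc n) - visser 1 n" for n
  proof (induction n)
    case 0 then show ?case using assms by simp
  next
    case (Suc n)
    let ?a = "visser x (Suc n)" and ?b = "visser x n"
    have eq: "?a * ?a - ?b * ?b = ?a * (?a - ?b) + (?a - ?b) * ?b" by (simp only: algebra_simps)
    have "norm (?a * ?a - ?b * ?b) \<le> norm ?a * norm (?a - ?b) + norm (?a - ?b) * norm ?b"
      unfolding eq by (intro order_trans[OF norm_triangle_ineq] add_mono norm_mult_ineq)
    also have "\<dots> = (norm ?a + norm ?b) * norm (?a - ?b)" by (simp only: algebra_simps)
    also have "\<dots> \<le> (visser 1 (Suc n) + visser 1 n) * (visser 1 (Suc n) - visser 1 n)"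
      using visser_one[of n] visser_one[of "Suc n"]
      by (intro mult_mono add_mono bnd Suc) (auto simp del: visser.simps)
    finally have "norm (?a * ?a - ?b * ?b) \<le> visser 1 (Suc n) * visser 1 (Suc n) - visser 1 n * visser 1 n"
      by (simp only: algebra_simps)
    moreover have "visser x (Suc (Suc n)) - visser x (Suc n) = (1/2) *\<^sub>R (?a * ?a - ?b * ?b)"
    proof -
      have "visser x (Suc (Suc n)) - visser x (Suc n)
          = (1/2) *\<^sub>R (x + ?a * ?a) - (1/2) *\<^sub>R (x + ?b * ?b)"
        by (intro arg_cong2[of _ _ _ _ "(-)"] visser.simps(2))
      then show ?thesis by (simp only: scaleR_diff_right[symmetric] add_diff_cancel_left)
    qed
    moreover have "visser 1 (Suc (Suc n)) - visser 1 (Suc n)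
        = (1/2) * (visser 1 (Suc n) * visser 1 (Suc n) - visser 1 n * visser (1::real) n)"
    proof -
      have "visser 1 (Suc (Suc n)) - visser 1 (Suc n)
          = (1/2) *\<^sub>R (1 + visser 1 (Suc n) * visser 1 (Suc n)) - (1/2) *\<^sub>R (1 + visser 1 n * visser (1::real) n)"
        by (intro arg_cong2[of _ _ _ _ "(-)"] visser.simps(2))
      then show ?thesis by (simp only: scaleR_diff_right[symmetric] add_diff_cancel_left) simp
    qed
    ultimately show ?case by (simp del: visser.simps)
  qed
  have "incseq (visser (1::real))" using visser_one by (intro incseq_SucI) blast
  then have "convergent (visser (1::real))"
    using visser_one by (intro Bseq_monoseq_convergent BseqI'[of _ 1] incseq_imp_monoseq) auto
  then have "summable (\<lambda>n. visser (1::real) (Suc n) - visser 1 n)"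
    unfolding convergent_def by (auto intro: telescope_summable simp del: visser.simps)
  then have "summable (\<lambda>n. visser x (Suc n) - visser x n)"
    by (rule summable_comparison_test') (use step in auto)
  then have "convergent (\<lambda>n. \<Sum>k<n. visser x (Suc k) - visser x k)"
    by (simp only: summable_iff_convergent)
  then show "convergent (visser x)" by (simp only: sum_lessThan_telescope visser.simps(1) diff_0_right)
qed

text \<open>For self-adjoint \<open>p\<close> the norm condition says that the spectrum lies in the
  interval from 0 to 2t. It passes to sums by the triangle inequality, whereas a definition through
  \<open>star x * x\<close> would make sums the hard case.\<close>

definition pos :: "'a::unital_cstar_algebra \<Rightarrow> bool" where
  "pos p \<longleftrightarrow> star p = p \<and> (\<exists>t\<ge>0. norm (t *\<^sub>R 1 - p) \<le> t)"

text \<open>Here \<open>q = 1 - y\<close>, and \<open>norm (1 - q) \<le> 1\<close> is the condition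
  of \<open>pos\<close> with t = 1. The commutation clause holds because the iterates are
  polynomials in \<open>x\<close>; it is the piece of functional calculus used later, where roots of
  different elements have to commute.\<close>

lemma sqrt_one_minus:
  fixes x :: "'a::unital_cstar_algebra"
  assumes "star x = x" "norm x \<le> 1"
  shows "\<exists>q. star q = q \<and> q * q = 1 - x \<and> norm (1 - q) \<le> 1 \<and> (\<forall>z. z * x = x * z \<longrightarrow> z * q = q * z)"
proof -
  obtain y where y: "visser x \<longlonglongrightarrow> y"
    using convergent_visser(1)[OF assms(2)] by (auto simp: convergent_def)
  have "(\<lambda>n. visser x (Suc n)) \<longlonglongrightarrow> (1/2) *\<^sub>R (x + y * y)"
    unfolding visser.simps by (intro tendsto_intros y)
  then have "y = (1/2) *\<^sub>R (x + y * y)"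
    using LIMSEQ_unique LIMSEQ_Suc[OF y] by blast
  then have "2 *\<^sub>R y = 2 *\<^sub>R (1/2) *\<^sub>R (x + y * y)" by (rule arg_cong)
  then have eq: "y + y = x + y * y" by (simp add: scaleR_2)
  have sa: "star (visser x n) = visser x n" for n
    by (induction n) (simp_all add: star_scaleR star_add star_mult assms)
  have "(\<lambda>n. star (visser x n)) \<longlonglongrightarrow> star y"
    by (intro bounded_linear.tendsto[OF bounded_linear_star] y)
  then have "star y = y" using y sa LIMSEQ_unique by simp
  then have 1: "star (1 - y) = 1 - y" by (simp add: star_diff)
  have 2: "norm (1 - (1 - y)) \<le> 1"
    using Lim_bounded[OF tendsto_norm[OF y]] convergent_visser(2)[OF assms(2)] by auto
  have 3: "z * (1 - y) = (1 - y) * z" if "z * x = x * z" for z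
  proof -
    have "z * visser x n = visser x n * z" for n
    proof (induction n)
      case (Suc n)
      then have "z * (visser x n * visser x n) = (visser x n * visser x n) * z"
        by (simp add: mult.assoc[symmetric]) (simp add: mult.assoc)
      then show ?case by (simp add: that distrib_left distrib_right)
    qed simp
    moreover have "(\<lambda>n. z * visser x n) \<longlonglongrightarrow> z * y" "(\<lambda>n. visser x n * z) \<longlonglongrightarrow> y * z"
      by (intro tendsto_intros y)+
    ultimately have "z * y = y * z" using LIMSEQ_unique by simp
    then show ?thesis by (simp add: algebra_simps)
  qed
  have 4: "(1 - y) * (1 - y) = 1 - x"
    using eq by (simp add: algebra_simps)
  show ?thesis
    by (intro exI[of _ "1 - y"] conjI allI impI 1 2 3 4)
qed

section \<open>The cone of positive elements and square roots\<close>

lemma pos_selfadjoint: "pos p \<Longrightarrow> star p = p"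
  by (simp add: pos_def)

lemma pos_mono:
  assumes "norm (t *\<^sub>R 1 - p) \<le> t" "t \<le> t'"
  shows "norm (t' *\<^sub>R 1 - (p::'a::unital_cstar_algebra)) \<le> t'"
proof -
  have "t' *\<^sub>R 1 - p = (t' - t) *\<^sub>R 1 + (t *\<^sub>R 1 - p)" by (simp add: algebra_simps)
  then have "norm (t' *\<^sub>R 1 - p) \<le> norm ((t' - t) *\<^sub>R (1::'a)) + norm (t *\<^sub>R 1 - p)"
    by (metis norm_triangle_ineq)
  then show ?thesis using assms by simp
qed

lemma pos_obtain:
  assumes "pos p"
  obtains t where "t > 0" "norm (t *\<^sub>R 1 - p) \<le> t"
proof -
  obtain t where "t \<ge> 0" "norm (t *\<^sub>R 1 - p) \<le> t" using assms by (auto simp: pos_def)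
  then show ?thesis using that[of "t + 1"] pos_mono[of t p "t + 1"] by simp
qed

lemma pos_scaleR: assumes "pos p" "0 \<le> r" shows "pos (r *\<^sub>R p)"
proof -
  obtain t where t: "t > 0" "norm (t *\<^sub>R 1 - p) \<le> t" by (rule pos_obtain[OF assms(1)])
  have "(r * t) *\<^sub>R 1 - r *\<^sub>R p = r *\<^sub>R (t *\<^sub>R 1 - p)" by (simp add: algebra_simps)
  then have "norm ((r * t) *\<^sub>R 1 - r *\<^sub>R p) = r * norm (t *\<^sub>R 1 - p)" using assms by simp
  then show ?thesis using assms t unfolding pos_def
    by (intro conjI exI[of _ "r * t"]) (auto simp: star_scaleR mult_left_mono)
qed

text \<open>Division by \<open>t\<close> turns the condition of \<open>pos\<close> into a bound by 1
  on the distance to the unit, where the iteration converges; the factor \<open>sqrt t\<close>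
  undoes the scaling.\<close>

lemma pos_sqrt:
  assumes "pos p"
  obtains q where "pos q" "q * q = p" "\<forall>z. z * p = p * z \<longrightarrow> z * q = q * z"
proof -
  obtain t where t: "t > 0" "norm (t *\<^sub>R 1 - p) \<le> t" by (rule pos_obtain[OF assms])
  let ?x = "1 - (1/t) *\<^sub>R p"
  have "t *\<^sub>R 1 - p = t *\<^sub>R ?x" using t by (simp add: algebra_simps)
  then have "norm ?x \<le> 1" using t by simp
  moreover have "star ?x = ?x" using assms by (simp add: star_diff star_scaleR pos_def)
  ultimately obtain q where q: "star q = q" "q * q = 1 - ?x" "norm (1 - q) \<le> 1"
    "\<And>z. z * ?x = ?x * z \<Longrightarrow> z * q = q * z" using sqrt_one_minus by blast
  have "pos q" unfolding pos_def using q(1,3) by (intro conjI exI[of _ 1]) auto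
  then have 1: "pos (sqrt t *\<^sub>R q)" using t by (intro pos_scaleR) auto
  have 2: "(sqrt t *\<^sub>R q) * (sqrt t *\<^sub>R q) = p" using q(2) t by simp
  show ?thesis
  proof (rule that[OF 1 2], intro allI impI)
    fix z assume "z * p = p * z"
    then have "z * ?x = ?x * z" by (simp add: algebra_simps)
    then have "z * q = q * z" by (rule q(4))
    then show "z * (sqrt t *\<^sub>R q) = (sqrt t *\<^sub>R q) * z" by simp
  qed
qed

lemma pos_add: assumes "pos p" "pos q" shows "pos (p + q)"
proof -
  obtain s where s: "s > 0" "norm (s *\<^sub>R 1 - p) \<le> s" by (rule pos_obtain[OF assms(1)])
  obtain t where t: "t > 0" "norm (t *\<^sub>R 1 - q) \<le> t" by (rule pos_obtain[OF assms(2)])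
  have eq: "(s + t) *\<^sub>R 1 - (p + q) = (s *\<^sub>R 1 - p) + (t *\<^sub>R 1 - q)" by (simp add: algebra_simps)
  have "norm ((s + t) *\<^sub>R 1 - (p + q)) \<le> s + t"
    unfolding eq using s t by (intro order_trans[OF norm_triangle_ineq] add_mono)
  then show ?thesis using s t assms unfolding pos_def
    by (intro conjI exI[of _ "s + t"]) (auto simp: star_add)
qed

lemma pos_zero [simp]: "pos 0" unfolding pos_def by (auto intro: exI[of _ 0])

lemma pos_sum: "(\<And>i. i \<in> I \<Longrightarrow> pos (f i)) \<Longrightarrow> pos (sum f I)"
  by (induction I rule: infinite_finite_induct) (auto intro: pos_add)

lemma scaleC_i:
  fixes a :: "'a::unital_cstar_algebra"
  shows "scaleC \<i> a * b = scaleC \<i> (a * b)" "a * scaleC \<i> b = scaleC \<i> (a * b)"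
    "scaleC \<i> (scaleC \<i> a) = - a" "star (scaleC \<i> a) = - scaleC \<i> (star a)"
    "norm (scaleC \<i> a) = norm a" "scaleC \<i> (a + b) = scaleC \<i> a + scaleC \<i> b"
    "scaleC \<i> (a - b) = scaleC \<i> a - scaleC \<i> b"
proof -
  show "scaleC \<i> (a - b) = scaleC \<i> a - scaleC \<i> b"
    using scaleC_add_right[of \<i> "a - b" b] by (simp add: algebra_simps)
  have m: "scaleC (- c) x = - scaleC c x" for c and x :: 'a
    using scaleC_add_left[of "- c" c x] scaleC_of_real[of 0 x] by (simp add: eq_neg_iff_add_eq_0)
  show "scaleC \<i> (scaleC \<i> a) = - a"
    using m[of 1 a] scaleC_of_real[of 1 a] by (simp add: scaleC_scaleC)
  show "star (scaleC \<i> a) = - scaleC \<i> (star a)" by (simp add: star_scaleC m)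
qed (simp_all add: mult_scaleC_left mult_scaleC_right norm_scaleC scaleC_add_right)

text \<open>Both norms are read off the normal element \<open>u = a + ib\<close>, for which \<open>u\<^sup>* u = a\<^sup>2 + b\<^sup>2\<close>.\<close>

lemma norm_commuting_squares:
  fixes a b :: "'a::unital_cstar_algebra"
  assumes "star a = a" "star b = b" "a * b = b * a"
  shows "norm (a * a) \<le> norm (a * a + b * b)"
proof -
  let ?u = "a + scaleC \<i> b"
  have su: "star ?u = a - scaleC \<i> b" by (simp add: star_add scaleC_i assms)
  have "star ?u * ?u = a * a + b * b"
    by (simp add: su algebra_simps scaleC_i assms)
  then have n: "(norm ?u)\<^sup>2 = norm (a * a + b * b)" using cstar_identity[of ?u] by simp
  have "2 *\<^sub>R a = ?u + star ?u" by (simp add: su scaleR_2)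
  then have "norm (2 *\<^sub>R a) \<le> norm ?u + norm ?u" 
    using norm_triangle_ineq[of ?u "star ?u"] by (simp only: norm_star)
  then have "norm a \<le> norm ?u" by simp
  then have "(norm a)\<^sup>2 \<le> (norm ?u)\<^sup>2" by (simp add: power_mono)
  moreover have "norm (a * a) = (norm a)\<^sup>2" using cstar_identity[of a] assms by simp
  ultimately show ?thesis using n by simp
qed

text \<open>In the unit ball let \<open>b\<close> be the root of \<open>1 - a * a\<close>. It
  commutes with \<open>a\<close>, so the norm of \<open>1 - a * a\<close>, which is that of
  \<open>b * b\<close>, is at most the norm of \<open>b * b + a * a = 1\<close>. That is the
  condition of \<open>pos\<close> with t = 1.\<close>

lemma pos_square:
  fixes a :: "'a::unital_cstar_algebra"
  assumes "star a = a"
  shows "pos (a * a)"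
proof -
  have *: "pos (a * a)" if "star a = a" "norm a \<le> 1" for a :: 'a
  proof -
    have "norm (a * a) \<le> 1"
      using norm_mult_ineq[of a a] that by (meson mult_le_one norm_ge_zero order_trans)
    moreover have "star (a * a) = a * a" by (simp add: star_mult that)
    ultimately obtain b where b: "star b = b" "b * b = 1 - a * a"
      "\<And>z. z * (a * a) = (a * a) * z \<Longrightarrow> z * b = b * z" using sqrt_one_minus by blast
    have "a * b = b * a" by (rule b(3)) (simp add: mult.assoc)
    then have "norm (b * b) \<le> norm (b * b + a * a)"
      by (intro norm_commuting_squares that b(1)) simp
    then have "norm (1 - a * a) \<le> 1" by (simp add: b(2))
    then show ?thesis unfolding pos_def using that by (intro conjI exI[of _ 1]) (auto simp: star_mult)
  qed
  show ?thesis
  proof (cases "a = 0")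
    case False
    have "pos (((1/norm a) *\<^sub>R a) * ((1/norm a) *\<^sub>R a))"
      using assms False by (intro *) (auto simp: star_scaleR)
    then have "pos ((norm a)^2 *\<^sub>R (((1/norm a) *\<^sub>R a) * ((1/norm a) *\<^sub>R a)))"
      by (rule pos_scaleR) simp
    then show ?thesis using False by (simp add: power2_eq_square)
  qed simp
qed

text \<open>Commuting roots of \<open>p\<close> and of \<open>t *\<^sub>R 1 - p\<close> have squares
  adding up to the scalar \<open>t\<close>, and \<open>norm_commuting_squares\<close> bounds one
  summand by the sum.\<close>

lemma norm_le_of_pos:
  fixes p :: "'a::unital_cstar_algebra"
  assumes "pos p" "pos (t *\<^sub>R 1 - p)" "0 \<le> t"
  shows "norm p \<le> t"
proof -
  obtain q where q: "pos q" "q * q = p" "\<forall>z. z * p = p * z \<longrightarrow> z * q = q * z"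
    by (rule pos_sqrt[OF assms(1)])
  obtain r where r: "pos r" "r * r = t *\<^sub>R 1 - p"
    "\<forall>z. z * (t *\<^sub>R 1 - p) = (t *\<^sub>R 1 - p) * z \<longrightarrow> z * r = r * z"
    by (rule pos_sqrt[OF assms(2)])
  have "p * r = r * p" by (rule r(3)[rule_format]) (simp add: algebra_simps)
  then have "q * r = r * q" by (intro q(3)[rule_format, symmetric] sym[of "r * p"]) simp
  then have "norm (q * q) \<le> norm (q * q + r * r)"
    by (intro norm_commuting_squares pos_selfadjoint q(1) r(1))
  then show ?thesis using assms(3) by (simp add: q(2) r(2))
qed

lemma pos_norm_minus: "star q = q \<Longrightarrow> pos (norm q *\<^sub>R 1 - (q::'a::unital_cstar_algebra))"
  unfolding pos_def by (intro conjI exI[of _ "norm q"]) (auto simp: star_diff star_scaleR)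

lemma norm_mono_pos:
  fixes p :: "'a::unital_cstar_algebra"
  assumes "pos p" "pos (q - p)"
  shows "norm p \<le> norm q"
proof (rule norm_le_of_pos)
  have "star q = q" using assms pos_add[OF assms] pos_selfadjoint by fastforce
  then have "pos (norm q *\<^sub>R 1 - q)" by (rule pos_norm_minus)
  then have "pos ((norm q *\<^sub>R 1 - q) + (q - p))" using assms by (intro pos_add)
  then show "pos (norm q *\<^sub>R 1 - p)" by simp
qed (use assms in auto)

lemma pos_antisym: "pos p \<Longrightarrow> pos (- p) \<Longrightarrow> p = 0"
  using norm_le_of_pos[of p 0] by simp

text \<open>The powers of \<open>1 + y y\<^sup>*\<close> and of \<open>1 + y\<^sup>* y\<close> are related, so the spectral radius
  of the first is controlled by the norm of the second.\<close>

lemma norm_one_plus_swap: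
  fixes y :: "'a::unital_cstar_algebra"
  assumes "norm (1 + star y * y) \<le> 1"
  shows "norm (1 + y * star y) \<le> 1"
proof (rule ccontr)
  let ?r = "1 + y * star y" and ?s = "1 + star y * y"
  assume w: "\<not> norm ?r \<le> 1"
  \<comment> \<open>The witness \<open>g\<close> is the sum of the powers of \<open>?s\<close> with
    exponent below n, each of norm at most 1. So the powers of \<open>?r\<close> grow at most
    linearly.\<close>
  have pw: "\<exists>g. ?r ^ n = 1 + y * g * star y \<and> norm g \<le> real n" for n
  proof (induction n)
    case (Suc n)
    then obtain g where g: "?r ^ n = 1 + y * g * star y" "norm g \<le> real n" by blast
    have "?r ^ Suc n = 1 + y * (1 + ?s * g) * star y"
      by (simp add: g algebra_simps)
    moreover have "norm (?s * g) \<le> 1 * real n"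
      using assms g norm_mult_ineq[of ?s g] by (meson mult_mono norm_ge_zero order_trans zero_le_one)
    then have "norm (1 + ?s * g) \<le> real (Suc n)"
      using norm_triangle_ineq[of 1 "?s * g"] by simp
    ultimately show ?case by blast
  qed (rule exI[of _ 0], simp)
  define C where "C = norm y * norm y"
  have bnd: "norm (?r ^ n) \<le> 1 + real n * C" for n
  proof -
    obtain g where g: "?r ^ n = 1 + y * g * star y" "norm g \<le> real n" using pw by blast
    have "norm (y * g * star y) \<le> norm y * norm g * norm y"
      using norm_mult_ineq[of "y * g" "star y"] mult_right_mono[OF norm_mult_ineq[of y g] norm_ge_zero[of y]]
      by (simp add: norm_star)
    also have "\<dots> \<le> norm y * real n * norm y" using g by (intro mult_mono) auto
    finally show ?thesis using norm_triangle_ineq[of 1 "y * g * star y"] g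
      by (simp add: C_def algebra_simps)
  qed
  define d where "d = norm ?r - 1"
  have d: "d > 0" using w d_def by simp
    \<comment> \<open>Bernoulli's lower bound and \<open>bnd\<close> are both linear in the
      exponent, which gives no contradiction. Writing the exponent as twice \<open>2 ^ k\<close> and
      squaring makes the lower bound quadratic.\<close>
    have key: "(1 + real (2 ^ k) * d)^2 \<le> 1 + 2 * (real (2 ^ k) * C)" for k
  proof -
    have "star ?r = ?r" by (simp add: star_add star_mult star_star)
    then have e: "norm (?r ^ (2 ^ Suc k)) = norm ?r ^ (2 ^ Suc k)" by (rule norm_selfadjoint_power)
    have "1 + real (2 ^ k) * d \<le> (1 + d) ^ (2 ^ k)"
      using Bernoulli_inequality[of d "2^k"] d by simp
    then have "(1 + real (2 ^ k) * d)^2 \<le> ((1 + d) ^ (2 ^ k))^2"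
      using d by (intro power_mono) auto
    also have "\<dots> = norm ?r ^ (2 ^ Suc k)"
      by (simp add: d_def power_mult[symmetric] mult.commute)
    also have "\<dots> \<le> 1 + real (2 ^ Suc k) * C" using e bnd[of "2 ^ Suc k"] by simp
    finally show ?thesis by simp
  qed
  obtain k where "real (2 ^ k) > 2 * C / (d * d)"
    using real_arch_pow[of 2 "2 * C / (d * d)"] by auto
  then have "real (2 ^ k) * (d * d) > 2 * C" using d by (simp add: divide_simps)
  then have "real (2 ^ k) * (real (2 ^ k) * (d * d)) > real (2 ^ k) * (2 * C)"
    by (intro mult_strict_left_mono) auto
  moreover have "(1 + real (2 ^ k) * d)^2 = 1 + 2 * (real (2 ^ k) * d) + real (2 ^ k) * (real (2 ^ k) * (d * d))"
    by (simp add: power2_eq_square algebra_simps)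
  moreover have "real (2 ^ k) * d > 0" using d by simp
  ultimately show False using key[of k] by linarith
qed

text \<open>Stands in for the equality of the spectra of \<open>star y * y\<close> and
  \<open>y * star y\<close> up to 0. Scaling \<open>y\<close> by \<open>1 / sqrt t\<close> brings
  the condition of \<open>pos\<close> into the form
  \<open>norm (1 + star y * y) \<le> 1\<close>.\<close>

lemma pos_neg_swap:
  fixes y :: "'a::unital_cstar_algebra"
  assumes "pos (- (star y * y))"
  shows "pos (- (y * star y))"
proof -
  obtain t where t: "t > 0" "norm (t *\<^sub>R 1 - - (star y * y)) \<le> t" by (rule pos_obtain[OF assms])
  let ?y = "(1 / sqrt t) *\<^sub>R y"
  have e: "star ?y * ?y = (1/t) *\<^sub>R (star y * y)" "?y * star ?y = (1/t) *\<^sub>R (y * star y)"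
    using t by (simp_all add: star_scaleR)
  have "t *\<^sub>R 1 + star y * y = t *\<^sub>R (1 + star ?y * ?y)" using t by (simp only: e) (simp add: algebra_simps)
  then have "norm (1 + star ?y * ?y) \<le> 1" using t by simp
  then have "norm (1 + ?y * star ?y) \<le> 1" by (rule norm_one_plus_swap)
  moreover have "t *\<^sub>R 1 + y * star y = t *\<^sub>R (1 + ?y * star ?y)" using t by (simp only: e) (simp add: algebra_simps)
  ultimately have "norm (t *\<^sub>R 1 - - (y * star y)) \<le> t" using t by simp
  then show ?thesis using t unfolding pos_def
    by (auto simp: star_minus star_mult star_star intro!: exI[of _ t])
qed

text \<open>Kaplansky's argument: with the negative part \<open>n\<close> of \<open>x\<^sup>* x\<close>, the element \<open>y = x n\<close> satisfies
  \<open>y\<^sup>* y = - n\<^sup>3 \<le> 0\<close>, which forces \<open>y = 0\<close>.\<close>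

lemma pos_star_mult:
  fixes x :: "'a::unital_cstar_algebra"
  shows "pos (star x * x)"
proof -
  define a where "a = star x * x"
  have sa: "star a = a" by (simp add: a_def star_mult star_star)
  obtain m where m: "pos m" "m * m = a * a" "\<forall>z. z * (a * a) = (a * a) * z \<longrightarrow> z * m = m * z"
    by (rule pos_sqrt[OF pos_square[OF sa]])
  have am: "a * m = m * a" by (rule m(3)[rule_format]) (simp add: mult.assoc)
  \<comment> \<open>This second root serves to write \<open>n * m * n\<close>, and so the cube of
    \<open>n\<close>, as a positive multiple of the square of the self-adjoint element
    \<open>n * k\<close>.\<close>
  obtain k where k: "pos k" "k * k = m" "\<forall>z. z * m = m * z \<longrightarrow> z * k = k * z"
    by (rule pos_sqrt[OF m(1)])
  have ak: "a * k = k * a" by (rule k(3)[rule_format]) (rule am)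
  have sm: "star m = m" "star k = k" by (intro pos_selfadjoint m(1) k(1))+
  have mk: "m * k = k * m" by (rule k(3)[rule_format]) simp
  \<comment> \<open>As \<open>m\<close> is the absolute value of \<open>a\<close>, this is twice the
    usual negative part. Hence \<open>a * n\<close> is minus one half of \<open>n * n\<close>, and
    \<open>star y * y\<close> is minus one half of the cube of \<open>n\<close>.\<close>
  define n where "n = m - a"
  have sn: "star n = n" by (simp add: n_def star_diff sm sa)
  have nk: "n * k = k * n" by (simp add: n_def algebra_simps mk ak)
  have np: "n * (m + a) = 0" by (simp add: n_def algebra_simps m(2) am)
  have pn: "(m + a) * n = 0" by (simp add: n_def algebra_simps m(2) am)
  have nm: "2 *\<^sub>R (n * m) = n * n"
    using np by (simp add: n_def algebra_simps scaleR_2 eq_neg_iff_add_eq_0 m(2) am)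
  have na: "2 *\<^sub>R (a * n) = - (n * n)"
    using pn by (simp add: n_def algebra_simps scaleR_2 eq_neg_iff_add_eq_0 m(2) am)
  have nnn: "n * (n * n) = 2 *\<^sub>R ((n * k) * (n * k))"
  proof -
    have "n * (n * n) = (n * n) * n" by (simp only: mult.assoc)
    also have "\<dots> = 2 *\<^sub>R ((n * m) * n)" by (simp only: nm[symmetric] mult_scaleR_left)
    also have "(n * m) * n = (n * k) * (n * k)" 
      by (simp only: k(2)[symmetric] nk mult.assoc[symmetric])
    finally show ?thesis .
  qed
  have "star (n * k) = n * k" by (simp add: star_mult sn sm nk)
  then have pos3: "pos (n * (n * n))" unfolding nnn by (intro pos_scaleR pos_square) auto
  define y where "y = x * n"
  have "star y * y = n * a * n" by (simp add: y_def a_def star_mult sn mult.assoc)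
  then have "2 *\<^sub>R (star y * y) = n * (2 *\<^sub>R (a * n))" by (simp add: mult.assoc)
  then have yy: "2 *\<^sub>R (star y * y) = - (n * (n * n))" by (simp add: na)
  then have "n * (n * n) = 2 *\<^sub>R (- (star y * y))" by simp
  then have "- (star y * y) = (1/2) *\<^sub>R (n * (n * n))" by simp
  then have neg: "pos (- (star y * y))" using pos3 by (simp add: pos_scaleR)
  then have neg': "pos (- (y * star y))" by (rule pos_neg_swap)
  \<comment> \<open>Up to sign and a factor 2, \<open>h\<close> and \<open>l\<close> are the real
    and imaginary parts of \<open>y\<close>. Their squares show that the sum is positive; as
    \<open>- (y * star y)\<close> is positive too, so is \<open>star y * y\<close>, which has both
    signs and vanishes.\<close>
  have "pos (star y * y + y * star y)"
  proof -
    define h where "h = y + star y"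
    define l where "l = scaleC \<i> (y - star y)"
    have "star h = h" by (simp add: h_def star_add star_star add.commute)
    moreover have "star l = l"
      by (simp add: l_def scaleC_i star_diff star_star)
    ultimately have "pos (h * h + l * l)" by (intro pos_add pos_square)
    moreover have "h * h + l * l = 2 *\<^sub>R (star y * y + y * star y)"
      by (simp add: h_def l_def scaleC_i algebra_simps scaleR_2)
    ultimately have "pos (2 *\<^sub>R (star y * y + y * star y))" by (simp only:)
    then have "pos ((1/2) *\<^sub>R (2 *\<^sub>R (star y * y + y * star y)))" by (rule pos_scaleR) simp
    then show ?thesis by simp
  qed
  then have "pos ((star y * y + y * star y) + - (y * star y))" by (rule pos_add[OF _ neg'])
  then have "pos (star y * y)" by simp
  then have "star y * y = 0" using neg by (intro pos_antisym)
  then have "n * (n * n) = 0" using yy by simp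
  then have "star (n * n) * (n * n) = 0" by (simp add: star_mult sn mult.assoc)
  then have "n * n = 0" using cstar_identity[of "n * n"] by simp
  then have "n = 0" using cstar_identity[of n] sn by simp
  then have "m = a" unfolding n_def by (simp only: right_minus_eq)
  then have "pos a" using m(1) by (simp only:)
  then show ?thesis unfolding a_def .
qed

section \<open>The standard module as a Banach space\<close>

lemma pos_conj:
  assumes "pos p"
  shows "pos (star c * p * c)"
proof -
  obtain q where q: "pos q" "q * q = p" "\<forall>z. z * p = p * z \<longrightarrow> z * q = q * z"
    by (rule pos_sqrt[OF assms])
  have "star c * p * c = star (q * c) * (q * c)"
    by (simp add: star_mult pos_selfadjoint[OF q(1)] q(2)[symmetric] mult.assoc)
  then show ?thesis by (simp only: pos_star_mult)
qed

text \<open>Expand the inner square of \<open>l *\<^sub>R (x i * A) - y i\<close>, where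
  \<open>A\<close> is the inner product, and replace \<open>X\<close> by a scalar bound
  \<open>s\<close>. The value \<open>l = 1 / s\<close> maximises the resulting coefficient
  \<open>2 * l - l * l * s\<close> of \<open>star A * A\<close>.\<close>

theorem Cauchy_Schwarz_cstar:
  fixes x y :: "'i \<Rightarrow> 'a::unital_cstar_algebra"
  shows "(norm (\<Sum>i\<in>I. star (x i) * y i))\<^sup>2
    \<le> norm (\<Sum>i\<in>I. star (x i) * x i) * norm (\<Sum>i\<in>I. star (y i) * y i)"
proof -
  define A where "A = (\<Sum>i\<in>I. star (x i) * y i)"
  define X where "X = (\<Sum>i\<in>I. star (x i) * x i)"
  define Y where "Y = (\<Sum>i\<in>I. star (y i) * y i)"
  have sA: "star A = (\<Sum>i\<in>I. star (y i) * x i)"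
    by (simp add: A_def star_sum star_mult star_star)
  have pX: "pos X" unfolding X_def by (intro pos_sum pos_star_mult)
  \<comment> \<open>A strictly positive bound \<open>s\<close> instead of \<open>norm X\<close>
    keeps \<open>1 / s\<close> meaningful when \<open>X = 0\<close>; afterwards \<open>s\<close>
    tends to \<open>norm X\<close>.\<close>
  have main: "(norm A)\<^sup>2 \<le> s * norm Y" if s: "norm X \<le> s" "0 < s" for s
  proof -
    define l where "l = 1 / s"
    have "pos (\<Sum>i\<in>I. star (l *\<^sub>R (x i * A) - y i) * (l *\<^sub>R (x i * A) - y i))"
      by (intro pos_sum pos_star_mult)
    also have "(\<Sum>i\<in>I. star (l *\<^sub>R (x i * A) - y i) * (l *\<^sub>R (x i * A) - y i))
        = (\<Sum>i\<in>I. (l * l) *\<^sub>R (star A * (star (x i) * x i) * A) - l *\<^sub>R (star A * (star (x i) * y i))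
          - l *\<^sub>R ((star (y i) * x i) * A) + star (y i) * y i)"
      by (intro sum.cong refl) (simp add: star_diff star_scaleR star_mult algebra_simps)
    also have "\<dots> = (l * l) *\<^sub>R (star A * X * A) - l *\<^sub>R (star A * A) - l *\<^sub>R (star A * A) + Y"
    proof -
      have "(\<Sum>i\<in>I. (l * l) *\<^sub>R (B * (star (x i) * x i) * C) - l *\<^sub>R (B * (star (x i) * y i))
          - l *\<^sub>R ((star (y i) * x i) * C) + star (y i) * y i)
        = (l * l) *\<^sub>R (B * X * C) - l *\<^sub>R (B * (\<Sum>i\<in>I. star (x i) * y i))
          - l *\<^sub>R ((\<Sum>i\<in>I. star (y i) * x i) * C) + Y" for B C
        by (simp only: X_def Y_def sum.distrib sum_subtractf sum_distrib_left sum_distrib_right scaleR_sum_right)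
      then show ?thesis by (simp only: A_def[symmetric] sA[symmetric])
    qed
    finally have 1: "pos ((l * l) *\<^sub>R (star A * X * A) - l *\<^sub>R (star A * A) - l *\<^sub>R (star A * A) + Y)" .
    have "pos ((s - norm X) *\<^sub>R 1 + (norm X *\<^sub>R 1 - X))"
      using that by (intro pos_add pos_norm_minus pos_selfadjoint[OF pX] pos_scaleR)
        (auto intro: exI[of _ 1] simp: pos_def)
    then have "pos (s *\<^sub>R 1 - X)" by (simp add: algebra_simps)
    then have "pos ((l * l) *\<^sub>R (star A * (s *\<^sub>R 1 - X) * A))"
      by (intro pos_scaleR pos_conj) auto
    then have "pos ((l * l) *\<^sub>R (star A * (s *\<^sub>R 1 - X) * A)
      + ((l * l) *\<^sub>R (star A * X * A) - l *\<^sub>R (star A * A) - l *\<^sub>R (star A * A) + Y))"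
      by (rule pos_add[OF _ 1])
    also have "(l * l) *\<^sub>R (star A * (s *\<^sub>R 1 - X) * A)
      + ((l * l) *\<^sub>R (star A * X * A) - l *\<^sub>R (star A * A) - l *\<^sub>R (star A * A) + Y)
      = Y - (2 * l - l * l * s) *\<^sub>R (star A * A)"
      by (simp add: algebra_simps scaleR_2[symmetric])
    also have "2 * l - l * l * s = l" using s by (simp add: l_def)
    finally have "pos (Y - l *\<^sub>R (star A * A))" .
    moreover have "pos (l *\<^sub>R (star A * A))" using s by (intro pos_scaleR pos_star_mult) (simp add: l_def)
    ultimately have "norm (l *\<^sub>R (star A * A)) \<le> norm Y" by (intro norm_mono_pos)
    then have "l * (norm A)\<^sup>2 \<le> norm Y" using s by (simp add: cstar_identity l_def)
    then show ?thesis using s by (simp add: l_def field_simps)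
  qed
  have "(norm A)\<^sup>2 \<le> norm X * norm Y"
  proof (rule field_le_epsilon)
    fix e :: real assume e: "0 < e"
    define d where "d = e / (norm Y + 1)"
    have Y1: "norm Y + 1 > 0" by (simp add: add_nonneg_pos)
    then have d: "d > 0" using e by (simp add: d_def)
    have "(norm A)\<^sup>2 \<le> (norm X + d) * norm Y"
      using d by (intro main) (auto simp: add_nonneg_pos)
    moreover have "d * norm Y \<le> e" using e Y1 by (simp add: d_def field_simps)
    ultimately show "(norm A)\<^sup>2 \<le> norm X * norm Y + e" by (simp add: algebra_simps)
  qed
  then show ?thesis unfolding A_def X_def Y_def .
qed

text \<open>The norm of the Hilbert module of columns indexed by \<open>I\<close>. Questions about
  \<open>ell2\<close> are reduced to finite \<open>I\<close>, where positivity applies without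
  limits.\<close>

definition colnorm :: "'i set \<Rightarrow> ('i \<Rightarrow> 'a::unital_cstar_algebra) \<Rightarrow> real" where
  "colnorm I x = sqrt (norm (\<Sum>i\<in>I. star (x i) * x i))"

lemma colnorm_triangle: "colnorm I (\<lambda>i. x i + y i) \<le> colnorm I x + colnorm I y"
proof -
  define A where "A = (\<Sum>i\<in>I. star (x i) * y i)"
  define X where "X = (\<Sum>i\<in>I. star (x i) * x i)"
  define Y where "Y = (\<Sum>i\<in>I. star (y i) * y i)"
  have sA: "star A = (\<Sum>i\<in>I. star (y i) * x i)"
    by (simp add: A_def star_sum star_mult star_star)
  have eq: "(\<Sum>i\<in>I. star (x i + y i) * (x i + y i)) = X + A + (star A + Y)"
    unfolding sA unfolding X_def Y_def A_def sum.distrib[symmetric]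
    by (intro sum.cong refl) (simp add: star_add algebra_simps)
  have "(norm A)\<^sup>2 \<le> norm X * norm Y"
    unfolding A_def X_def Y_def by (rule Cauchy_Schwarz_cstar)
  then have "norm A \<le> sqrt (norm X) * sqrt (norm Y)"
    by (metis real_le_rsqrt real_sqrt_mult)
  moreover have "norm (X + A + (star A + Y)) \<le> (norm X + norm A) + (norm (star A) + norm Y)"
    by (intro order_trans[OF norm_triangle_ineq] add_mono norm_triangle_ineq)
  ultimately have "norm (X + A + (star A + Y)) \<le> (sqrt (norm X) + sqrt (norm Y))\<^sup>2"
    by (simp add: norm_star power2_sum)
  then show ?thesis unfolding colnorm_def eq X_def[symmetric] Y_def[symmetric]
    by (intro real_le_lsqrt) auto
qed

lemma norm_sum_star_mono:
  assumes "finite J" "I \<subseteq> J"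
  shows "norm (\<Sum>i\<in>I. star (x i) * x i) \<le> norm (\<Sum>i\<in>J. star (x i) * (x i :: 'a::unital_cstar_algebra))"
proof (rule norm_mono_pos)
  have "(\<Sum>i\<in>J. star (x i) * x i) - (\<Sum>i\<in>I. star (x i) * x i) = (\<Sum>i\<in>J-I. star (x i) * x i)"
    using assms by (simp add: sum_diff)
  then show "pos ((\<Sum>i\<in>J. star (x i) * x i) - (\<Sum>i\<in>I. star (x i) * x i))"
    by (simp add: pos_sum pos_star_mult)
qed (intro pos_sum pos_star_mult)

lemma colnorm_mono: "finite J \<Longrightarrow> I \<subseteq> J \<Longrightarrow> colnorm I x \<le> colnorm J x"
  by (simp add: colnorm_def norm_sum_star_mono)

lemma colnorm_singleton [simp]: "colnorm {i} x = norm (x i)"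
  by (simp add: colnorm_def cstar_identity)

lemma colnorm_mult_right: "colnorm I (\<lambda>i. x i * a) \<le> colnorm I x * norm a"
proof -
  let ?X = "\<Sum>i\<in>I. star (x i) * x i"
  have "(\<Sum>i\<in>I. star (x i * a) * (x i * a)) = star a * ?X * a"
    by (simp add: sum_distrib_left sum_distrib_right star_mult mult.assoc)
  moreover have "norm (star a * ?X * a) \<le> norm (star a) * norm ?X * norm a"
    by (intro order_trans[OF norm_mult_ineq] mult_right_mono norm_mult_ineq) auto
  ultimately have "norm (\<Sum>i\<in>I. star (x i * a) * (x i * a)) \<le> norm ?X * (norm a)\<^sup>2"
    by (simp add: norm_star power2_eq_square ac_simps)
  then have "colnorm I (\<lambda>i. x i * a) \<le> sqrt (norm ?X * (norm a)\<^sup>2)"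
    unfolding colnorm_def by (rule real_sqrt_le_mono)
  then show ?thesis by (simp add: colnorm_def real_sqrt_mult)
qed

lemma colnorm_scaleR: "colnorm I (\<lambda>i. r *\<^sub>R x i) = \<bar>r\<bar> * colnorm I x"
proof -
  have "(\<Sum>i\<in>I. star (r *\<^sub>R x i) * (r *\<^sub>R x i)) = (r * r) *\<^sub>R (\<Sum>i\<in>I. star (x i) * x i)"
    by (simp add: star_scaleR scaleR_sum_right)
  then show ?thesis by (simp add: colnorm_def real_sqrt_mult)
qed

section \<open>Square summable sequences\<close>

abbreviation (input) sqsum :: "(nat \<Rightarrow> 'a::unital_cstar_algebra) \<Rightarrow> bool" where
  "sqsum x \<equiv> summable (\<lambda>n. star (x n) * x n)"

text \<open>Tails are measured by \<open>colnorm\<close> because it satisfies the triangle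
  inequality. Closure under sums follows at once, whereas the defining series of a sum contains
  cross terms.\<close>

lemma sqsum_Cauchy:
  "sqsum x \<longleftrightarrow> (\<forall>e>0. \<exists>N. \<forall>m\<ge>N. \<forall>n. colnorm {m..<n} x < e)"
proof
  assume s: "sqsum x"
  show "\<forall>e>0. \<exists>N. \<forall>m\<ge>N. \<forall>n. colnorm {m..<n} x < e"
  proof (intro allI impI)
    fix e :: real assume e: "e > 0"
    then obtain N where N: "\<forall>m\<ge>N. \<forall>n. norm (\<Sum>i\<in>{m..<n}. star (x i) * x i) < e\<^sup>2"
      using s unfolding summable_Cauchy by (meson zero_less_power)
    then have "\<forall>m\<ge>N. \<forall>n. colnorm {m..<n} x < e"
      unfolding colnorm_def using e by (auto intro!: real_less_lsqrt)
    then show "\<exists>N. \<forall>m\<ge>N. \<forall>n. colnorm {m..<n} x < e" by blast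
  qed
next
  assume s: "\<forall>e>0. \<exists>N. \<forall>m\<ge>N. \<forall>n. colnorm {m..<n} x < e"
  show "sqsum x"
    unfolding summable_Cauchy
  proof (intro allI impI)
    fix e :: real assume e: "e > 0"
    then obtain N where N: "\<forall>m\<ge>N. \<forall>n. colnorm {m..<n} x < sqrt e"
      using s by (meson real_sqrt_gt_zero)
    then show "\<exists>N. \<forall>m\<ge>N. \<forall>n. norm (\<Sum>i\<in>{m..<n}. star (x i) * x i) < e"
      unfolding colnorm_def by (intro exI[of _ N]) auto
  qed
qed

lemma sqsum_add:
  assumes "sqsum x" "sqsum y" shows "sqsum (\<lambda>n. x n + y n)"
  unfolding sqsum_Cauchy
proof (intro allI impI)
  fix e :: real assume e: "e > 0"
  obtain N where N: "\<forall>m\<ge>N. \<forall>n. colnorm {m..<n} x < e/2"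
    using assms(1) e unfolding sqsum_Cauchy by (meson half_gt_zero)
  obtain M where M: "\<forall>m\<ge>M. \<forall>n. colnorm {m..<n} y < e/2"
    using assms(2) e unfolding sqsum_Cauchy by (meson half_gt_zero)
  have "colnorm {m..<n} (\<lambda>n. x n + y n) < e" if "m \<ge> max M N" for m n
    using colnorm_triangle[of "{m..<n}" x y] N[rule_format, of m n] M[rule_format, of m n] that by simp
  then show "\<exists>N. \<forall>m\<ge>N. \<forall>n. colnorm {m..<n} (\<lambda>n. x n + y n) < e" by blast
qed

lemma sqsum_mult_right: "sqsum x \<Longrightarrow> sqsum (\<lambda>n. x n * a)"
  using summable_mult[OF summable_mult2, of "\<lambda>n. star (x n) * x n" "star a" a]
  by (simp add: star_mult mult.assoc)

lemma sqsum_scaleR: "sqsum x \<Longrightarrow> sqsum (\<lambda>n. r *\<^sub>R x n)"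
  using sqsum_mult_right[of x "r *\<^sub>R 1"] by simp

lemma hnorm_ell2: "hnorm ell2 x = sqrt (norm (\<Sum>n. star (x n) * x n))"
  by (simp add: hnorm_def ell2_def)

lemma hcarrier_ell2: "x \<in> hcarrier ell2 \<longleftrightarrow> sqsum x"
  by (simp add: ell2_def)

lemma act_ell2: "act ell2 x a = (\<lambda>n. x n * a)"
  by (simp add: ell2_def)

lemma colnorm_LIMSEQ: "sqsum x \<Longrightarrow> (\<lambda>n. colnorm {..<n} x) \<longlonglongrightarrow> hnorm ell2 x"
  unfolding hnorm_ell2 colnorm_def
  by (intro tendsto_real_sqrt tendsto_norm summable_LIMSEQ)

lemma colnorm_le_hnorm:
  assumes "sqsum x" "finite I" shows "colnorm I x \<le> hnorm ell2 x"
proof (rule LIMSEQ_le_const[OF colnorm_LIMSEQ[OF assms(1)]])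
  obtain m where "I \<subseteq> {..<m}" using assms(2) finite_nat_iff_bounded by blast
  then have "colnorm I x \<le> colnorm {..<n} x" if "n \<ge> m" for n
    using that by (intro colnorm_mono) auto
  then show "\<exists>N. \<forall>n\<ge>N. colnorm I x \<le> colnorm {..<n} x" by blast
qed

lemma hnorm_ell2_le:
  assumes "sqsum x" "\<And>n. colnorm {..<n} x \<le> K" shows "hnorm ell2 x \<le> K"
  by (rule LIMSEQ_le_const2[OF colnorm_LIMSEQ[OF assms(1)]]) (use assms(2) in auto)

text \<open>A type instead of a carrier set, so that results on Banach spaces, such as the fixed
  point and category theorems, apply directly.\<close>

typedef (overloaded) ('a::unital_cstar_algebra) l2 = "hcarrier (ell2 :: ('a, nat \<Rightarrow> 'a) hilbert_mod)"
  morphisms l2_nth Abs_l2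
  by (rule exI[of _ "\<lambda>n. 0"]) (simp add: hcarrier_ell2)

setup_lifting type_definition_l2

lemma sqsum_l2_nth: "sqsum (l2_nth x)"
  using l2_nth[of x] by (simp add: hcarrier_ell2)

lemma l2_eqI: "(\<And>n. l2_nth x n = l2_nth y n) \<Longrightarrow> x = y"
  by (simp add: l2_nth_inject[symmetric] fun_eq_iff)

instantiation l2 :: (unital_cstar_algebra) real_normed_vector
begin

lift_definition zero_l2 :: "'a l2" is "\<lambda>n. 0" by (simp add: hcarrier_ell2)
lift_definition plus_l2 :: "'a l2 \<Rightarrow> 'a l2 \<Rightarrow> 'a l2" is "\<lambda>x y n. x n + y n"
  by (simp add: hcarrier_ell2 sqsum_add)
lift_definition minus_l2 :: "'a l2 \<Rightarrow> 'a l2 \<Rightarrow> 'a l2" is "\<lambda>x y n. x n - y n"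
  subgoal for x y
    using sqsum_add[of x "\<lambda>n. (-1) *\<^sub>R y n"] sqsum_scaleR[of y "-1"] by (simp add: hcarrier_ell2)
  done
lift_definition uminus_l2 :: "'a l2 \<Rightarrow> 'a l2" is "\<lambda>x n. - x n"
  by (simp add: hcarrier_ell2 star_minus)
lift_definition scaleR_l2 :: "real \<Rightarrow> 'a l2 \<Rightarrow> 'a l2" is "\<lambda>r x n. r *\<^sub>R x n"
  subgoal for r x using sqsum_scaleR[of x r] by (simp add: hcarrier_ell2)
  done
lift_definition norm_l2 :: "'a l2 \<Rightarrow> real" is "hnorm ell2" .

definition "dist_l2 (x::'a l2) y = norm (x - y)"
definition "uniformity_l2 = (INF e\<in>{0 <..}. principal {(x::'a l2, y). dist x y < e})"
definition "open_l2 (S :: 'a l2 set) = (\<forall>x\<in>S. \<forall>\<^sub>F (x', y) in uniformity. x' = x \<longrightarrow> y \<in> S)"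
definition "sgn_l2 (x::'a l2) = inverse (norm x) *\<^sub>R x"

lemma l2_nth_simps [simp]:
  "l2_nth (x + y) n = l2_nth x n + l2_nth y n" "l2_nth (x - y) n = l2_nth x n - l2_nth y n"
  "l2_nth (- x) n = - l2_nth x n" "l2_nth (r *\<^sub>R x) n = r *\<^sub>R l2_nth x n" "l2_nth 0 n = 0"
  by (transfer; simp)+

lemma colnorm_le_norm_l2: "finite I \<Longrightarrow> colnorm I (l2_nth x) \<le> norm x"
  unfolding norm_l2.rep_eq by (rule colnorm_le_hnorm[OF sqsum_l2_nth])

lemma norm_l2_le: "(\<And>n. colnorm {..<n} (l2_nth x) \<le> K) \<Longrightarrow> norm x \<le> K"
  unfolding norm_l2.rep_eq by (rule hnorm_ell2_le[OF sqsum_l2_nth])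

lemma norm_l2_nth_le: "norm (l2_nth x n) \<le> norm x"
  using colnorm_le_norm_l2[of "{n}" x] by simp

instance
proof
  fix x y :: "'a l2" and r s :: real
  show "norm (x + y) \<le> norm x + norm y"
  proof (rule norm_l2_le)
    fix n
    have "colnorm {..<n} (l2_nth (x + y)) \<le> colnorm {..<n} (l2_nth x) + colnorm {..<n} (l2_nth y)"
      using colnorm_triangle[of "{..<n}" "l2_nth x" "l2_nth y"] by (simp add: colnorm_def)
    also have "\<dots> \<le> norm x + norm y" by (intro add_mono colnorm_le_norm_l2) auto
    finally show "colnorm {..<n} (l2_nth (x + y)) \<le> norm x + norm y" .
  qed
  have le: "norm (r *\<^sub>R x) \<le> \<bar>r\<bar> * norm x" for r and x :: "'a l2"
  proof (rule norm_l2_le)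
    fix n
    have "colnorm {..<n} (l2_nth (r *\<^sub>R x)) = \<bar>r\<bar> * colnorm {..<n} (l2_nth x)"
      using colnorm_scaleR[of "{..<n}" r "l2_nth x"] by (simp add: colnorm_def)
    then show "colnorm {..<n} (l2_nth (r *\<^sub>R x)) \<le> \<bar>r\<bar> * norm x"
      by (simp add: mult_left_mono colnorm_le_norm_l2)
  qed
  show "norm (r *\<^sub>R x) = \<bar>r\<bar> * norm x"
  proof (cases "r = 0")
    case True
    then show ?thesis using le[of 0 x] colnorm_le_norm_l2[of "{}" "0 *\<^sub>R x"] by (simp add: colnorm_def)
  next
    case False
    have "(1/r) *\<^sub>R (r *\<^sub>R x) = x" using False by (intro l2_eqI) simp
    then have "norm x \<le> \<bar>1/r\<bar> * norm (r *\<^sub>R x)" using le[of "1/r" "r *\<^sub>R x"] by simp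
    then have "\<bar>r\<bar> * norm x \<le> norm (r *\<^sub>R x)" using False by (simp add: field_simps abs_divide)
    then show ?thesis using le[of r x] by simp
  qed
  show "norm x = 0 \<longleftrightarrow> x = 0"
  proof
    assume "norm x = 0"
    then have "norm (l2_nth x n) \<le> 0" for n using norm_l2_nth_le[of x n] by simp
    then show "x = 0" by (intro l2_eqI) simp
  next
    show "x = 0 \<Longrightarrow> norm x = 0"
      by (simp add: norm_l2.rep_eq hnorm_ell2)
  qed
qed (auto intro!: l2_eqI simp: dist_l2_def uniformity_l2_def open_l2_def sgn_l2_def
    algebra_simps)

end

instance l2 :: (unital_cstar_algebra) banach
proof
  fix X :: "nat \<Rightarrow> 'a l2" assume C: "Cauchy X"
  have "Cauchy (\<lambda>k. l2_nth (X k) n)" for n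
  proof (rule CauchyI)
    fix e :: real assume "e > 0"
    then obtain N where N: "\<forall>k\<ge>N. \<forall>l\<ge>N. norm (X k - X l) < e" using C CauchyD by blast
    have "norm (l2_nth (X k) n - l2_nth (X l) n) < e" if "k \<ge> N" "l \<ge> N" for k l
      using norm_l2_nth_le[of "X k - X l" n] N[rule_format, OF that] by simp
    then show "\<exists>N. \<forall>k\<ge>N. \<forall>l\<ge>N. norm (l2_nth (X k) n - l2_nth (X l) n) < e" by blast
  qed
  then have "\<exists>z. (\<lambda>k. l2_nth (X k) n) \<longlonglongrightarrow> z" for n
    by (meson Cauchy_convergent convergent_def)
  then obtain x where x: "\<And>n. (\<lambda>k. l2_nth (X k) n) \<longlonglongrightarrow> x n" by metis
  \<comment> \<open>For each finite \<open>I\<close> let \<open>l\<close> tend to infinity in the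
    Cauchy condition. The index \<open>N\<close> is independent of \<open>I\<close>, which gives
    both the square summability of the coordinatewise limit and convergence in norm.\<close>
  have tail: "\<exists>N. \<forall>k\<ge>N. \<forall>I. finite I \<longrightarrow> colnorm I (\<lambda>n. l2_nth (X k) n - x n) \<le> e" if e: "e > 0" for e
  proof -
    obtain N where N: "\<forall>k\<ge>N. \<forall>l\<ge>N. norm (X k - X l) < e" using C CauchyD e by blast
    have "colnorm I (\<lambda>n. l2_nth (X k) n - x n) \<le> e" if "k \<ge> N" "finite I" for k I
    proof (rule LIMSEQ_le_const2)
      show "(\<lambda>l. colnorm I (\<lambda>n. l2_nth (X k) n - l2_nth (X l) n)) \<longlonglongrightarrow> colnorm I (\<lambda>n. l2_nth (X k) n - x n)"
        unfolding colnorm_def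
        by (intro tendsto_intros x bounded_linear.tendsto[OF bounded_linear_star])
      have "colnorm I (\<lambda>n. l2_nth (X k) n - l2_nth (X l) n) \<le> e" if "l \<ge> N" for l
      proof -
        have "colnorm I (l2_nth (X k - X l)) \<le> norm (X k - X l)"
          by (rule colnorm_le_norm_l2) (rule \<open>finite I\<close>)
        then show ?thesis using N[rule_format, OF \<open>k \<ge> N\<close> that] by (simp add: colnorm_def)
      qed
      then show "\<exists>N. \<forall>l\<ge>N. colnorm I (\<lambda>n. l2_nth (X k) n - l2_nth (X l) n) \<le> e" by blast
    qed
    then show ?thesis by blast
  qed
  have "sqsum x" unfolding sqsum_Cauchy
  proof (intro allI impI)
    fix e :: real assume e: "e > 0"
    then obtain k where k: "\<forall>I. finite I \<longrightarrow> colnorm I (\<lambda>n. l2_nth (X k) n - x n) \<le> e / 2"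
      using tail[of "e/2"] by auto
    obtain N where N: "\<forall>m\<ge>N. \<forall>n. colnorm {m..<n} (l2_nth (X k)) < e / 2"
      using sqsum_l2_nth[of "X k"] e unfolding sqsum_Cauchy by (meson half_gt_zero)
    have "colnorm {m..<n} x < e" if "m \<ge> N" for m n
    proof -
      have "colnorm {m..<n} (\<lambda>i. l2_nth (X k) i + (-1) *\<^sub>R (l2_nth (X k) i - x i))
        \<le> colnorm {m..<n} (l2_nth (X k)) + colnorm {m..<n} (\<lambda>i. (-1) *\<^sub>R (l2_nth (X k) i - x i))"
        by (rule colnorm_triangle)
      moreover have "colnorm {m..<n} (\<lambda>i. (-1) *\<^sub>R (l2_nth (X k) i - x i)) \<le> e / 2"
        unfolding colnorm_scaleR using k by simp
      ultimately show ?thesis using N[rule_format, OF that, of n] by simp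
    qed
    then show "\<exists>N. \<forall>m\<ge>N. \<forall>n. colnorm {m..<n} x < e" by blast
  qed
  then have nth: "l2_nth (Abs_l2 x) = x" by (simp add: Abs_l2_inverse hcarrier_ell2)
  have "X \<longlonglongrightarrow> Abs_l2 x"
  proof (rule LIMSEQ_I)
    fix e :: real assume e: "e > 0"
    then obtain N where N: "\<forall>k\<ge>N. \<forall>I. finite I \<longrightarrow> colnorm I (\<lambda>n. l2_nth (X k) n - x n) \<le> e / 2"
      using tail[of "e/2"] by auto
    have "norm (X k - Abs_l2 x) < e" if "k \<ge> N" for k
    proof -
      have "norm (X k - Abs_l2 x) \<le> e / 2"
        using N that by (intro norm_l2_le) (simp add: nth colnorm_def)
      then show ?thesis using e by simp
    qed
    then show "\<exists>N. \<forall>k\<ge>N. norm (X k - Abs_l2 x) < e" by blast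
  qed
  then show "convergent X" by (auto simp: convergent_def)
qed

section \<open>Bounded module maps and open mappings\<close>

text \<open>The category argument is run in the subspace topology of \<open>U\<close>, since
  \<open>f\<close> is onto \<open>U\<close> only from \<open>S\<close>. Closedness of
  \<open>U\<close> provides the Baire property, closedness of \<open>S\<close> keeps the limit of
  the partial sums inside \<open>S\<close>.\<close>

theorem open_mapping_closed_subspaces:
  fixes f :: "'x::banach \<Rightarrow> 'y::banach"
  assumes f: "bounded_linear f"
    and S: "closed S" "subspace S" and U: "closed U" "subspace U" and im: "f ` S = U"
  obtains C where "C > 0" "\<forall>y\<in>U. \<exists>x\<in>S. f x = y \<and> norm x \<le> C * norm y"
proof -
  interpret f: bounded_linear f by (rule f)
  define T where "T n = closure (f ` (S \<inter> cball 0 (real n)))" for n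
  have TU: "T n \<subseteq> U" for n
    unfolding T_def using im U by (intro closure_minimal) auto
  have "U \<subseteq> \<Union>(range T)"
  proof
    fix y assume "y \<in> U"
    then obtain x where x: "x \<in> S" "y = f x" using im by blast
    obtain n where "norm x \<le> real n" using real_arch_simple by blast
    then have "y \<in> T n" unfolding T_def using x by (intro subsetD[OF closure_subset]) auto
    then show "y \<in> \<Union>(range T)" by blast
  qed
  then have UT: "\<Union>(range T) = U" using TU by blast
  have "\<exists>n. top_of_set U interior_of (T n) \<noteq> {}"
  proof (rule ccontr)
    assume *: "\<nexists>n. top_of_set U interior_of (T n) \<noteq> {}"
    have "top_of_set U interior_of \<Union>(range T) = {}"
    proof (rule Baire_category_alt)
      show "completely_metrizable_space (top_of_set U) \<or> locally_compact_space (top_of_set U) \<and> regular_space (top_of_set U)"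
        using completely_metrizable_space_closedin[OF completely_metrizable_space_euclidean, of U] U by simp
      show "closedin (top_of_set U) V \<and> top_of_set U interior_of V = {}" if V: "V \<in> range T" for V
      proof -
        obtain n where "V = T n" using V by blast
        then show ?thesis using * closed_subset[OF TU[of n]] by (simp add: T_def)
      qed
    qed simp
    moreover have "top_of_set U interior_of U = U"
      using interior_of_topspace[of "top_of_set U"] by simp
    ultimately show False using UT subspace_0[OF U(2)] by simp
  qed
  then obtain n y0 where "y0 \<in> top_of_set U interior_of (T n)" by blast
  then obtain V where V: "openin (top_of_set U) V" "y0 \<in> V" "V \<subseteq> T n"
    by (auto simp: interior_of_def)
  then have y0: "y0 \<in> U" using openin_imp_subset by blast
  obtain r where r: "r > 0" "ball y0 r \<inter> U \<subseteq> V"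
    using V(1,2) openin_contains_ball[of U V] by blast
  \<comment> \<open>The approximant below is a difference of two vectors of norm at most n, divided
    by \<open>c\<close>; using n + 1 keeps \<open>M\<close> positive.\<close>
  define M where "M = 4 * (real n + 1) / r"
  have M: "M > 0" using r by (simp add: M_def)
  have approx: "\<exists>x\<in>S. norm x \<le> M * norm y \<and> norm (y - f x) \<le> norm y / 2" if y: "y \<in> U" for y
  proof (cases "y = 0")
    case True
    then show ?thesis using subspace_0[OF S(2)] by (intro bexI[of _ 0]) auto
  next
    case False
    define c where "c = r / (2 * norm y)"
    have c: "c > 0" using False r by (simp add: c_def)
    have nc: "norm (c *\<^sub>R y) = r / 2" using False r by (simp add: c_def)
    have "y0 + c *\<^sub>R y \<in> ball y0 r \<inter> U"
      using y0 y U(2) nc r(1) by (auto simp: dist_norm intro: subspace_add subspace_scale)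
    then have 1: "y0 + c *\<^sub>R y \<in> T n" using r(2) V(3) by blast
    have 2: "y0 \<in> T n" using V by blast
    \<comment> \<open>Two errors below \<open>r / 8\<close>, divided by
      \<open>c = r / (2 * norm y)\<close>, add up to at most half of \<open>norm y\<close>.\<close>
    define e where "e = r / 8"
    have e: "e > 0" using r by (simp add: e_def)
    obtain x1 where x1: "x1 \<in> S" "norm x1 \<le> real n" "dist (f x1) (y0 + c *\<^sub>R y) < e"
      using 1 e unfolding T_def closure_approachable by auto
    obtain x2 where x2: "x2 \<in> S" "norm x2 \<le> real n" "dist (f x2) y0 < e"
      using 2 e unfolding T_def closure_approachable by auto
    define x where "x = (1/c) *\<^sub>R (x1 - x2)"
    have "x \<in> S" using x1 x2 S(2) by (simp add: x_def subspace_diff subspace_scale)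
    moreover have "norm x \<le> M * norm y"
    proof -
      have "norm (x1 - x2) \<le> 2 * (real n + 1)" using x1 x2 norm_triangle_ineq4[of x1 x2] by simp
      then have "norm x \<le> (1/c) * (2 * (real n + 1))" using c by (simp add: x_def divide_right_mono)
      also have "\<dots> = M * norm y" using False r by (simp add: c_def M_def field_simps)
      finally show ?thesis .
    qed
    moreover have "norm (y - f x) \<le> norm y / 2"
    proof -
      have "c *\<^sub>R (y - f x) = (f x2 - y0) - (f x1 - (y0 + c *\<^sub>R y))"
        using c by (simp add: x_def f.scale f.diff algebra_simps)
      then have "norm (c *\<^sub>R (y - f x)) \<le> norm (f x2 - y0) + norm (f x1 - (y0 + c *\<^sub>R y))"
        by (simp only: norm_triangle_ineq4)
      then have "c * norm (y - f x) \<le> 2 * e" using x1 x2 c by (simp add: dist_norm)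
      then show ?thesis using c False r by (simp add: c_def e_def field_simps)
    qed
    ultimately show ?thesis by blast
  qed
  then obtain g where g: "\<And>y. y \<in> U \<Longrightarrow> g y \<in> S" "\<And>y. y \<in> U \<Longrightarrow> norm (g y) \<le> M * norm y"
    "\<And>y. y \<in> U \<Longrightarrow> norm (y - f (g y)) \<le> norm y / 2" by metis
  have "\<exists>x\<in>S. f x = y \<and> norm x \<le> (2 * M) * norm y" if y: "y \<in> U" for y
  proof -
    \<comment> \<open>Successive residuals. Their norms halve at each step, so the approximants are
      dominated by a geometric series and sum to an exact preimage.\<close>
    define s where "s = rec_nat y (\<lambda>_ z. z - f (g z))"
    have s: "s 0 = y" "s (Suc k) = s k - f (g (s k))" for k by (simp_all add: s_def)
    have sU: "s k \<in> U" for k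
    proof (induction k)
      case (Suc k)
      then have "f (g (s k)) \<in> U" using g(1) im by blast
      then show ?case using Suc U(2) by (simp add: s subspace_diff)
    qed (simp add: s y)
    have sn: "norm (s k) \<le> norm y * (1/2) ^ k" for k
    proof (induction k)
      case (Suc k)
      then show ?case using g(3)[OF sU[of k]] by (simp add: s)
    qed (simp add: s)
    have gn: "norm (g (s k)) \<le> (M * norm y) * (1/2) ^ k" for k
      using order_trans[OF g(2)[OF sU[of k]] mult_left_mono[OF sn[of k], of M]] M
      by (simp add: mult.assoc)
    have geo: "(\<lambda>k. (M * norm y) * (1/2) ^ k) sums ((M * norm y) * 2)"
      using sums_mult[OF geometric_sums[of "1/2::real"], of "M * norm y"] by simp
    then have sm: "summable (\<lambda>k. g (s k))"
      by (intro summable_comparison_test'[OF sums_summable gn])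
    define x where "x = (\<Sum>k. g (s k))"
    have "x \<in> S"
    proof -
      have "(\<lambda>m. \<Sum>k<m. g (s k)) \<longlonglongrightarrow> x" unfolding x_def by (rule summable_LIMSEQ[OF sm])
      then show ?thesis
        by (rule closed_sequentially[OF S(1), rotated]) (intro subspace_sum S g sU)
    qed
    moreover have "f x = y"
    proof -
      have "(\<lambda>k. f (g (s k))) sums f x"
        unfolding x_def by (intro f.sums summable_sums sm)
      moreover have "s \<longlonglongrightarrow> 0"
      proof (rule Lim_null_comparison)
        show "\<forall>\<^sub>F k in sequentially. norm (s k) \<le> norm y * (1/2) ^ k" using sn by simp
        show "(\<lambda>k. norm y * (1/2) ^ k) \<longlonglongrightarrow> 0"
          by (intro tendsto_mult_right_zero LIMSEQ_power_zero) simp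
      qed
      then have "(\<lambda>k. s k - s (Suc k)) sums (s 0 - 0)" by (rule telescope_sums')
      then have "(\<lambda>k. f (g (s k))) sums y" by (simp add: s)
      ultimately show ?thesis by (rule sums_unique2)
    qed
    moreover have "norm x \<le> (M * norm y) * 2"
    proof -
      have sn': "summable (\<lambda>k. norm (g (s k)))"
        by (rule summable_comparison_test'[OF sums_summable[OF geo]]) (use gn in auto)
      have "norm x \<le> (\<Sum>k. norm (g (s k)))" unfolding x_def by (rule summable_norm[OF sn'])
      also have "\<dots> \<le> (\<Sum>k. (M * norm y) * (1/2) ^ k)"
        by (intro suminf_le gn sn' sums_summable[OF geo])
      finally show ?thesis using sums_unique[OF geo] by simp
    qed
    ultimately show ?thesis by (intro bexI[of _ x]) auto
  qed
  then show ?thesis using that[of "2 * M"] M by simp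
qed

text \<open>Only the norm and the action are kept, so a product may carry the norm of its product
  type. The axiom \<open>ac_real\<close> makes submodules real subspaces and maps commuting with the
  action real homogeneous.\<close>

locale banach_module =
  fixes ac :: "'x::banach \<Rightarrow> 'a::unital_cstar_algebra \<Rightarrow> 'x"
  assumes ac_add: "ac (x + y) a = ac x a + ac y a"
    and ac_add_right: "ac x (a + b) = ac x a + ac x b"
    and ac_ac: "ac (ac x a) b = ac x (a * b)"
    and ac_real: "ac x (r *\<^sub>R 1) = r *\<^sub>R x"
    and ac_norm: "norm (ac x a) \<le> norm x * norm a"

definition msub :: "('x::banach \<Rightarrow> 'a \<Rightarrow> 'x) \<Rightarrow> 'x set \<Rightarrow> bool" where
  "msub ac M \<longleftrightarrow> closed M \<and> 0 \<in> M \<and> (\<forall>x\<in>M. \<forall>y\<in>M. x + y \<in> M) \<and> (\<forall>x\<in>M. \<forall>a. ac x a \<in> M)"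

definition mlin :: "('x::banach \<Rightarrow> 'a \<Rightarrow> 'x) \<Rightarrow> ('y::banach \<Rightarrow> 'a \<Rightarrow> 'y) \<Rightarrow> ('x \<Rightarrow> 'y) \<Rightarrow> bool" where
  "mlin ac ac' f \<longleftrightarrow> bounded_linear f \<and> (\<forall>x a. f (ac x a) = ac' (f x) a)"

definition compl :: "('x::banach \<Rightarrow> 'a \<Rightarrow> 'x) \<Rightarrow> 'x set \<Rightarrow> 'x set \<Rightarrow> bool" where
  "compl ac M N \<longleftrightarrow> msub ac M \<and> msub ac N \<and> M \<inter> N = {0} \<and> (\<forall>x. \<exists>m\<in>M. \<exists>n\<in>N. x = m + n)"

text \<open>A numbered family with possible repetitions instead of a finite set: images under
  non-injective maps and concatenations keep this form.\<close>

definition mspan :: "('x::banach \<Rightarrow> 'a \<Rightarrow> 'x) \<Rightarrow> (nat \<Rightarrow> 'x) \<Rightarrow> nat \<Rightarrow> 'x set" where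
  "mspan ac g n = range (\<lambda>a. \<Sum>i<n. ac (g i) (a i))"

definition mfg :: "('x::banach \<Rightarrow> 'a \<Rightarrow> 'x) \<Rightarrow> 'x set \<Rightarrow> bool" where
  "mfg ac M \<longleftrightarrow> (\<exists>g n. M = mspan ac g n)"

text \<open>The bound for the inverse of \<open>f\<close> on \<open>M2\<close> is left to the open
  mapping theorem, see \<open>diag_inverse\<close>.\<close>

definition diag ::
  "('x::banach \<Rightarrow> 'a \<Rightarrow> 'x) \<Rightarrow> ('x \<Rightarrow> 'x) \<Rightarrow> 'x set \<Rightarrow> 'x set \<Rightarrow> 'x set \<Rightarrow> 'x set \<Rightarrow> bool" where
  "diag ac f M1 N1 M2 N2 \<longleftrightarrow> compl ac M1 N1 \<and> compl ac M2 N2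
    \<and> f ` M1 \<subseteq> M2 \<and> f ` N1 \<subseteq> N2 \<and> bij_betw f M1 M2"

text \<open>Both directions are restrictions of bounded maps of the whole module, so they compose
  without any care for domains.\<close>

definition miso :: "('x::banach \<Rightarrow> 'a \<Rightarrow> 'x) \<Rightarrow> 'x set \<Rightarrow> 'x set \<Rightarrow> bool" where
  "miso ac M N \<longleftrightarrow> (\<exists>f g. mlin ac ac f \<and> mlin ac ac g \<and> f ` M \<subseteq> N \<and> g ` N \<subseteq> M
    \<and> (\<forall>x\<in>M. g (f x) = x) \<and> (\<forall>y\<in>N. f (g y) = y))"

definition pact :: "('x \<Rightarrow> 'a \<Rightarrow> 'x) \<Rightarrow> ('y \<Rightarrow> 'a \<Rightarrow> 'y) \<Rightarrow> 'x \<times> 'y \<Rightarrow> 'a \<Rightarrow> 'x \<times> 'y" where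
  "pact ac ac' p a = (ac (fst p) a, ac' (snd p) a)"

section \<open>Calculus of bounded module maps and generalised inverses\<close>

lemma mlinD:
  assumes "mlin ac ac' f"
  shows "bounded_linear f" "f (ac x a) = ac' (f x) a" "f (x + y) = f x + f y" "f (x - y) = f x - f y"
    "f (r *\<^sub>R x) = r *\<^sub>R f x" "f 0 = 0" "f (- x) = - f x" "f (sum h I) = (\<Sum>i\<in>I. f (h i))"
proof -
  show bl: "bounded_linear f" using assms by (simp add: mlin_def)
  interpret bounded_linear f by (rule bl)
  show "f (ac x a) = ac' (f x) a" using assms by (simp add: mlin_def)
  show "f (x + y) = f x + f y" "f (x - y) = f x - f y"
    "f (r *\<^sub>R x) = r *\<^sub>R f x" "f 0 = 0" "f (- x) = - f x" "f (sum h I) = (\<Sum>i\<in>I. f (h i))"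
    by (simp_all add: add diff scaleR zero neg sum)
qed

lemma mlin_id: "mlin ac ac (\<lambda>x. x)"
  by (simp add: mlin_def bounded_linear_ident)

lemma mlin_compose: "mlin ac' ac'' f \<Longrightarrow> mlin ac ac' g \<Longrightarrow> mlin ac ac'' (\<lambda>x. f (g x))"
  by (simp add: mlin_def bounded_linear_compose)

lemma mlin_fst: "mlin ac'' (pact ac ac') f \<Longrightarrow> mlin ac'' ac (\<lambda>x. fst (f x))"
  by (simp add: mlin_def bounded_linear_fst_comp pact_def)

lemma mlin_snd: "mlin ac'' (pact ac ac') f \<Longrightarrow> mlin ac'' ac' (\<lambda>x. snd (f x))"
  by (simp add: mlin_def bounded_linear_snd_comp pact_def)

lemma mlin_Pair: "mlin ac'' ac f \<Longrightarrow> mlin ac'' ac' g \<Longrightarrow> mlin ac'' (pact ac ac') (\<lambda>x. (f x, g x))"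
  by (simp add: mlin_def bounded_linear_Pair pact_def)

context banach_module begin

lemma ac_scaleR: "ac (r *\<^sub>R x) a = r *\<^sub>R ac x a"
  using ac_ac[of x "r *\<^sub>R 1" a] ac_ac[of x a "r *\<^sub>R 1"] by (simp add: ac_real)

lemma bounded_linear_ac: "bounded_linear (\<lambda>x. ac x a)"
  by (rule bounded_linear_intro[where K = "norm a"]) (auto simp: ac_add ac_scaleR ac_norm)

lemma bounded_linear_ac_right: "bounded_linear (\<lambda>a. ac x a)"
proof (rule bounded_linear_intro[where K = "norm x"])
  fix r a
  have "ac x (r *\<^sub>R a) = ac (ac x a) (r *\<^sub>R 1)" by (simp add: ac_ac)
  then show "ac x (r *\<^sub>R a) = r *\<^sub>R ac x a" by (simp add: ac_real)
qed (use ac_norm[of x] in \<open>auto simp: ac_add_right mult.commute\<close>)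

lemma ac_arith [simp]: "ac 0 a = 0" "ac x 0 = 0" "ac x 1 = x" "ac (- x) a = - ac x a" "ac (x - y) a = ac x a - ac y a"
proof -
  interpret l: bounded_linear "\<lambda>x. ac x a" by (rule bounded_linear_ac)
  interpret r: bounded_linear "\<lambda>a. ac x a" by (rule bounded_linear_ac_right)
  show "ac 0 a = 0" "ac x 0 = 0" "ac (- x) a = - ac x a" "ac (x - y) a = ac x a - ac y a"
    by (simp_all add: l.zero r.zero l.neg l.diff)
  show "ac x 1 = x" using ac_real[of x 1] by simp
qed

lemma ac_sum_right: "ac x (sum h I) = (\<Sum>i\<in>I. ac x (h i))"
  using linear_sum[OF bounded_linear.linear[OF bounded_linear_ac_right]] .

lemma msub_subspace: "msub ac M \<Longrightarrow> subspace M"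
  unfolding subspace_def msub_def by (metis ac_real)

lemma msub_ac: "msub ac M \<Longrightarrow> x \<in> M \<Longrightarrow> ac x a \<in> M"
  by (simp add: msub_def)

lemma msub_diff: "msub ac M \<Longrightarrow> x \<in> M \<Longrightarrow> y \<in> M \<Longrightarrow> x - y \<in> M"
  by (rule subspace_diff[OF msub_subspace])

lemma mlin_add: "mlin ac' ac f \<Longrightarrow> mlin ac' ac g \<Longrightarrow> mlin ac' ac (\<lambda>x. f x + g x)"
  by (simp add: mlin_def bounded_linear_add ac_add)

lemma mlin_diff: "mlin ac' ac f \<Longrightarrow> mlin ac' ac g \<Longrightarrow> mlin ac' ac (\<lambda>x. f x - g x)"
  by (simp add: mlin_def bounded_linear_sub)

lemma mlin_zero: "mlin ac' ac (\<lambda>x. 0)"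
  by (simp add: mlin_def bounded_linear_zero)

lemma msub_eq:
  assumes "mlin ac ac' f" "mlin ac ac' g" shows "msub ac {x. f x = g x}"
  unfolding msub_def using assms
  by (auto simp: mlinD intro!: closed_Collect_eq linear_continuous_on dest: mlinD(1))

text \<open>\<open>R y\<close> is the fixed point of the contraction sending x to y + E x.
  Uniqueness of fixed points gives additivity, homogeneity and compatibility with the
  action.\<close>

lemma neumann:
  assumes E: "mlin ac ac E" and c: "\<And>x. norm (E x) \<le> c * norm x" "0 \<le> c" "c < 1"
  obtains R where "mlin ac ac R" "\<forall>x. R (x - E x) = x" "\<forall>x. R x - E (R x) = x"
proof -
  have ex: "\<exists>!x. y + E x = x" for y
  proof (rule banach_fix_type[OF c(2,3)], intro allI)
    fix x x'
    show "dist (y + E x) (y + E x') \<le> c * dist x x'"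
      using c(1)[of "x - x'"] by (simp add: dist_norm mlinD(4)[OF E])
  qed
  define R where "R y = (THE x. y + E x = x)" for y
  have R: "y + E (R y) = R y" for y unfolding R_def by (rule theI'[OF ex])
  have uniq: "x = R y" if "y + E x = x" for x y using ex[of y] R that by blast
  have Rb: "norm (R y) \<le> norm y * (1 / (1 - c))" for y
  proof -
    have "norm (R y) \<le> norm y + c * norm (R y)"
      using R[of y] norm_triangle_ineq[of y "E (R y)"] c(1)[of "R y"] by simp
    then show ?thesis using c(3) by (simp add: field_simps)
  qed
  have Radd: "R x + R y = R (x + y)" for x y
    using R[of x] R[of y] by (intro uniq) (simp add: mlinD[OF E] algebra_simps)
  have Rsc: "r *\<^sub>R R x = R (r *\<^sub>R x)" for r x
    using R[of x] by (intro uniq) (metis mlinD(5)[OF E] scaleR_right_distrib)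
  have Rac: "ac (R x) a = R (ac x a)" for x a
    using R[of x] by (intro uniq) (metis mlinD(2)[OF E] ac_add)
  have "bounded_linear R"
    by (rule bounded_linear_intro[where K = "1 / (1 - c)"]) (use Rb in \<open>auto simp: Radd Rsc\<close>)
  then have "mlin ac ac R" by (simp add: mlin_def Rac)
  moreover have "R (x - E x) = x" for x by (rule uniq[symmetric]) simp
  moreover have "R x - E (R x) = x" for x using R[of x] by (simp add: algebra_simps)
  ultimately show ?thesis using that by blast
qed

text \<open>A generalised inverse: \<open>B \<circ> f\<close> and \<open>f \<circ> B\<close> are the projections onto \<open>M1\<close> and \<open>M2\<close>.\<close>

lemma diag_inverse:
  assumes f: "mlin ac ac f" and d: "diag ac f M1 N1 M2 N2"
  obtains B where "mlin ac ac B" "\<forall>y. B y \<in> M1" "\<forall>y\<in>N2. B y = 0"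
    "\<forall>x\<in>M1. B (f x) = x" "\<forall>x. x - B (f x) \<in> N1" "\<forall>y. y - f (B y) \<in> N2"
proof -
  have M: "msub ac M1" "msub ac N1" "msub ac M2" "msub ac N2" "M1 \<inter> N1 = {0}" "M2 \<inter> N2 = {0}"
    and s1: "\<exists>m\<in>M1. \<exists>n\<in>N1. x = m + n" and s2: "\<exists>m\<in>M2. \<exists>n\<in>N2. x = m + n"
    and im: "f ` M1 \<subseteq> M2" "f ` N1 \<subseteq> N2" and bij: "bij_betw f M1 M2" for x
    using d by (auto simp: diag_def compl_def)
  have fM: "f ` M1 = M2" using bij by (simp add: bij_betw_def)
  define h where "h p = f (fst p) + snd p" for p
  have bh: "bounded_linear h" unfolding h_def
    by (intro bounded_linear_add bounded_linear_compose[OF mlinD(1)[OF f]] bounded_linear_fst bounded_linear_snd)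
  have hs: "h ` (M1 \<times> N2) = UNIV"
  proof -
    have "y \<in> h ` (M1 \<times> N2)" for y
    proof -
      obtain m n where "m \<in> M2" "n \<in> N2" "y = m + n" using s2 by blast
      moreover obtain x where "x \<in> M1" "m = f x" using \<open>m \<in> M2\<close> fM by blast
      ultimately show ?thesis by (intro image_eqI[of _ _ "(x, n)"]) (auto simp: h_def)
    qed
    then show ?thesis by blast
  qed
  obtain C where C: "C > 0" "\<forall>y\<in>UNIV. \<exists>p\<in>M1 \<times> N2. h p = y \<and> norm p \<le> C * norm y"
    by (rule open_mapping_closed_subspaces[OF bh _ _ closed_UNIV subspace_UNIV hs])
      (use M in \<open>auto simp: msub_def intro!: closed_Times subspace_Times msub_subspace\<close>)
  have uniq: "x = x'" if "x \<in> M1" "x' \<in> M1" "y - f x \<in> N2" "y - f x' \<in> N2" for x x' y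
  proof -
    have "f x - f x' \<in> N2" using msub_diff[OF M(4) that(4,3)] by simp
    moreover have "f x - f x' \<in> M2" using that im(1) by (intro msub_diff M) auto
    ultimately have "f x - f x' \<in> M2 \<inter> N2" by (rule IntI[rotated])
    then have "f x = f x'" by (simp add: M(6))
    then show ?thesis by (rule inj_onD[OF bij_betw_imp_inj_on[OF bij] _ that(1,2)])
  qed
  have ex: "\<exists>x. x \<in> M1 \<and> y - f x \<in> N2 \<and> norm x \<le> C * norm y" for y
  proof -
    obtain p where p: "p \<in> M1 \<times> N2" "h p = y" "norm p \<le> C * norm y" using C(2) by blast
    have "y - f (fst p) = snd p" using p(2) by (auto simp: h_def)
    moreover have "norm (fst p) \<le> norm p" by (metis norm_fst_le prod.collapse)
    ultimately show ?thesis using p by (intro exI[of _ "fst p"]) (auto simp: mem_Times_iff)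
  qed
  then obtain B where B: "\<And>y. B y \<in> M1" "\<And>y. y - f (B y) \<in> N2" "\<And>y. norm (B y) \<le> C * norm y"
    by metis
  \<comment> \<open>\<open>B y\<close> is the only vector of \<open>M1\<close> whose image agrees
    with \<open>y\<close> modulo \<open>N2\<close>; the algebraic properties of \<open>B\<close> are
    checked through this characterisation.\<close>
  have Beq: "B y = x" if "x \<in> M1" "y - f x \<in> N2" for x y by (rule uniq[OF B(1) that(1) B(2) that(2)])
  note sp = msub_subspace[OF M(1)] msub_subspace[OF M(4)]
  have "bounded_linear B"
  proof (rule bounded_linear_intro[where K = C])
    fix x y r
    show "B (x + y) = B x + B y"
      using subspace_add[OF sp(1) B(1) B(1), of x y] subspace_add[OF sp(2) B(2) B(2), of x y]
      by (intro Beq) (auto simp: mlinD[OF f] algebra_simps)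
    show "B (r *\<^sub>R x) = r *\<^sub>R B x"
      using subspace_scale[OF sp(1) B(1), of r x] subspace_scale[OF sp(2) B(2), of r x]
      by (intro Beq) (auto simp: mlinD[OF f] algebra_simps)
  qed (use B in \<open>simp add: mult.commute\<close>)
  moreover have "B (ac x a) = ac (B x) a" for x a
  proof (rule Beq)
    show "ac (B x) a \<in> M1" using B(1) M(1) by (auto simp: msub_def)
    have "ac (x - f (B x)) a \<in> N2" by (rule msub_ac[OF M(4) B(2)])
    then show "ac x a - f (ac (B x) a) \<in> N2" by (simp add: mlinD[OF f])
  qed
  ultimately have Bl: "mlin ac ac B" by (simp add: mlin_def)
  have 0: "0 \<in> M1" "0 \<in> N2" using M by (auto simp: msub_def)
  have BN: "B y = 0" if "y \<in> N2" for y using 0 that by (intro Beq) (auto simp: mlinD[OF f])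
  have BM: "B (f x) = x" if "x \<in> M1" for x using 0 that by (intro Beq) auto
  have BfN: "x - B (f x) \<in> N1" for x
  proof -
    obtain m n where mn: "m \<in> M1" "n \<in> N1" "x = m + n" using s1 by blast
    then have "f n \<in> N2" using im by blast
    then have "B (f x) = m" using BM[OF mn(1)] BN by (simp add: mn(3) mlinD[OF f] mlinD[OF Bl])
    then show ?thesis using mn by simp
  qed
  show ?thesis by (rule that[OF Bl]) (use B(1,2) BN BM BfN in blast)+
qed

end

section \<open>Truncations and finitely generated submodules of the standard module\<close>

lemma mspanI: "(\<Sum>i<n. ac (g i) (a i)) \<in> mspan ac g n"
  by (simp add: mspan_def)

lemma mspan_image:
  assumes f: "mlin ac ac' f" shows "f ` mspan ac g n = mspan ac' (\<lambda>i. f (g i)) n"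
  by (simp add: mspan_def image_image mlinD[OF f])

lemma mfg_image: "mlin ac ac' f \<Longrightarrow> mfg ac M \<Longrightarrow> mfg ac' (f ` M)"
  unfolding mfg_def by (metis mspan_image)

lemma mfg_sum:
  assumes "mfg ac M" "mfg ac N" shows "mfg ac {x + y | x y. x \<in> M \<and> y \<in> N}"
proof -
  obtain g m h n where M: "M = mspan ac g m" and N: "N = mspan ac h n"
    using assms by (auto simp: mfg_def)
  define k where "k i = (if i < m then g i else h (i - m))" for i
  have split: "(\<Sum>i<m + n. ac (k i) (c i)) = (\<Sum>i<m. ac (g i) (c i)) + (\<Sum>i<n. ac (h i) (c (m + i)))" for c
  proof -
    have "(\<Sum>i<m + n. ac (k i) (c i)) = (\<Sum>i<m. ac (k i) (c i)) + (\<Sum>i\<in>{m..<m + n}. ac (k i) (c i))"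
      by (metis (no_types) atLeast0LessThan le_add1 sum.atLeastLessThan_concat zero_le)
    also have "(\<Sum>i\<in>{m..<m + n}. ac (k i) (c i)) = (\<Sum>i<n. ac (k (m + i)) (c (m + i)))"
      by (rule sum.reindex_bij_witness[of _ "\<lambda>i. m + i" "\<lambda>i. i - m"]) auto
    finally show ?thesis by (simp add: k_def)
  qed
  have "{x + y | x y. x \<in> M \<and> y \<in> N} = mspan ac k (m + n)"
  proof (intro set_eqI iffI)
    fix z assume "z \<in> {x + y | x y. x \<in> M \<and> y \<in> N}"
    then obtain a b where z: "z = (\<Sum>i<m. ac (g i) (a i)) + (\<Sum>i<n. ac (h i) (b i))"
      by (auto simp: M N mspan_def)
    have "z = (\<Sum>i<m + n. ac (k i) (if i < m then a i else b (i - m)))"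
      unfolding split z by simp
    then show "z \<in> mspan ac k (m + n)" 
      using mspanI[of ac k "\<lambda>i. if i < m then a i else b (i - m)" "m + n"] by simp
  next
    fix z assume "z \<in> mspan ac k (m + n)"
    then obtain c where "z = (\<Sum>i<m. ac (g i) (c i)) + (\<Sum>i<n. ac (h i) (c (m + i)))"
      unfolding mspan_def split by blast
    then show "z \<in> {x + y | x y. x \<in> M \<and> y \<in> N}"
      unfolding M N using mspanI[of ac g c m] mspanI[of ac h "\<lambda>i. c (m + i)" n] by blast
  qed
  then show ?thesis by (auto simp: mfg_def)
qed

lemma banach_module_pact:
  assumes "banach_module ac" "banach_module ac'" shows "banach_module (pact ac ac')"
proof -
  interpret a: banach_module ac by (rule assms)
  interpret b: banach_module ac' by (rule assms)
  show ?thesis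
  proof
    fix x :: "'a \<times> 'c" and a
    have "norm (pact ac ac' x a) \<le> sqrt ((norm (fst x) * norm a)\<^sup>2 + (norm (snd x) * norm a)\<^sup>2)"
      unfolding norm_prod_def pact_def
      by (intro real_sqrt_le_mono add_mono power_mono) (auto simp: a.ac_norm b.ac_norm)
    also have "\<dots> = norm x * norm a"
      by (simp add: norm_prod_def power_mult_distrib distrib_right[symmetric] real_sqrt_mult)
    finally show "norm (pact ac ac' x a) \<le> norm x * norm a" .
  qed (auto simp: pact_def a.ac_add b.ac_add a.ac_add_right b.ac_add_right a.ac_ac b.ac_ac
      a.ac_real b.ac_real prod_eq_iff)
qed

section \<open>The standard module and the interleaving of two copies\<close>

lift_definition l2act :: "'a::unital_cstar_algebra l2 \<Rightarrow> 'a \<Rightarrow> 'a l2" is "\<lambda>x a n. x n * a"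
  using sqsum_mult_right by (simp add: hcarrier_ell2)

lemma l2_nth_l2act [simp]: "l2_nth (l2act x a) n = l2_nth x n * a"
  by transfer simp

lemma l2_nth_sum: "l2_nth (sum h I) n = (\<Sum>i\<in>I. l2_nth (h i) n)"
  by (induction I rule: infinite_finite_induct) auto

interpretation l2: banach_module l2act
proof
  fix x :: "'a::unital_cstar_algebra l2" and a
  show "norm (l2act x a) \<le> norm x * norm a"
  proof (rule norm_l2_le)
    fix n
    have "colnorm {..<n} (l2_nth (l2act x a)) \<le> colnorm {..<n} (l2_nth x) * norm a"
      using colnorm_mult_right[of "{..<n}" "l2_nth x" a] by (simp add: colnorm_def)
    also have "\<dots> \<le> norm x * norm a" by (intro mult_right_mono colnorm_le_norm_l2) auto
    finally show "colnorm {..<n} (l2_nth (l2act x a)) \<le> norm x * norm a" .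
  qed
qed (auto intro!: l2_eqI simp: algebra_simps)

abbreviation l2mod2 where "l2mod2 \<equiv> pact l2act l2act"

interpretation l2l2: banach_module l2mod2
  by (intro banach_module_pact l2.banach_module_axioms)

lemma sqsum_extend:
  fixes x :: "nat \<Rightarrow> 'a::unital_cstar_algebra"
  assumes g: "strict_mono g" and x: "sqsum x"
  shows "sqsum (\<lambda>m. if m \<in> range g then x (inv g m) else 0)"
    and "hnorm ell2 (\<lambda>m. if m \<in> range g then x (inv g m) else 0) = hnorm ell2 x"
proof -
  let ?y = "\<lambda>m. if m \<in> range g then x (inv g m) else 0"
  have inv: "?y (g n) = x n" for n using strict_mono_imp_inj_on[OF g] by simp
  show "sqsum ?y"
    using summable_mono_reindex[OF g, of "\<lambda>m. star (?y m) * ?y m"] x inv by simp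
  show "hnorm ell2 ?y = hnorm ell2 x"
    using suminf_mono_reindex[OF g, of "\<lambda>m. star (?y m) * ?y m"] inv by (simp add: hnorm_ell2)
qed

definition l2_extend :: "(nat \<Rightarrow> nat) \<Rightarrow> 'a::unital_cstar_algebra l2 \<Rightarrow> 'a l2" where
  "l2_extend g x = Abs_l2 (\<lambda>m. if m \<in> range g then l2_nth x (inv g m) else 0)"

lemma l2_nth_extend:
  "strict_mono g \<Longrightarrow> l2_nth (l2_extend g x) m = (if m \<in> range g then l2_nth x (inv g m) else 0)"
  unfolding l2_extend_def using sqsum_extend(1)[OF _ sqsum_l2_nth]
  by (subst Abs_l2_inverse) (auto simp: hcarrier_ell2)

lemma mlin_l2_extend:
  assumes g: "strict_mono g" shows "mlin l2act l2act (l2_extend g)"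
  unfolding mlin_def
proof (intro conjI allI)
  show "bounded_linear (l2_extend g :: 'a l2 \<Rightarrow> 'a l2)"
  proof (rule bounded_linear_intro[where K = 1])
    fix x :: "'a l2"
    have "l2_nth (l2_extend g x) = (\<lambda>m. if m \<in> range g then l2_nth x (inv g m) else 0)"
      by (simp add: l2_nth_extend[OF g] fun_eq_iff)
    then show "norm (l2_extend g x) \<le> norm x * 1"
      by (simp only: norm_l2.rep_eq sqsum_extend(2)[OF g sqsum_l2_nth] mult_1_right order_refl)
  qed (auto intro!: l2_eqI simp: l2_nth_extend[OF g])
qed (auto intro!: l2_eqI simp: l2_nth_extend[OF g])

lemma sqsum_restrict:
  fixes x :: "nat \<Rightarrow> 'a::unital_cstar_algebra"
  assumes g: "strict_mono g" and x: "sqsum x"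
  shows "sqsum (\<lambda>n. x (g n))"
  unfolding sqsum_Cauchy
proof (intro allI impI)
  fix e :: real assume e: "e > 0"
  obtain N where N: "\<forall>m\<ge>N. \<forall>n. colnorm {m..<n} x < e"
    using x e unfolding sqsum_Cauchy by blast
  have "colnorm {m..<n} (\<lambda>i. x (g i)) < e" if "m \<ge> N" for m n
  proof -
    have "colnorm {m..<n} (\<lambda>i. x (g i)) = colnorm (g ` {m..<n}) x"
      unfolding colnorm_def by (subst sum.reindex) (auto intro: strict_mono_imp_inj_on g inj_on_subset)
    \<comment> \<open>A strictly increasing \<open>g\<close> satisfies \<open>i \<le> g i\<close>,
      so it maps tails into tails.\<close>
    also have "\<dots> \<le> colnorm {m..<g n} x"
      by (intro colnorm_mono) (auto simp: strict_mono_less[OF g] intro: order_trans[OF _ strict_mono_imp_increasing[OF g]])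
    also have "\<dots> < e" using N that by blast
    finally show ?thesis .
  qed
  then show "\<exists>N. \<forall>m\<ge>N. \<forall>n. colnorm {m..<n} (\<lambda>i. x (g i)) < e" by blast
qed

definition l2_restrict :: "(nat \<Rightarrow> nat) \<Rightarrow> 'a::unital_cstar_algebra l2 \<Rightarrow> 'a l2" where
  "l2_restrict g x = Abs_l2 (\<lambda>n. l2_nth x (g n))"

lemma l2_nth_restrict: "strict_mono g \<Longrightarrow> l2_nth (l2_restrict g x) n = l2_nth x (g n)"
  unfolding l2_restrict_def using sqsum_restrict[OF _ sqsum_l2_nth]
  by (subst Abs_l2_inverse) (auto simp: hcarrier_ell2)

lemma l2_restrict_extend:
  assumes g: "strict_mono g" and h: "strict_mono h"
  shows "l2_restrict g (l2_extend g x) = x"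
    and "range g \<inter> range h = {} \<Longrightarrow> l2_restrict g (l2_extend h x) = 0"
  by (rule l2_eqI; use strict_mono_imp_inj_on[OF g] in
      \<open>auto simp: l2_nth_restrict[OF g] l2_nth_extend[OF g] l2_nth_extend[OF h]\<close>)+

lemma mlin_l2_restrict:
  assumes g: "strict_mono g" shows "mlin l2act l2act (l2_restrict g)"
  unfolding mlin_def
proof (intro conjI allI)
  show "bounded_linear (l2_restrict g :: 'a l2 \<Rightarrow> 'a l2)"
  proof (rule bounded_linear_intro[where K = 1])
    fix x :: "'a l2"
    have "colnorm {..<n} (l2_nth (l2_restrict g x)) \<le> norm x * 1" for n
    proof -
      have "colnorm {..<n} (l2_nth (l2_restrict g x)) = colnorm (g ` {..<n}) (l2_nth x)"
        unfolding colnorm_def l2_nth_restrict[OF g]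
        by (subst sum.reindex) (auto intro: strict_mono_imp_inj_on g inj_on_subset)
      then show ?thesis by (simp add: colnorm_le_norm_l2)
    qed
    then show "norm (l2_restrict g x) \<le> norm x * 1" by (rule norm_l2_le)
  qed (auto intro!: l2_eqI simp: l2_nth_restrict[OF g])
qed (auto intro!: l2_eqI simp: l2_nth_restrict[OF g])

text \<open>One copy goes to the even and one to the odd coordinates. The bounded left inverse
  \<open>j'\<close> is recorded because it makes images of closed submodules closed.\<close>

lemma l2_pairing:
  obtains j :: "'a::unital_cstar_algebra l2 \<times> 'a l2 \<Rightarrow> 'a l2" and j'
  where "mlin l2mod2 l2act j" "mlin l2act l2mod2 j'" "\<And>p. j' (j p) = p"
proof -
  define ev where "ev n = 2 * n" for n :: nat
  define od where "od n = 2 * n + 1" for n :: nat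
  have e: "strict_mono ev" and o: "strict_mono od" by (auto simp: strict_mono_def ev_def od_def)
  have "ev m \<noteq> od n" for m n unfolding ev_def od_def by presburger
  then have d: "range ev \<inter> range od = {}" by (auto simp: disjoint_iff)
  then have re: "l2_restrict ev (l2_extend ev x) = x" "l2_restrict od (l2_extend od x) = x"
    "l2_restrict ev (l2_extend od x) = 0" "l2_restrict od (l2_extend ev x) = 0" for x :: "'a l2"
    using l2_restrict_extend[OF e o] l2_restrict_extend[OF o e] l2_restrict_extend[OF e e]
      l2_restrict_extend[OF o o] d by (simp_all add: Int_commute)
  define j where "j p = l2_extend ev (fst p) + l2_extend od (snd p)" for p :: "'a l2 \<times> 'a l2"
  define j' where "j' x = (l2_restrict ev x, l2_restrict od x)" for x :: "'a l2"
  note me = mlin_l2_extend[OF e] mlin_l2_extend[OF o] mlin_l2_restrict[OF e] mlin_l2_restrict[OF o]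
  show ?thesis
  proof (rule that)
    show "mlin l2mod2 l2act j" unfolding j_def
      by (intro l2.mlin_add mlin_compose[OF me(1)] mlin_compose[OF me(2)] 
          mlin_fst[OF mlin_id] mlin_snd[OF mlin_id])
    show "mlin l2act l2mod2 j'" unfolding j'_def by (intro mlin_Pair me)
    show "j' (j p) = p" for p
      by (simp add: j_def j'_def mlinD(3)[OF me(3)] mlinD(3)[OF me(4)] re)
  qed
qed

section \<open>Truncation to finitely many coordinates\<close>

lemma sqsum_trunc: "sqsum x \<Longrightarrow> sqsum (\<lambda>n. if n < k then x n else 0)"
  by (rule summable_finite[of "{..<k}"]) auto

lift_definition trunc :: "nat \<Rightarrow> 'a::unital_cstar_algebra l2 \<Rightarrow> 'a l2" is
  "\<lambda>k x n. if n < k then x n else 0"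
  using sqsum_trunc by (simp add: hcarrier_ell2)

lemma l2_nth_trunc [simp]: "l2_nth (trunc k x) n = (if n < k then l2_nth x n else 0)"
  by transfer simp

lemma trunc_trunc [simp]: "trunc k (trunc k x) = trunc k x"
  by (rule l2_eqI) simp

lemma mlin_trunc: "mlin l2act l2act (trunc k)"
  unfolding mlin_def
proof (intro conjI allI)
  show "bounded_linear (trunc k :: 'a l2 \<Rightarrow> 'a l2)"
  proof (rule bounded_linear_intro[where K = 1])
    fix x :: "'a l2"
    have "colnorm {..<n} (l2_nth (trunc k x)) \<le> norm x * 1" for n
    proof -
      have "(\<Sum>i<n. star (l2_nth (trunc k x) i) * l2_nth (trunc k x) i)
        = (\<Sum>i\<in>{..<n} \<inter> {..<k}. star (l2_nth x i) * l2_nth x i)"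
        by (rule sum.mono_neutral_cong_right) auto
      then have "colnorm {..<n} (l2_nth (trunc k x)) = colnorm ({..<n} \<inter> {..<k}) (l2_nth x)"
        by (simp only: colnorm_def)
      then show ?thesis by (simp add: colnorm_le_norm_l2)
    qed
    then show "norm (trunc k x) \<le> norm x * 1" by (rule norm_l2_le)
  qed (auto intro!: l2_eqI)
qed (auto intro!: l2_eqI)

text \<open>This is convergence at each single vector; \<open>mfg_trunc_uniform\<close> makes it
  uniform on unit balls of finitely generated closed submodules.\<close>

lemma trunc_LIMSEQ: "(\<lambda>k. x - trunc k x) \<longlonglongrightarrow> 0"
proof (rule LIMSEQ_I)
  fix e :: real assume e: "e > 0"
  obtain N where N: "\<forall>m\<ge>N. \<forall>n. colnorm {m..<n} (l2_nth x) < e / 2"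
    using sqsum_l2_nth[of x] e unfolding sqsum_Cauchy by (meson half_gt_zero)
  have "norm (x - trunc k x - 0) < e" if "k \<ge> N" for k
  proof -
    have "norm (x - trunc k x) \<le> e / 2"
    proof (rule norm_l2_le)
      fix n
      have "(\<Sum>i<n. star (l2_nth (x - trunc k x) i) * l2_nth (x - trunc k x) i)
        = (\<Sum>i\<in>{k..<n}. star (l2_nth x i) * l2_nth x i)"
        by (rule sum.mono_neutral_cong_right) auto
      then have "colnorm {..<n} (l2_nth (x - trunc k x)) = colnorm {k..<n} (l2_nth x)"
        by (simp only: colnorm_def)
      then show "colnorm {..<n} (l2_nth (x - trunc k x)) \<le> e / 2"
        using N[rule_format, OF that, of n] by simp
    qed
    then show ?thesis using e by simp
  qed
  then show "\<exists>N. \<forall>k\<ge>N. norm (x - trunc k x - 0) < e" by blast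
qed

definition l2_of :: "nat \<Rightarrow> (nat \<Rightarrow> 'a::unital_cstar_algebra) \<Rightarrow> 'a l2" where
  "l2_of k a = Abs_l2 (\<lambda>n. if n < k then a n else 0)"

lemma l2_nth_l2_of [simp]: "l2_nth (l2_of k a) n = (if n < k then a n else 0)"
  unfolding l2_of_def
  by (subst Abs_l2_inverse) (auto simp add: hcarrier_ell2 intro!: summable_finite[of "{..<k}"] split: if_splits)

lemma mfg_range_trunc: "mfg l2act (range (trunc k))"
proof -
  \<comment> \<open>\<open>l2_of\<close> cuts off before its first argument, so \<open>Suc i\<close>
    is the least length that retains position i.\<close>
  define e where "e i = l2_of (Suc i) (\<lambda>n. if n = i then (1::'a) else 0)" for i
  have nth: "l2_nth (\<Sum>i<k. l2act (e i) (a i)) n = (if n < k then a n else 0)" for a n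
  proof -
    have "l2_nth (\<Sum>i<k. l2act (e i) (a i)) n = (\<Sum>i<k. if i = n then a i else 0)"
      unfolding l2_nth_sum by (intro sum.cong) (auto simp: e_def)
    then show ?thesis by (simp add: sum.delta)
  qed
  have "range (trunc k) = mspan l2act e k"
  proof (intro set_eqI iffI)
    fix z :: "'a l2" assume "z \<in> range (trunc k)"
    then obtain x where "z = trunc k x" by blast
    then have "z = (\<Sum>i<k. l2act (e i) (l2_nth x i))" by (intro l2_eqI) (simp add: nth)
    then show "z \<in> mspan l2act e k" using mspanI[of l2act e "l2_nth x" k] by simp
  next
    fix z :: "'a l2" assume "z \<in> mspan l2act e k"
    then obtain a where "z = (\<Sum>i<k. l2act (e i) (a i))" unfolding mspan_def by blast
    then have "z = trunc k z" by (intro l2_eqI) (simp add: nth)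
    then show "z \<in> range (trunc k)" by blast
  qed
  then show ?thesis by (auto simp: mfg_def)
qed

text \<open>Finitely generated closed submodules behave like compact sets for the truncations.\<close>

lemma (in banach_module) mfg_trunc_uniform:
  assumes N: "msub ac N" "mfg ac N" and L: "mlin ac l2act L" and e: "e > 0"
  obtains k where "\<forall>x\<in>N. norm (L x - trunc k (L x)) \<le> e * norm x"
proof -
  obtain g m where g: "N = mspan ac g m" using N(2) by (auto simp: mfg_def)
  \<comment> \<open>The first \<open>m\<close> coordinates of \<open>z\<close> serve as
    coefficients, so that the source is a Banach space. Openness of \<open>h\<close> then provides,
    for every x in \<open>N\<close>, coefficients bounded by \<open>C * norm x\<close>.\<close>
  define h where "h z = (\<Sum>i<m. ac (g i) (l2_nth z i))" for z
  have nl: "bounded_linear (\<lambda>z. l2_nth z i)" for i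
    by (rule bounded_linear_intro[where K = 1]) (auto simp: norm_l2_nth_le)
  have bh: "bounded_linear h" unfolding h_def
    by (intro bounded_linear_sum bounded_linear_compose[OF bounded_linear_ac_right] nl)
  have im: "h ` UNIV = N"
  proof -
    have "(\<Sum>i<m. ac (g i) (a i)) = h (l2_of m a)" for a by (simp add: h_def)
    then have "mspan ac g m \<subseteq> range h" unfolding mspan_def by auto
    moreover have "range h \<subseteq> mspan ac g m" unfolding mspan_def h_def by auto
    ultimately show ?thesis unfolding g by blast
  qed
  have cN: "closed N" using N(1) by (simp add: msub_def)
  obtain C where C: "C > 0" "\<forall>y\<in>N. \<exists>z\<in>UNIV. h z = y \<and> norm z \<le> C * norm y"
    by (rule open_mapping_closed_subspaces[OF bh closed_UNIV subspace_UNIV cN msub_subspace[OF N(1)] im])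
  \<comment> \<open>There are finitely many generators, so one \<open>k\<close> makes the total
    truncation error of their images less than \<open>e / C\<close>; the coefficient bound cancels
    \<open>C\<close>.\<close>
  have "(\<lambda>k. \<Sum>i<m. norm (L (g i) - trunc k (L (g i)))) \<longlonglongrightarrow> (\<Sum>i<m. 0)"
    by (intro tendsto_sum tendsto_norm_zero trunc_LIMSEQ)
  then have "\<forall>\<^sub>F k in sequentially. (\<Sum>i<m. norm (L (g i) - trunc k (L (g i)))) < e / C"
    using order_tendstoD(2)[of _ "\<Sum>i<m. (0::real)" _ "e / C"] e C(1) by simp
  then obtain k where k: "(\<Sum>i<m. norm (L (g i) - trunc k (L (g i)))) < e / C"
    unfolding eventually_sequentially by blast
  have "norm (L x - trunc k (L x)) \<le> e * norm x" if xN: "x \<in> N" for x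
  proof -
    obtain z where z: "h z = x" "norm z \<le> C * norm x" 
      using bspec[OF C(2) xN] by auto
    have "L x - trunc k (L x) = (\<Sum>i<m. l2act (L (g i) - trunc k (L (g i))) (l2_nth z i))"
      by (simp add: z(1)[symmetric] h_def mlinD[OF L] mlinD[OF mlin_trunc] sum_subtractf)
    also have "norm \<dots> \<le> (\<Sum>i<m. norm (L (g i) - trunc k (L (g i))) * norm z)"
      by (intro sum_norm_le order_trans[OF l2.ac_norm] mult_left_mono norm_l2_nth_le) auto
    also have "\<dots> = (\<Sum>i<m. norm (L (g i) - trunc k (L (g i)))) * norm z"
      by (simp only: sum_distrib_right)
    also have "\<dots> \<le> (e / C) * (C * norm x)"
      using k z(2) e C(1) by (intro mult_mono) auto
    finally show ?thesis using C(1) by simp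
  qed
  then show ?thesis using that by blast
qed

section \<open>Upper triangular operators\<close>

text \<open>Write t for \<open>trunc k\<close>. The hypothesis makes U = 1 - (1 - t)(1 - B F)
  invertible, any constant below 1 in place of 1/2 would do, and S F = (1 - t) U for S = (1 - t) B.
  Pulling kernel and range of t back along U splits the domain: R S inverts F on the first part, and
  the second is finitely generated like the range of t.\<close>

lemma diag_of_left_inverse:
  fixes F B :: "'a::unital_cstar_algebra l2 \<Rightarrow> 'a l2"
  assumes F: "mlin l2act l2act F" and B: "mlin l2act l2act B"
    and k: "\<forall>x. norm ((x - B (F x)) - trunc k (x - B (F x))) \<le> (1/2) * norm x"
  shows "\<exists>M1 N1 M2 N2. diag l2act F M1 N1 M2 N2 \<and> mfg l2act N1"
proof -
  note T = mlin_trunc[of k]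
  define E where "E x = (x - B (F x)) - trunc k (x - B (F x))" for x
  define U where "U x = x - E x" for x
  define S where "S y = B y - trunc k (B y)" for y
  note comp = mlin_compose[OF B F] mlin_compose[OF T]
  have E: "mlin l2act l2act E" unfolding E_def by (intro l2.mlin_diff comp mlin_id)
  have U: "mlin l2act l2act U" unfolding U_def by (intro l2.mlin_diff E mlin_id)
  have S: "mlin l2act l2act S" unfolding S_def by (intro l2.mlin_diff comp B)
  obtain R where R: "mlin l2act l2act R" "\<forall>x. R (x - E x) = x" "\<forall>x. R x - E (R x) = x"
    by (rule l2.neumann[OF E, of "1/2"]) (use k in \<open>auto simp: E_def\<close>)
  have RU: "R (U x) = x" and UR: "U (R x) = x" for x using R by (simp_all add: U_def)
  note lin = mlinD(3-7)[OF F] mlinD(3-7)[OF B] mlinD(3-7)[OF T] mlinD(3-7)[OF U]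
    mlinD(3-7)[OF S] mlinD(3-7)[OF R(1)]
  have SF: "S (F x) = U x - trunc k (U x)" for x
    by (simp add: U_def E_def S_def lin)
  define M1 where "M1 = {x. trunc k (U x) = 0}"
  define N1 where "N1 = {x. trunc k (U x) = U x}"
  \<comment> \<open>\<open>M2\<close> and \<open>N2\<close> are range and kernel of the idempotent F
    R S, whose kernel is that of \<open>S\<close> by \<open>SFR\<close>.\<close>
  define M2 where "M2 = {y. F (R (S y)) = y}"
  define N2 where "N2 = {y. S y = 0}"
  have TS: "trunc k (S y) = 0" for y by (simp add: S_def lin)
  have RS: "R (S (F x)) = x" if "x \<in> M1" for x using that by (simp add: SF M1_def RU)
  have RSM: "R (S y) \<in> M1" for y by (simp add: M1_def UR TS)
  have SFR: "S (F (R (S y))) = S y" for y by (simp add: SF UR TS)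
  have FM: "F ` M1 = M2"
  proof
    show "F ` M1 \<subseteq> M2" by (auto simp: M2_def RS)
    show "M2 \<subseteq> F ` M1" using RSM by (auto simp: M2_def intro: image_eqI[OF sym])
  qed
  have "compl l2act M1 N1" unfolding compl_def
  proof (intro conjI allI)
    show "msub l2act M1" "msub l2act N1" unfolding M1_def N1_def
      by (intro l2.msub_eq[where ac' = l2act] comp U l2.mlin_zero)+
    show "M1 \<inter> N1 = {0}"
    proof (intro equalityI subsetI)
      fix x assume "x \<in> M1 \<inter> N1"
      then have "trunc k (U x) = 0" "trunc k (U x) = U x" by (auto simp: M1_def N1_def)
      then have "U x = 0" by (simp only:)
      then show "x \<in> {0}" using RU[of x] by (simp add: lin)
    qed (simp add: M1_def N1_def lin)
    fix x
    have "x = R (U x - trunc k (U x)) + R (trunc k (U x))" by (simp add: lin RU)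
    moreover have "R (U x - trunc k (U x)) \<in> M1" "R (trunc k (U x)) \<in> N1"
      by (simp_all add: M1_def N1_def UR lin(12))
    ultimately show "\<exists>m\<in>M1. \<exists>n\<in>N1. x = m + n" by blast
  qed
  moreover have "compl l2act M2 N2" unfolding compl_def
  proof (intro conjI allI)
    show "msub l2act M2" unfolding M2_def
      by (intro l2.msub_eq[where ac' = l2act] mlin_id mlin_compose[OF F] mlin_compose[OF R(1)] S)
    show "msub l2act N2" unfolding N2_def by (intro l2.msub_eq[where ac' = l2act] S l2.mlin_zero)
    show "M2 \<inter> N2 = {0}" by (auto simp: M2_def N2_def lin)
    fix y
    have "F (R (S y)) \<in> M2" using FM RSM by blast
    moreover have "y - F (R (S y)) \<in> N2" by (simp add: N2_def lin SFR)
    moreover have "y = F (R (S y)) + (y - F (R (S y)))" by simp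
    ultimately show "\<exists>m\<in>M2. \<exists>n\<in>N2. y = m + n" by blast
  qed
  moreover have "F ` N1 \<subseteq> N2" by (auto simp: N1_def N2_def SF)
  moreover have "bij_betw F M1 M2" unfolding bij_betw_def using FM by (auto intro: inj_on_inverseI RS)
  ultimately have "diag l2act F M1 N1 M2 N2" using FM by (simp add: diag_def)
  moreover have "mfg l2act N1"
  proof -
    have "N1 = R ` range (trunc k)"
    proof (intro equalityI subsetI)
      fix x assume "x \<in> N1"
      then have "x = R (trunc k (U x))" by (simp add: N1_def RU)
      then show "x \<in> R ` range (trunc k)" by blast
    qed (auto simp: N1_def UR)
    then show ?thesis using mfg_image[OF R(1) mfg_range_trunc] by simp
  qed
  ultimately show ?thesis by blast
qed

text \<open>With t = \<open>trunc k\<close> and A = B R, the map D A differs from the identity by a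
  map into the range of t, so S = (1 - t) D satisfies S A = 1 - t. Hence A S is idempotent and its
  range and kernel split the domain.\<close>

lemma diag_of_right_inverse:
  fixes D B :: "'a::unital_cstar_algebra l2 \<Rightarrow> 'a l2"
  assumes D: "mlin l2act l2act D" and B: "mlin l2act l2act B"
    and k: "\<forall>x. norm ((x - D (B x)) - trunc k (x - D (B x))) \<le> (1/2) * norm x"
  shows "\<exists>M1 N1 M2 N2. diag l2act D M1 N1 M2 N2 \<and> mfg l2act N2"
proof -
  note T = mlin_trunc[of k]
  define E where "E x = (x - D (B x)) - trunc k (x - D (B x))" for x
  note comp = mlin_compose[OF D B] mlin_compose[OF T]
  have E: "mlin l2act l2act E" unfolding E_def by (intro l2.mlin_diff comp mlin_id)
  obtain R where R: "mlin l2act l2act R" "\<forall>x. R (x - E x) = x" "\<forall>x. R x - E (R x) = x"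
    by (rule l2.neumann[OF E, of "1/2"]) (use k in \<open>auto simp: E_def\<close>)
  define S where "S x = D x - trunc k (D x)" for x
  define A where "A y = B (R y)" for y
  have S: "mlin l2act l2act S" unfolding S_def by (intro l2.mlin_diff comp D)
  have A: "mlin l2act l2act A" unfolding A_def by (rule mlin_compose[OF B R(1)])
  note lin = mlinD(3-7)[OF D] mlinD(3-7)[OF B] mlinD(3-7)[OF T] mlinD(3-7)[OF A]
    mlinD(3-7)[OF S]
  have DA: "D (A y) = y - trunc k (R y - D (A y))" for y
    using R(3)[rule_format, of y] by (simp add: E_def A_def algebra_simps)
  have SA: "S (A y) = y - trunc k y" for y
  proof -
    have "trunc k (D (A y)) = trunc k (y - trunc k (R y - D (A y)))" using DA[of y] by simp
    then have "S (A y) = (y - trunc k (R y - D (A y))) - trunc k (y - trunc k (R y - D (A y)))"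
      using DA[of y] by (simp only: S_def)
    then show ?thesis by (simp add: lin)
  qed
  have TS: "trunc k (S x) = 0" for x by (simp add: S_def lin)
  have SAS: "S (A (S x)) = S x" for x by (simp add: SA TS)
  define M1 where "M1 = {x. A (S x) = x}"
  define N1 where "N1 = {x. S x = 0}"
  \<comment> \<open>The range of the idempotent D A (1 - t), whose kernel is exactly the range of
    t.\<close>
  define M2 where "M2 = {y. D (A (y - trunc k y)) = y}"
  define N2 where "N2 = range (trunc k :: 'a l2 \<Rightarrow> 'a l2)"
  have N2: "N2 = {y. trunc k y = y}" unfolding N2_def by (auto intro: range_eqI[OF sym])
  have AM: "A (y - trunc k y) \<in> M1" for y by (simp add: M1_def SA lin)
  have FM: "D ` M1 = M2"
  proof
    show "D ` M1 \<subseteq> M2" by (auto simp: M2_def M1_def S_def)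
    show "M2 \<subseteq> D ` M1"
    proof
      fix y assume "y \<in> M2"
      then have "y = D (A (y - trunc k y))" by (simp add: M2_def)
      then show "y \<in> D ` M1" using AM by blast
    qed
  qed
  have "compl l2act M1 N1" unfolding compl_def
  proof (intro conjI allI)
    show "msub l2act M1" "msub l2act N1" unfolding M1_def N1_def
      by (intro l2.msub_eq[where ac' = l2act] mlin_compose[OF A] S mlin_id l2.mlin_zero)+
    show "M1 \<inter> N1 = {0}" by (auto simp: M1_def N1_def lin)
    fix x
    have "A (S x) \<in> M1" by (simp add: M1_def SAS)
    moreover have "x - A (S x) \<in> N1" by (simp add: N1_def lin SAS)
    moreover have "x = A (S x) + (x - A (S x))" by simp
    ultimately show "\<exists>m\<in>M1. \<exists>n\<in>N1. x = m + n" by blast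
  qed
  moreover have "compl l2act M2 N2" unfolding compl_def
  proof (intro conjI allI)
    show "msub l2act M2" unfolding M2_def
      by (intro l2.msub_eq[where ac' = l2act] mlin_id mlin_compose[OF D] mlin_compose[OF A] l2.mlin_diff T)
    show "msub l2act N2" unfolding N2 by (intro l2.msub_eq[where ac' = l2act] mlin_id T)
    show "M2 \<inter> N2 = {0}" by (auto simp: M2_def N2 lin)
    fix y :: "'a l2"
    let ?w = "y - trunc k y"
    have "D (A ?w) \<in> M2" using FM AM by blast
    moreover have "y - D (A ?w) = trunc k (y + (R ?w - D (A ?w)))"
      using DA[of ?w] by (simp add: lin algebra_simps)
    then have "y - D (A ?w) \<in> N2" by (simp add: N2_def)
    moreover have "y = D (A ?w) + (y - D (A ?w))" by simp
    ultimately show "\<exists>m\<in>M2. \<exists>n\<in>N2. y = m + n" by blast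
  qed
  moreover have "D ` N1 \<subseteq> N2" by (auto simp: N1_def N2 S_def)
  moreover have "inj_on D M1"
  proof (rule inj_onI)
    fix x y assume "x \<in> M1" "y \<in> M1" "D x = D y"
    moreover from this have "S x = S y" by (simp add: S_def)
    ultimately show "x = y" by (metis (mono_tags) M1_def mem_Collect_eq)
  qed
  ultimately have "diag l2act D M1 N1 M2 N2" using FM by (simp add: diag_def bij_betw_def)
  then show ?thesis using mfg_range_trunc N2_def by blast
qed

definition upper_tri :: "('a::unital_cstar_algebra l2 \<Rightarrow> 'a l2) \<Rightarrow> ('a l2 \<Rightarrow> 'a l2) \<Rightarrow> ('a l2 \<Rightarrow> 'a l2)
    \<Rightarrow> 'a l2 \<times> 'a l2 \<Rightarrow> 'a l2 \<times> 'a l2" where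
  "upper_tri F C D p = (F (fst p) + C (snd p), D (snd p))"

lemma mlin_upper_tri:
  assumes "mlin l2act l2act F" "mlin l2act l2act C" "mlin l2act l2act D"
  shows "mlin l2mod2 l2mod2 (upper_tri F C D)"
  unfolding upper_tri_def
  by (intro mlin_Pair l2.mlin_add mlin_compose[OF assms(1)] mlin_compose[OF assms(2)]
      mlin_compose[OF assms(3)] mlin_fst[OF mlin_id] mlin_snd[OF mlin_id])

lemma norm_Pair_zero: "norm (x, 0::'b::real_normed_vector) = norm x" "norm (0::'b, x) = norm x"
  by (simp_all add: norm_prod_def)

text \<open>The zero corner gives T (x, 0) = (F x, 0) and makes the second component of T p equal to
  D applied to that of p. So the upper left corner of \<open>B\<close> inverts \<open>F\<close> on
  the left and its lower right corner inverts \<open>D\<close> on the right, with errors read off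
  from \<open>u1\<close> and \<open>u2\<close>.\<close>

theorem upper_tri_diag:
  fixes F C D :: "'a::unital_cstar_algebra l2 \<Rightarrow> 'a l2"
  assumes F: "mlin l2act l2act F" and C: "mlin l2act l2act C" and D: "mlin l2act l2act D"
    and d: "diag l2mod2 (upper_tri F C D) t1 u1 t2 u2" and u: "mfg l2mod2 u1" "mfg l2mod2 u2"
  shows "\<exists>M1 N1 M2 N2. diag l2act F M1 N1 M2 N2 \<and> mfg l2act N1"
    and "\<exists>M1 N1 M2 N2. diag l2act D M1 N1 M2 N2 \<and> mfg l2act N2"
proof -
  let ?T = "upper_tri F C D"
  note T = mlin_upper_tri[OF F C D]
  obtain B where B: "mlin l2mod2 l2mod2 B" "\<forall>y. B y \<in> t1" "\<forall>y\<in>u2. B y = 0"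
    "\<forall>x\<in>t1. B (?T x) = x" "\<forall>x. x - B (?T x) \<in> u1" "\<forall>y. y - ?T (B y) \<in> u2"
    by (rule l2l2.diag_inverse[OF T d])
  have mu: "msub l2mod2 u1" "msub l2mod2 u2" using d by (auto simp: diag_def compl_def)
  have p1: "mlin l2mod2 l2act fst" "mlin l2mod2 l2act snd"
    using mlin_fst[OF mlin_id] mlin_snd[OF mlin_id] by auto
  have i1: "mlin l2act l2mod2 (\<lambda>x. (x, 0))" "mlin l2act l2mod2 (\<lambda>x. (0, x))"
    by (intro mlin_Pair mlin_id l2.mlin_zero)+
  \<comment> \<open>\<open>K\<close> bounds the projection 1 - B T into \<open>u1\<close>, so a
    relative truncation error \<open>1 / (2 * K)\<close> on \<open>u1\<close> becomes the 1/2
    required by \<open>diag_of_left_inverse\<close>.\<close>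
  obtain K where K: "K > 0" "\<And>p. norm (p - B (?T p)) \<le> norm p * K"
    using bounded_linear.pos_bounded[OF mlinD(1)[OF l2l2.mlin_diff[OF mlin_id mlin_compose[OF B(1) T]]]] by blast
  obtain k where k: "\<forall>x\<in>u1. norm (fst x - trunc k (fst x)) \<le> (1 / (2 * K)) * norm x"
    by (rule l2l2.mfg_trunc_uniform[OF mu(1) u(1) p1(1), of "1 / (2 * K)"]) (use K in auto)
  show "\<exists>M1 N1 M2 N2. diag l2act F M1 N1 M2 N2 \<and> mfg l2act N1"
  proof (rule diag_of_left_inverse[OF F, of "\<lambda>x. fst (B (x, 0))"])
    show "mlin l2act l2act (\<lambda>x. fst (B (x, 0)))"
      by (rule mlin_fst[OF mlin_compose[OF B(1) i1(1)]])
    show "\<forall>x. norm ((x - fst (B (F x, 0))) - trunc k (x - fst (B (F x, 0)))) \<le> (1/2) * norm x"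
    proof
      fix x
      have eq: "(x, 0) - B (?T (x, 0)) \<in> u1" "?T (x, 0) = (F x, 0)"
        by (rule B(5)[rule_format]) (simp add: upper_tri_def mlinD[OF C] mlinD[OF D])
      have "norm (fst ((x, 0) - B (?T (x, 0))) - trunc k (fst ((x, 0) - B (?T (x, 0)))))
          \<le> (1 / (2 * K)) * norm ((x, 0::'a l2) - B (?T (x, 0)))"
        using k eq(1) by blast
      also have "\<dots> \<le> (1 / (2 * K)) * (norm x * K)"
        using K(1) K(2)[of "(x, 0)"] by (intro mult_left_mono) (auto simp: norm_Pair_zero)
      finally show "norm ((x - fst (B (F x, 0))) - trunc k (x - fst (B (F x, 0)))) \<le> (1/2) * norm x"
        using K(1) by (simp add: eq(2))
    qed
  qed
  obtain K' where K': "K' > 0" "\<And>p. norm (p - ?T (B p)) \<le> norm p * K'"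
    using bounded_linear.pos_bounded[OF mlinD(1)[OF l2l2.mlin_diff[OF mlin_id mlin_compose[OF T B(1)]]]] by blast
  obtain k' where k': "\<forall>x\<in>u2. norm (snd x - trunc k' (snd x)) \<le> (1 / (2 * K')) * norm x"
    by (rule l2l2.mfg_trunc_uniform[OF mu(2) u(2) p1(2), of "1 / (2 * K')"]) (use K' in auto)
  show "\<exists>M1 N1 M2 N2. diag l2act D M1 N1 M2 N2 \<and> mfg l2act N2"
  proof (rule diag_of_right_inverse[OF D, of "\<lambda>y. snd (B (0, y))"])
    show "mlin l2act l2act (\<lambda>x. snd (B (0, x)))"
      by (rule mlin_snd[OF mlin_compose[OF B(1) i1(2)]])
    show "\<forall>x. norm ((x - D (snd (B (0, x)))) - trunc k' (x - D (snd (B (0, x))))) \<le> (1/2) * norm x"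
    proof
      fix x
      have eq: "(0, x) - ?T (B (0, x)) \<in> u2" "snd ((0, x) - ?T (B (0, x))) = x - D (snd (B (0, x)))"
        by (rule B(6)[rule_format]) (simp add: upper_tri_def)
      have "norm (snd ((0, x) - ?T (B (0, x))) - trunc k' (snd ((0, x) - ?T (B (0, x)))))
          \<le> (1 / (2 * K')) * norm ((0::'a l2, x) - ?T (B (0, x)))"
        using k' eq(1) by blast
      also have "\<dots> \<le> (1 / (2 * K')) * (norm x * K')"
        using K'(1) K'(2)[of "(0, x)"] by (intro mult_left_mono) (auto simp: norm_Pair_zero)
      finally show "norm ((x - D (snd (B (0, x)))) - trunc k' (x - D (snd (B (0, x))))) \<le> (1/2) * norm x"
        using K'(1) unfolding eq(2) by simp
    qed
  qed
qed

text \<open>Each parametrisation of the pairs (x, v) is inverted explicitly by means of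
  \<open>B\<close>, or of \<open>P\<close> and \<open>Q\<close>. Thus \<open>f\<close> and
  \<open>g\<close> are bounded maps of the whole fourfold sum, although they are mutually inverse
  only between the two submodules.\<close>

theorem upper_tri_index:
  fixes F C D :: "'a::unital_cstar_algebra l2 \<Rightarrow> 'a l2"
  assumes F: "mlin l2act l2act F" and C: "mlin l2act l2act C" and D: "mlin l2act l2act D"
    and d: "diag l2mod2 (upper_tri F C D) t1 u1 t2 u2"
    and dF: "diag l2act F M1 N1 M2 N2" and dD: "diag l2act D M1' N1' M2' N2'"
  shows "\<exists>f g. mlin (pact l2mod2 l2mod2) (pact l2mod2 l2mod2) f \<and> mlin (pact l2mod2 l2mod2) (pact l2mod2 l2mod2) g
    \<and> f ` ((N2 \<times> N2') \<times> u1) \<subseteq> u2 \<times> (N1 \<times> N1') \<and> g ` (u2 \<times> (N1 \<times> N1')) \<subseteq> (N2 \<times> N2') \<times> u1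
    \<and> (\<forall>x\<in>(N2 \<times> N2') \<times> u1. g (f x) = x) \<and> (\<forall>y\<in>u2 \<times> (N1 \<times> N1'). f (g y) = y)"
proof -
  define T where "T = upper_tri F C D"
  have T: "mlin l2mod2 l2mod2 T" unfolding T_def by (rule mlin_upper_tri[OF F C D])
  obtain B where B: "mlin l2mod2 l2mod2 B" "\<forall>y. B y \<in> t1" "\<forall>y\<in>u2. B y = 0"
    "\<forall>x\<in>t1. B (T x) = x" "\<forall>x. x - B (T x) \<in> u1" "\<forall>y. y - T (B y) \<in> u2"
    by (rule l2l2.diag_inverse[OF T d[folded T_def]])
  obtain P where P: "mlin l2act l2act P" "\<forall>y. P y \<in> M1" "\<forall>y\<in>N2. P y = 0"
    "\<forall>x\<in>M1. P (F x) = x" "\<forall>x. x - P (F x) \<in> N1" "\<forall>y. y - F (P y) \<in> N2"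
    by (rule l2.diag_inverse[OF F dF])
  obtain Q where Q: "mlin l2act l2act Q" "\<forall>y. Q y \<in> M1'" "\<forall>y\<in>N2'. Q y = 0"
    "\<forall>x\<in>M1'. Q (D x) = x" "\<forall>x. x - Q (D x) \<in> N1'" "\<forall>y. y - D (Q y) \<in> N2'"
    by (rule l2.diag_inverse[OF D dD])
  have sub: "msub l2mod2 u2" "msub l2act N2" "msub l2act N2'"
    and im: "T ` u1 \<subseteq> u2" "F ` N1 \<subseteq> N2" "D ` N1' \<subseteq> N2'"
    using d dF dD by (auto simp: diag_def compl_def T_def)
  note lin = mlinD(3-7)[OF T] mlinD(3-7)[OF B(1)] mlinD(3-7)[OF P(1)] mlinD(3-7)[OF Q(1)]
    mlinD(3-7)[OF F] mlinD(3-7)[OF D] mlinD(3-7)[OF C]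
  \<comment> \<open>For p = (w, u) this is the vector with \<open>u1\<close>-component u whose image
    under \<open>T\<close> agrees with w modulo \<open>u2\<close>. The difference w - T (h p) is the
    v of the pair.\<close>
  define h where "h p = snd p + B (fst p)" for p
  define f where "f p = (fst p - T (h p), (fst (h p) - P (F (fst (h p))), snd (h p) - Q (D (snd (h p)))))" for p
  \<comment> \<open>Back substitution for q = (v, (m, n)). The second row asks for y with
    \<open>N1'\<close>-component n and D y + \<open>snd v\<close> in \<open>N2'\<close>. The first
    row then determines x, with C y moved to the given data.\<close>
  define y where "y q = snd (snd q) - Q (snd (fst q))" for q :: "('a l2 \<times> 'a l2) \<times> ('a l2 \<times> 'a l2)"
  define x where "x q = fst (snd q) - P (fst (fst q) + C (y q))" for q
  define g where "g q = (T (x q, y q) + fst q, (x q, y q) - B (T (x q, y q)))" for q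
  let ?A = "pact l2mod2 l2mod2"
  note proj = mlin_fst[OF mlin_id] mlin_snd[OF mlin_id]
  have h: "mlin ?A l2mod2 h" unfolding h_def by (intro l2l2.mlin_add proj mlin_compose[OF B(1)])
  have f: "mlin ?A ?A f" unfolding f_def
    by (intro mlin_Pair l2l2.mlin_diff l2.mlin_diff proj mlin_compose[OF T] mlin_compose[OF P(1)]
        mlin_compose[OF F] mlin_compose[OF Q(1)] mlin_compose[OF D] mlin_fst[OF h] mlin_snd[OF h] h)
  have y: "mlin ?A l2act y" unfolding y_def
    by (intro l2.mlin_diff mlin_compose[OF Q(1)] mlin_snd[OF proj(1)] mlin_snd[OF proj(2)])
  have x: "mlin ?A l2act x" unfolding x_def
    by (intro l2.mlin_diff l2.mlin_add mlin_compose[OF P(1)] mlin_compose[OF C] y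
        mlin_fst[OF proj(1)] mlin_fst[OF proj(2)])
  have g: "mlin ?A ?A g" unfolding g_def
    by (intro mlin_Pair l2l2.mlin_add l2l2.mlin_diff proj mlin_compose[OF T] mlin_compose[OF B(1)] x y)
  have BT: "B (T (B v)) = B v" for v using B(2,4) by blast
  have BTu: "B (T u) = 0" if "u \<in> u1" for u using B(3) im(1) that by blast
  have PF: "P (F (P v)) = P v" for v using P(2,4) by blast
  have PFn: "P (F n) = 0" if "n \<in> N1" for n using P(3) im(2) that by blast
  have QD: "Q (D (Q v)) = Q v" for v using Q(2,4) by blast
  have QDn: "Q (D n) = 0" if "n \<in> N1'" for n using Q(3) im(3) that by blast
  have fin: "f p \<in> u2 \<times> (N1 \<times> N1')" and gf: "g (f p) = p" if p: "p \<in> (N2 \<times> N2') \<times> u1" for p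
  proof -
    obtain v u where vu: "p = (v, u)" "fst v \<in> N2" "snd v \<in> N2'" "u \<in> u1" using p by auto
    have hp: "h p = u + B v" by (simp add: h_def vu)
    have "T u \<in> u2" using im(1) vu by blast
    then have "(v - T (B v)) - T u \<in> u2" by (rule l2l2.msub_diff[OF sub(1) B(6)[rule_format]])
    moreover have "fst p - T (h p) = (v - T (B v)) - T u"
      unfolding hp by (simp add: lin vu(1))
    ultimately have "fst p - T (h p) \<in> u2" by (simp only:)
    then show "f p \<in> u2 \<times> (N1 \<times> N1')" using P(5) Q(5) by (simp add: f_def)
    have fp: "fst p = v" by (simp add: vu(1))
    have Th: "T (h p) = (F (fst (h p)) + C (snd (h p)), D (snd (h p)))"
      by (simp add: T_def upper_tri_def)
    have "Q (snd v) = 0" "P (fst v) = 0" using Q(3) P(3) vu by auto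
    then have yf: "y (f p) = snd (h p)" by (simp add: y_def f_def Th lin fp)
    have xf: "x (f p) = fst (h p)" using \<open>P (fst v) = 0\<close>
      by (simp only: x_def yf) (simp add: f_def Th lin fp)
    have "h p - B (T (h p)) = u" by (simp add: hp lin BT BTu vu(4))
    then show "g (f p) = p" by (simp add: g_def xf yf) (simp add: f_def vu(1))
  qed
  have gin: "g q \<in> (N2 \<times> N2') \<times> u1" and fg: "f (g q) = q" if q: "q \<in> u2 \<times> (N1 \<times> N1')" for q
  proof -
    obtain v m n where vmn: "q = (v, (m, n))" "v \<in> u2" "m \<in> N1" "n \<in> N1'" using q by auto
    have yq: "y q = n - Q (snd v)" by (simp add: y_def vmn(1))
    define w where "w = fst v + C (y q)"
    have xq: "x q = m - P w" by (simp add: x_def vmn(1) w_def)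
    have Txy: "T (x q, y q) = (F (x q) + C (y q), D (y q))" by (simp add: T_def upper_tri_def)
    have "F m \<in> N2" "D n \<in> N2'" using im vmn by auto
    then have "F m + (w - F (P w)) \<in> N2" "D n + (snd v - D (Q (snd v))) \<in> N2'"
      using P(6) Q(6) sub by (auto simp: msub_def)
    moreover have "fst (T (x q, y q) + v) = F m + (w - F (P w))"
      "snd (T (x q, y q) + v) = D n + (snd v - D (Q (snd v)))"
      by (simp_all add: Txy) (simp_all add: xq yq w_def lin)
    ultimately have "fst (T (x q, y q) + v) \<in> N2" "snd (T (x q, y q) + v) \<in> N2'"
      by (simp_all only:)
    then have "T (x q, y q) + fst q \<in> N2 \<times> N2'" by (simp add: mem_Times_iff vmn(1))
    then show "g q \<in> (N2 \<times> N2') \<times> u1" using B(5)[rule_format, of "(x q, y q)"]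
      unfolding g_def by (rule SigmaI)
    have "B v = 0" using B(3) vmn by blast
    then have hg: "h (g q) = (x q, y q)" by (simp add: h_def g_def lin) (simp add: vmn(1))
    have "x q - P (F (x q)) = m" by (simp add: xq lin PF PFn vmn(3))
    moreover have "y q - Q (D (y q)) = n" by (simp add: yq lin QD QDn vmn(4))
    ultimately show "f (g q) = q" by (simp add: f_def hg) (simp add: g_def vmn(1))
  qed
  show ?thesis
    by (intro exI[of _ f] exI[of _ g] conjI ballI image_subsetI f g fin gin gf fg)
qed

section \<open>Transfer to Hilbert modules\<close>

text \<open>Passing to a set of generators adds up the coefficients of equal members of the
  family.\<close>

lemma mspan_eq_sum_image:
  assumes "banach_module ac"
  shows "mspan ac g n = range (\<lambda>b. \<Sum>s\<in>g ` {..<n}. ac s (b s))" and "g ` {..<n} \<subseteq> mspan ac g n"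
proof -
  interpret banach_module ac by (rule assms)
  have gen: "ac (g i) a \<in> mspan ac g n" if "i < n" for i a
  proof -
    have "(\<Sum>j<n. ac (g j) (if j = i then a else 0)) = (\<Sum>j<n. if j = i then ac (g i) a else 0)"
      by (intro sum.cong) auto
    also have "\<dots> = ac (g i) a" using that by simp
    finally show ?thesis using mspanI[of ac g "\<lambda>j. if j = i then a else 0" n] by simp
  qed
  then show "g ` {..<n} \<subseteq> mspan ac g n" using gen[of _ 1] by auto
  have zero: "0 \<in> mspan ac g n" using mspanI[of ac g "\<lambda>_. 0" n] by simp
  have add: "x + y \<in> mspan ac g n" if xy: "x \<in> mspan ac g n" "y \<in> mspan ac g n" for x y
  proof -
    obtain a b where "x = (\<Sum>i<n. ac (g i) (a i))" "y = (\<Sum>i<n. ac (g i) (b i))"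
      using xy by (auto simp: mspan_def)
    then have "x + y = (\<Sum>i<n. ac (g i) (a i + b i))" by (simp add: ac_add_right sum.distrib)
    then show ?thesis using mspanI[of ac g "\<lambda>i. a i + b i" n] by simp
  qed
  have sub: "(\<Sum>s\<in>S. ac s (b s)) \<in> mspan ac g n" if "S \<subseteq> g ` {..<n}" for S b
    using that
  proof (induction S rule: infinite_finite_induct)
    case (insert s S)
    then show ?case using gen by (auto intro!: add)
  qed (auto simp: zero)
  show "mspan ac g n = range (\<lambda>b. \<Sum>s\<in>g ` {..<n}. ac s (b s))"
  proof (intro equalityI subsetI)
    fix x assume "x \<in> mspan ac g n"
    then obtain a where x: "x = (\<Sum>i<n. ac (g i) (a i))" by (auto simp: mspan_def)
    have "x = (\<Sum>s\<in>g ` {..<n}. \<Sum>i | i \<in> {..<n} \<and> g i = s. ac (g i) (a i))"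
      unfolding x by (rule sum.image_gen) simp
    also have "\<dots> = (\<Sum>s\<in>g ` {..<n}. ac s (\<Sum>i | i \<in> {..<n} \<and> g i = s. a i))"
      by (intro sum.cong) (auto simp: ac_sum_right)
    finally show "x \<in> range (\<lambda>b. \<Sum>s\<in>g ` {..<n}. ac s (b s))"
      by (rule image_eqI[where x = "\<lambda>s. \<Sum>i | i \<in> {..<n} \<and> g i = s. a i"]) simp
  qed (use sub in blast)
qed

text \<open>Two constants instead of an isometry: on pairs, the product norm and the norm of the
  orthogonal sum are only equivalent.\<close>

locale hilbert_rep = banach_module ac
  for ac :: "'x::banach \<Rightarrow> 'a::unital_cstar_algebra \<Rightarrow> 'x" +
  fixes H :: "('a, 'h::ab_group_add) hilbert_mod" and \<phi> :: "'x \<Rightarrow> 'h" and c d :: real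
  assumes bij: "bij_betw \<phi> UNIV (hcarrier H)"
    and \<phi>_add: "\<phi> (x + y) = \<phi> x + \<phi> y"
    and \<phi>_act: "\<phi> (ac x a) = act H (\<phi> x) a"
    and lower: "norm x \<le> c * hnorm H (\<phi> x)"
    and upper: "hnorm H (\<phi> x) \<le> d * norm x"
    and cd: "0 \<le> c" "0 \<le> d"
begin

lemma inj: "inj \<phi>" and range_\<phi>: "range \<phi> = hcarrier H"
  using bij by (auto simp: bij_betw_def)

lemma \<phi>_eq [simp]: "\<phi> x = \<phi> y \<longleftrightarrow> x = y"
  using inj by (auto dest: injD)

lemma inv_\<phi> [simp]: "inv \<phi> (\<phi> x) = x"
  using inj by simp

lemma \<phi>_inv: "y \<in> hcarrier H \<Longrightarrow> \<phi> (inv \<phi> y) = y"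
  by (metis f_inv_into_f range_\<phi>)

lemma \<phi>_zero [simp]: "\<phi> 0 = 0"
  using \<phi>_add[of 0 0] by simp

lemma \<phi>_diff: "\<phi> (x - y) = \<phi> x - \<phi> y"
  using \<phi>_add[of "x - y" y] by (simp add: algebra_simps)

lemma \<phi>_sum: "\<phi> (sum h I) = (\<Sum>i\<in>I. \<phi> (h i))"
  by (induction I rule: infinite_finite_induct) (auto simp: \<phi>_add)

lemma image_mem [simp]: "\<phi> x \<in> \<phi> ` S \<longleftrightarrow> x \<in> S"
  using inj by (auto dest: injD)

text \<open>Closedness in the Hilbert module is sequential for \<open>hnorm\<close>. The bound
  \<open>upper\<close> carries limits from the Banach space to \<open>H\<close>, the bound
  \<open>lower\<close> carries them back.\<close>

lemma closed_submod_iff: "closed_submod H (\<phi> ` S) \<longleftrightarrow> msub ac S"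
proof
  assume L: "closed_submod H (\<phi> ` S)"
  have sm: "submod H (\<phi> ` S)" using L by (simp add: closed_submod_def)
  have "closed S" unfolding closed_sequential_limits
  proof (intro allI impI, elim conjE)
    fix s l assume s: "\<forall>n. s n \<in> S" "s \<longlonglongrightarrow> l"
    have "(\<lambda>n. hnorm H (\<phi> (s n) - \<phi> l)) \<longlonglongrightarrow> 0"
    proof (rule Lim_null_comparison)
      show "\<forall>\<^sub>F n in sequentially. norm (hnorm H (\<phi> (s n) - \<phi> l)) \<le> d * norm (s n - l)"
        using upper[of "s _ - l"] by (simp add: \<phi>_diff hnorm_def)
      show "(\<lambda>n. d * norm (s n - l)) \<longlonglongrightarrow> 0"
        using s(2) by (intro tendsto_mult_right_zero tendsto_norm_zero LIM_zero)
    qed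
    moreover have "\<forall>n. \<phi> (s n) \<in> \<phi> ` S" "\<phi> l \<in> hcarrier H" using s range_\<phi> by auto
    ultimately have "\<phi> l \<in> \<phi> ` S"
      using L[unfolded closed_submod_def, THEN conjunct2, rule_format, of "\<lambda>n. \<phi> (s n)" "\<phi> l"]
      by simp
    then show "l \<in> S" by simp
  qed
  moreover have "0 \<in> S" using sm image_mem[of 0 S] by (simp add: submod_def)
  moreover have "x + y \<in> S" if "x \<in> S" "y \<in> S" for x y
    using sm that image_mem[of "x + y" S] unfolding submod_def \<phi>_add by blast
  moreover have "ac x a \<in> S" if "x \<in> S" for x a
    using sm that image_mem[of "ac x a" S] unfolding submod_def \<phi>_act by blast
  ultimately show "msub ac S" by (simp add: msub_def)
next
  assume R: "msub ac S"
  have "submod H (\<phi> ` S)" unfolding submod_def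
  proof (intro conjI ballI allI)
    show "\<phi> ` S \<subseteq> hcarrier H" using range_\<phi> by blast
    show "0 \<in> \<phi> ` S" using R image_mem[of 0 S] by (simp add: msub_def)
    show "x + y \<in> \<phi> ` S" if "x \<in> \<phi> ` S" "y \<in> \<phi> ` S" for x y
      using that R by (auto simp: \<phi>_add[symmetric] msub_def)
    show "act H x a \<in> \<phi> ` S" if "x \<in> \<phi> ` S" for x a
      using that R by (auto simp: \<phi>_act[symmetric] msub_def)
  qed
  moreover have "x \<in> \<phi> ` S"
    if s: "\<forall>n. s n \<in> \<phi> ` S" "x \<in> hcarrier H" "(\<lambda>n. hnorm H (s n - x)) \<longlonglongrightarrow> 0" for s x
  proof -
    define t where "t n = inv \<phi> (s n)" for n
    have t: "t n \<in> S" "\<phi> (t n) = s n" for n using s(1)[rule_format, of n] by (auto simp: t_def)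
    obtain l where l: "x = \<phi> l" using s(2) range_\<phi> by blast
    have "(\<lambda>n. t n - l) \<longlonglongrightarrow> 0"
    proof (rule Lim_null_comparison)
      show "\<forall>\<^sub>F n in sequentially. norm (t n - l) \<le> c * hnorm H (s n - x)"
        using lower[of "t _ - l"] by (simp add: \<phi>_diff t l)
      show "(\<lambda>n. c * hnorm H (s n - x)) \<longlonglongrightarrow> 0" by (intro tendsto_mult_right_zero s)
    qed
    then have "t \<longlonglongrightarrow> l" by (rule LIM_zero_cancel)
    moreover have "closed S" using R by (simp add: msub_def)
    ultimately have "l \<in> S" using t(1) closed_sequential_limits by blast
    then show ?thesis by (simp add: l)
  qed
  ultimately show "closed_submod H (\<phi> ` S)" unfolding closed_submod_def by blast
qed

lemma closed_submod_obtain: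
  assumes "closed_submod H M" obtains S where "M = \<phi> ` S"
proof -
  have "M \<subseteq> range \<phi>" using assms by (simp add: closed_submod_def submod_def range_\<phi>)
  then show ?thesis using that by (metis subset_imageE)
qed

lemma fin_gen_iff: "fin_gen H (\<phi> ` M) \<longleftrightarrow> mfg ac M"
proof
  assume "fin_gen H (\<phi> ` M)"
  then obtain S where S: "finite S" "S \<subseteq> \<phi> ` M" "\<phi> ` M = {\<Sum>s\<in>S. act H s (a s) | a. True}"
    by (auto simp: fin_gen_def)
  obtain h where h: "bij_betw h {..<card S} S"
    using ex_bij_betw_nat_finite[OF S(1)] by (auto simp: atLeast0LessThan)
  define g where "g i = inv \<phi> (h i)" for i
  have Scar: "S \<subseteq> hcarrier H" using S(2) range_\<phi> by blast
  have "g ` {..<card S} = inv \<phi> ` S"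
    using h by (auto simp: g_def bij_betw_def image_image[symmetric])
  moreover have "(\<Sum>s\<in>S. act H s (a s)) = \<phi> (\<Sum>t\<in>inv \<phi> ` S. ac t (a (\<phi> t)))" for a
  proof -
    have "inj_on (inv \<phi>) S" using inj_on_inv_into[of S \<phi> UNIV] Scar range_\<phi> by simp
    then show ?thesis
      using Scar by (auto simp: \<phi>_sum \<phi>_act sum.reindex \<phi>_inv intro!: sum.cong)
  qed
  ultimately have eq: "(\<Sum>s\<in>S. act H s (a s)) = \<phi> (\<Sum>t\<in>g ` {..<card S}. ac t (a (\<phi> t)))" for a
    by simp
  have "M = mspan ac g (card S)"
    unfolding mspan_eq_sum_image(1)[OF banach_module_axioms]
  proof (intro equalityI subsetI)
    fix x assume "x \<in> M"
    then have "\<phi> x \<in> \<phi> ` M" by simp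
    then obtain a where "\<phi> x = (\<Sum>s\<in>S. act H s (a s))" unfolding S(3) by blast
    then have "x = (\<Sum>t\<in>g ` {..<card S}. ac t (a (\<phi> t)))" by (simp add: eq)
    then show "x \<in> range (\<lambda>b. \<Sum>s\<in>g ` {..<card S}. ac s (b s))"
      by (rule image_eqI[where x = "\<lambda>t. a (\<phi> t)"]) simp
  next
    fix x assume "x \<in> range (\<lambda>b. \<Sum>s\<in>g ` {..<card S}. ac s (b s))"
    then obtain b where b: "x = (\<Sum>s\<in>g ` {..<card S}. ac s (b s))" by blast
    have "\<phi> x = (\<Sum>s\<in>S. act H s (b (inv \<phi> s)))" by (simp add: eq b)
    then have "\<phi> x \<in> \<phi> ` M" unfolding S(3)
      by (intro CollectI exI[of _ "\<lambda>s. b (inv \<phi> s)"] conjI TrueI)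
    then show "x \<in> M" by simp
  qed
  then show "mfg ac M" by (auto simp: mfg_def)
next
  assume "mfg ac M"
  then obtain g n where M: "M = mspan ac g n" by (auto simp: mfg_def)
  let ?S = "\<phi> ` g ` {..<n}"
  have eq: "(\<Sum>s\<in>?S. act H s (a s)) = \<phi> (\<Sum>t\<in>g ` {..<n}. ac t (a (\<phi> t)))" for a
    by (subst sum.reindex) (auto simp: \<phi>_sum \<phi>_act inj_on_def)
  have "\<phi> ` M = {\<Sum>s\<in>?S. act H s (a s) | a. True}"
    unfolding M mspan_eq_sum_image(1)[OF banach_module_axioms] eq
  proof (intro equalityI subsetI)
    fix y assume "y \<in> \<phi> ` range (\<lambda>b. \<Sum>s\<in>g ` {..<n}. ac s (b s))"
    then obtain b where "y = \<phi> (\<Sum>s\<in>g ` {..<n}. ac s (b s))" by blast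
    then have "y = \<phi> (\<Sum>t\<in>g ` {..<n}. ac t ((\<lambda>s. b (inv \<phi> s)) (\<phi> t)))" by simp
    then show "y \<in> {\<phi> (\<Sum>t\<in>g ` {..<n}. ac t (a (\<phi> t))) | a. True}"
      by (intro CollectI exI[of _ "\<lambda>s. b (inv \<phi> s)"] conjI TrueI)
  next
    fix y assume "y \<in> {\<phi> (\<Sum>t\<in>g ` {..<n}. ac t (a (\<phi> t))) | a. True}"
    then obtain a where "y = \<phi> (\<Sum>t\<in>g ` {..<n}. ac t (a (\<phi> t)))" by blast
    then show "y \<in> \<phi> ` range (\<lambda>b. \<Sum>s\<in>g ` {..<n}. ac s (b s))"
      by (intro image_eqI[where x = "\<Sum>t\<in>g ` {..<n}. ac t (a (\<phi> t))"] range_eqI[where x = "\<lambda>t. a (\<phi> t)"]) auto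
  qed
  moreover have "?S \<subseteq> \<phi> ` M"
    unfolding M using mspan_eq_sum_image(2)[OF banach_module_axioms] by blast
  ultimately show "fin_gen H (\<phi> ` M)" unfolding fin_gen_def by (intro exI[of _ ?S]) auto
qed

lemma direct_sum_iff:
  "direct_sum H (\<phi> ` W) (\<phi> ` M) (\<phi> ` N) \<longleftrightarrow>
    msub ac W \<and> msub ac M \<and> msub ac N \<and> M \<inter> N = {0} \<and> W = {x + y | x y. x \<in> M \<and> y \<in> N}"
proof -
  have "\<phi> ` M \<inter> \<phi> ` N = {0} \<longleftrightarrow> M \<inter> N = {0}"
    using image_Int[OF inj, of M N] inj_image_eq_iff[OF inj, of "M \<inter> N" "{0}"] by simp
  moreover have "{x + y | x y. x \<in> \<phi> ` M \<and> y \<in> \<phi> ` N} = \<phi> ` {x + y | x y. x \<in> M \<and> y \<in> N}"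
    by (auto simp: \<phi>_add image_iff) (metis \<phi>_add)+
  ultimately show ?thesis
    by (simp add: direct_sum_def closed_submod_iff inj_image_eq_iff[OF inj])
qed

lemma compl_iff: "direct_sum H (hcarrier H) (\<phi> ` M) (\<phi> ` N) \<longleftrightarrow> compl ac M N"
proof -
  have "UNIV = {x + y | x y. x \<in> M \<and> y \<in> N} \<longleftrightarrow> (\<forall>x. \<exists>m\<in>M. \<exists>n\<in>N. x = m + n)"
    by (auto simp: set_eq_iff) blast+
  moreover have "msub ac UNIV" by (simp add: msub_def)
  ultimately show ?thesis
    unfolding range_\<phi>[symmetric] direct_sum_iff compl_def by blast
qed

lemma operator_obtain:
  assumes "F \<in> adjointable_ops H"
  obtains f where "mlin ac ac f" "\<forall>x. \<phi> (f x) = F (\<phi> x)"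
proof -
  have F: "F y \<in> hcarrier H" if "y \<in> hcarrier H" for y
    using assms that by (auto simp: adjointable_ops_def)
  have lin: "linear_on_mod H (hcarrier H) F" and bd: "bounded_on_mod H (hcarrier H) F"
    using assms by (auto simp: adjointable_ops_def)
  have car: "\<phi> x \<in> hcarrier H" for x using range_\<phi> by blast
  define f where "f x = inv \<phi> (F (\<phi> x))" for x
  have f: "\<phi> (f x) = F (\<phi> x)" for x by (simp add: f_def \<phi>_inv F car)
  have add: "f (x + y) = f x + f y" for x y
  proof -
    have "\<phi> (f (x + y)) = \<phi> (f x + f y)"
      using lin car unfolding linear_on_mod_def by (simp add: f \<phi>_add)
    then show ?thesis by simp
  qed
  have act: "f (ac x a) = ac (f x) a" for x a
  proof -
    have "\<phi> (f (ac x a)) = \<phi> (ac (f x) a)"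
      using lin car unfolding linear_on_mod_def by (simp add: f \<phi>_act)
    then show ?thesis by simp
  qed
  \<comment> \<open>Real scalars act as real multiples of the unit of the algebra.\<close>
  have sc: "f (r *\<^sub>R x) = r *\<^sub>R f x" for r x
    using act[of x "r *\<^sub>R 1"] by (simp add: ac_real)
  obtain K where K: "\<forall>x\<in>hcarrier H. hnorm H (F x) \<le> K * hnorm H x"
    using bd by (auto simp: bounded_on_mod_def)
  have "norm (f x) \<le> norm x * (c * (\<bar>K\<bar> * d))" for x
  proof -
    have "hnorm H (F (\<phi> x)) \<le> K * hnorm H (\<phi> x)" using K car by blast
    also have "\<dots> \<le> \<bar>K\<bar> * hnorm H (\<phi> x)" by (intro mult_right_mono) (auto simp: hnorm_def)
    also have "\<dots> \<le> \<bar>K\<bar> * (d * norm x)" by (intro mult_left_mono upper) auto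
    finally have "c * hnorm H (\<phi> (f x)) \<le> c * (\<bar>K\<bar> * (d * norm x))"
      using cd by (simp add: f mult_left_mono)
    then show ?thesis using lower[of "f x"] by (simp add: mult_ac)
  qed
  then have "bounded_linear f" by (intro bounded_linear_intro add sc)
  then show ?thesis using that[of f] f act by (simp add: mlin_def)
qed

lemma hnorm_bounded:
  assumes g: "mlin ac ac g" shows "\<exists>K. \<forall>x. hnorm H (\<phi> (g x)) \<le> K * hnorm H (\<phi> x)"
proof -
  obtain K where K: "K > 0" "\<And>x. norm (g x) \<le> norm x * K"
    using bounded_linear.pos_bounded[OF mlinD(1)[OF g]] by blast
  have "hnorm H (\<phi> (g x)) \<le> (d * K * c) * hnorm H (\<phi> x)" for x
  proof -
    have "hnorm H (\<phi> (g x)) \<le> d * norm (g x)" by (rule upper)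
    also have "\<dots> \<le> d * (norm x * K)" using cd by (intro mult_left_mono K)
    also have "\<dots> \<le> d * ((c * hnorm H (\<phi> x)) * K)"
      using cd K(1) by (intro mult_left_mono mult_right_mono lower) auto
    finally show ?thesis by (simp add: mult_ac)
  qed
  then show ?thesis by blast
qed

text \<open>The two notions differ in the bound on the inverse of \<open>F\<close>; towards
  \<open>diag_decomp\<close> it comes from the generalised inverse \<open>B\<close>, hence from the
  open mapping theorem.\<close>

lemma diag_iff:
  assumes f: "mlin ac ac f" and F: "\<forall>x. \<phi> (f x) = F (\<phi> x)"
  shows "diag_decomp H F (\<phi> ` M1) (\<phi> ` N1) (\<phi> ` M2) (\<phi> ` N2) \<longleftrightarrow> diag ac f M1 N1 M2 N2"
proof -
  have im: "F ` \<phi> ` A = \<phi> ` f ` A" for A using F by (simp add: image_image)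
  have sub: "\<phi> ` A \<subseteq> \<phi> ` B \<longleftrightarrow> A \<subseteq> B" for A B by (rule inj_image_subset_iff[OF inj])
  have bij_iff: "bij_betw F (\<phi> ` M1) (\<phi> ` M2) \<longleftrightarrow> bij_betw f M1 M2"
  proof -
    have "inj_on F (\<phi> ` M1) \<longleftrightarrow> inj_on f M1"
      using F by (auto simp: inj_on_def) (metis \<phi>_eq)+
    then show ?thesis by (simp add: bij_betw_def im inj_image_eq_iff[OF inj])
  qed
  show ?thesis
  proof
    assume "diag_decomp H F (\<phi> ` M1) (\<phi> ` N1) (\<phi> ` M2) (\<phi> ` N2)"
    then show "diag ac f M1 N1 M2 N2"
      by (simp add: diag_decomp_def diag_def compl_iff im sub mod_iso_def bij_iff)
  next
    assume d: "diag ac f M1 N1 M2 N2"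
    obtain B where B: "mlin ac ac B" "\<forall>y. B y \<in> M1" "\<forall>y\<in>N2. B y = 0"
      "\<forall>x\<in>M1. B (f x) = x" "\<forall>x. x - B (f x) \<in> N1" "\<forall>y. y - f (B y) \<in> N2"
      by (rule diag_inverse[OF f d])
    have bij: "bij_betw F (\<phi> ` M1) (\<phi> ` M2)" using d by (simp add: bij_iff diag_def)
    have "bounded_on_mod H (\<phi> ` M1) F"
      using hnorm_bounded[OF f] F unfolding bounded_on_mod_def by auto
    moreover have "bounded_on_mod H (\<phi> ` M2) (inv_into (\<phi> ` M1) F)"
    proof -
      have "inv_into (\<phi> ` M1) F (\<phi> y) = \<phi> (B y)" if y: "y \<in> M2" for y
      proof (rule inv_into_f_eq[OF bij_betw_imp_inj_on[OF bij]])
        show "\<phi> (B y) \<in> \<phi> ` M1" using B(2) by simp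
        obtain x where "x \<in> M1" "y = f x" using y d by (auto simp: diag_def bij_betw_def)
        then show "F (\<phi> (B y)) = \<phi> y" using B(4) F by auto
      qed
      then show ?thesis using hnorm_bounded[OF B(1)] unfolding bounded_on_mod_def by auto
    qed
    moreover have "linear_on_mod H (\<phi> ` M1) F"
      unfolding linear_on_mod_def
      by (auto simp: mlinD[OF f] F[rule_format, symmetric] simp flip: \<phi>_add \<phi>_act)
    ultimately show "diag_decomp H F (\<phi> ` M1) (\<phi> ` N1) (\<phi> ` M2) (\<phi> ` N2)"
      using d by (simp add: diag_decomp_def diag_def compl_iff im sub mod_iso_def bij_iff)
  qed
qed

lemma diag_decomp_obtain:
  assumes f: "mlin ac ac f" "\<forall>x. \<phi> (f x) = F (\<phi> x)" and d: "diag_decomp H F M1 N1 M2 N2"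
  obtains m1 n1 m2 n2 where "M1 = \<phi> ` m1" "N1 = \<phi> ` n1" "M2 = \<phi> ` m2" "N2 = \<phi> ` n2"
    "diag ac f m1 n1 m2 n2"
proof -
  have "closed_submod H M1" "closed_submod H N1" "closed_submod H M2" "closed_submod H N2"
    using d by (auto simp: diag_decomp_def direct_sum_def)
  then obtain m1 n1 m2 n2 where eq: "M1 = \<phi> ` m1" "N1 = \<phi> ` n1" "M2 = \<phi> ` m2" "N2 = \<phi> ` n2"
    by (metis closed_submod_obtain)
  then show ?thesis using that d diag_iff[OF f, of m1 n1 m2 n2] by blast
qed

lemma isomorphicI:
  assumes "miso ac M N" shows "isomorphic H (\<phi> ` M) (\<phi> ` N)"
proof -
  obtain f g where fg: "mlin ac ac f" "mlin ac ac g" "f ` M \<subseteq> N" "g ` N \<subseteq> M"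
    "\<forall>x\<in>M. g (f x) = x" "\<forall>y\<in>N. f (g y) = y" using assms by (auto simp: miso_def)
  define F where "F y = \<phi> (f (inv \<phi> y))" for y
  have F: "F (\<phi> x) = \<phi> (f x)" for x by (simp add: F_def)
  have inj: "inj_on F (\<phi> ` M)" using fg(5) by (auto simp: inj_on_def F) (metis)
  have "F ` \<phi> ` M = \<phi> ` N"
  proof -
    have "f ` M = N" using fg(3,4,6) by force
    then show ?thesis by (auto simp: F image_image)
  qed
  then have "bij_betw F (\<phi> ` M) (\<phi> ` N)" using inj by (simp add: bij_betw_def)
  moreover have "linear_on_mod H (\<phi> ` M) F"
    unfolding linear_on_mod_def by (auto simp: F mlinD[OF fg(1)] simp flip: \<phi>_add \<phi>_act)
  moreover have "bounded_on_mod H (\<phi> ` M) F"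
    using hnorm_bounded[OF fg(1)] unfolding bounded_on_mod_def by (auto simp: F)
  moreover have "inv_into (\<phi> ` M) F (\<phi> y) = \<phi> (g y)" if "y \<in> N" for y
    using fg(4,6) that by (intro inv_into_f_eq[OF inj]) (auto simp: F)
  then have "bounded_on_mod H (\<phi> ` N) (inv_into (\<phi> ` M) F)"
    using hnorm_bounded[OF fg(2)] unfolding bounded_on_mod_def by auto
  ultimately show ?thesis by (auto simp: isomorphic_def mod_iso_def)
qed

end

section \<open>Packing sums of submodules into one standard module\<close>

lemma (in banach_module) msub_zero: "msub ac {0}"
  by (simp add: msub_def)

lemma msub_Times: "msub ac A \<Longrightarrow> msub ac' B \<Longrightarrow> msub (pact ac ac') (A \<times> B)"
  by (auto simp: msub_def pact_def zero_prod_def closed_Times)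

text \<open>The left inverse describes the image by closed conditions: x is fixed by j j', and j' x
  lies in \<open>A\<close>.\<close>

lemma msub_embed:
  assumes j: "mlin ac ac' j" and j': "mlin ac' ac j'" and inv: "\<forall>p. j' (j p) = p" and A: "msub ac A"
  shows "msub ac' (j ` A)"
proof -
  have eq: "j ` A = {x. j (j' x) = x} \<inter> j' -` A"
    using inv by (auto simp: image_iff) metis
  have "continuous_on UNIV (\<lambda>x. j (j' x))" "continuous_on UNIV j'"
    using mlinD(1)[OF mlin_compose[OF j j']] mlinD(1)[OF j'] by (simp_all add: linear_continuous_on)
  then have "closed (j ` A)"
    unfolding eq using A by (auto simp: msub_def intro!: closed_Int closed_Collect_eq closed_vimage)
  moreover have "0 \<in> j ` A" using A mlinD(6)[OF j] by (auto simp: msub_def intro: image_eqI[of _ _ 0])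
  moreover have "x + y \<in> j ` A" if "x \<in> j ` A" "y \<in> j ` A" for x y
    using A that mlinD(3)[OF j, symmetric] by (auto simp: msub_def)
  moreover have "ac' x a \<in> j ` A" if "x \<in> j ` A" for x a
    using A that mlinD(2)[OF j, symmetric] by (auto simp: msub_def)
  ultimately show ?thesis by (simp add: msub_def)
qed

lemma embed_direct_sum:
  assumes j: "mlin ac ac' j" and inv: "\<forall>p. j' (j p) = p" and XY: "X \<inter> Y = {0}"
  shows "j ` X \<inter> j ` Y = {0}" and "j ` {x + y | x y. x \<in> X \<and> y \<in> Y} = {x + y | x y. x \<in> j ` X \<and> y \<in> j ` Y}"
proof -
  have "inj j" using inv by (metis injI)
  then have "j ` X \<inter> j ` Y = j ` (X \<inter> Y)" by (simp add: image_Int)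
  then show "j ` X \<inter> j ` Y = {0}" by (simp add: XY mlinD(6)[OF j])
  show "j ` {x + y | x y. x \<in> X \<and> y \<in> Y} = {x + y | x y. x \<in> j ` X \<and> y \<in> j ` Y}"
    by (auto simp: mlinD(3)[OF j] image_iff) (metis mlinD(3)[OF j])+
qed

abbreviation l2mod4 where "l2mod4 \<equiv> pact l2mod2 l2mod2"

interpretation l2l4: banach_module l2mod4
  by (intro banach_module_pact l2l2.banach_module_axioms)

lemma l2_pairing2:
  obtains j :: "('a::unital_cstar_algebra l2 \<times> 'a l2) \<times> ('a l2 \<times> 'a l2) \<Rightarrow> 'a l2" and j'
  where "mlin l2mod4 l2act j" "mlin l2act l2mod4 j'" "\<forall>p. j' (j p) = p"
proof -
  obtain i :: "'a l2 \<times> 'a l2 \<Rightarrow> 'a l2" and i' where i: "mlin l2mod2 l2act i" "mlin l2act l2mod2 i'"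
    "\<forall>p. i' (i p) = p" using l2_pairing by metis
  note proj = mlin_fst[OF mlin_id] mlin_snd[OF mlin_id]
  show ?thesis
  proof (rule that)
    show "mlin l2mod4 l2act (\<lambda>p. i (i (fst p), i (snd p)))"
      by (intro mlin_compose[OF i(1)] mlin_Pair proj)
    show "mlin l2act l2mod4 (\<lambda>x. (i' (fst (i' x)), i' (snd (i' x))))"
      by (intro mlin_compose[OF i(2)] mlin_Pair mlin_fst[OF i(2)] mlin_snd[OF i(2)])
  qed (simp add: i(3))
qed

text \<open>On either side of the isomorphism one summand is singled out, \<open>N2\<close> or
  \<open>N1'\<close>. The remaining summands, \<open>N2'\<close> with \<open>u1\<close> and
  \<open>u2\<close> with \<open>N1\<close>, are finitely generated and become \<open>ttN2\<close>
  and \<open>ttN1'\<close> after embedding by \<open>j\<close>.\<close>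

lemma upper_tri_index_l2:
  fixes F C D :: "'a::unital_cstar_algebra l2 \<Rightarrow> 'a l2"
  assumes F: "mlin l2act l2act F" and C: "mlin l2act l2act C" and D: "mlin l2act l2act D"
    and d: "diag l2mod2 (upper_tri F C D) t1 u1 t2 u2" and u: "mfg l2mod2 u1" "mfg l2mod2 u2"
    and dF: "diag l2act F M1 N1 M2 N2" and dD: "diag l2act D M1' N1' M2' N2'"
    and N: "mfg l2act N1" "mfg l2act N2'"
  shows "\<exists>tN1' ttN1' tN2 ttN2 W W'. msub l2act tN1' \<and> msub l2act ttN1' \<and> msub l2act tN2 \<and> msub l2act ttN2
    \<and> miso l2act N2 tN2 \<and> miso l2act N1' tN1' \<and> mfg l2act ttN2 \<and> mfg l2act ttN1'
    \<and> msub l2act W \<and> tN2 \<inter> ttN2 = {0} \<and> W = {x + y | x y. x \<in> tN2 \<and> y \<in> ttN2}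
    \<and> msub l2act W' \<and> tN1' \<inter> ttN1' = {0} \<and> W' = {x + y | x y. x \<in> tN1' \<and> y \<in> ttN1'}
    \<and> miso l2act W W'"
proof -
  obtain j :: "('a l2 \<times> 'a l2) \<times> ('a l2 \<times> 'a l2) \<Rightarrow> 'a l2" and j'
    where j: "mlin l2mod4 l2act j" "mlin l2act l2mod4 j'" "\<forall>p. j' (j p) = p" by (rule l2_pairing2)
  obtain f g where fg: "mlin l2mod4 l2mod4 f" "mlin l2mod4 l2mod4 g"
    "f ` ((N2 \<times> N2') \<times> u1) \<subseteq> u2 \<times> (N1 \<times> N1')" "g ` (u2 \<times> (N1 \<times> N1')) \<subseteq> (N2 \<times> N2') \<times> u1"
    "\<forall>x\<in>(N2 \<times> N2') \<times> u1. g (f x) = x" "\<forall>y\<in>u2 \<times> (N1 \<times> N1'). f (g y) = y"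
    using upper_tri_index[OF F C D d dF dD] by blast
  have sub: "msub l2mod2 u1" "msub l2mod2 u2" "msub l2act N1" "msub l2act N2" "msub l2act N1'" "msub l2act N2'"
    using d dF dD by (auto simp: diag_def compl_def)
  have z: "0 \<in> u1" "0 \<in> u2" "0 \<in> N1" "0 \<in> N2" "0 \<in> N1'" "0 \<in> N2'" using sub by (auto simp: msub_def)
  define A where "A = (N2 \<times> N2') \<times> u1"
  define X where "X = (N2 \<times> {0::'a l2}) \<times> {0::'a l2 \<times> 'a l2}"
  define Y where "Y = ({0::'a l2} \<times> N2') \<times> u1"
  define A' where "A' = u2 \<times> (N1 \<times> N1')"
  define X' where "X' = {0::'a l2 \<times> 'a l2} \<times> ({0::'a l2} \<times> N1')"
  define Y' where "Y' = u2 \<times> (N1 \<times> {0::'a l2})"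
  have msub: "msub l2mod4 A" "msub l2mod4 X" "msub l2mod4 Y" "msub l2mod4 A'" "msub l2mod4 X'" "msub l2mod4 Y'"
    unfolding A_def X_def Y_def A'_def X'_def Y'_def
    by (intro msub_Times sub l2.msub_zero l2l2.msub_zero)+
  have XY: "X \<inter> Y = {0}" "X' \<inter> Y' = {0}"
    using z by (auto simp: X_def Y_def X'_def Y'_def zero_prod_def)
  have A: "A = {x + y | x y. x \<in> X \<and> y \<in> Y}" unfolding A_def X_def Y_def
    by (auto simp: zero_prod_def)
  have A': "A' = {x + y | x y. x \<in> X' \<and> y \<in> Y'}" unfolding A'_def X'_def Y'_def
    by (auto simp: zero_prod_def)
  note proj = mlin_fst[OF mlin_id] mlin_snd[OF mlin_id]
  note zero = l2.mlin_zero l2l2.mlin_zero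
  have inl: "mlin l2act l2mod4 (\<lambda>x. ((x, 0), 0))" "mlin l2act l2mod4 (\<lambda>x. ((0, x), 0))"
    "mlin l2act l2mod4 (\<lambda>x. (0, (x, 0)))" "mlin l2act l2mod4 (\<lambda>x. (0, (0, x)))"
    "mlin l2mod2 l2mod4 (\<lambda>p. (p, 0))" "mlin l2mod2 l2mod4 (\<lambda>p. (0, p))"
    by (intro mlin_Pair mlin_id zero)+
  have fgY: "mfg l2mod4 Y"
  proof -
    have "Y = {x + y | x y. x \<in> (\<lambda>x. ((0, x), 0)) ` N2' \<and> y \<in> (\<lambda>p. (0, p)) ` u1}"
    proof (intro equalityI subsetI)
      fix y assume "y \<in> Y"
      then obtain b p where "y = ((0, b), 0) + (0, p)" "b \<in> N2'" "p \<in> u1" by (auto simp: Y_def)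
      then show "y \<in> {x + y | x y. x \<in> (\<lambda>x. ((0, x), 0)) ` N2' \<and> y \<in> (\<lambda>p. (0, p)) ` u1}" by blast
    qed (auto simp: Y_def zero_prod_def)
    then show ?thesis using mfg_sum[OF mfg_image[OF inl(2) N(2)] mfg_image[OF inl(6) u(1)]] by simp
  qed
  have fgY': "mfg l2mod4 Y'"
  proof -
    have "Y' = {x + y | x y. x \<in> (\<lambda>p. (p, 0)) ` u2 \<and> y \<in> (\<lambda>x. (0, (x, 0))) ` N1}"
    proof (intro equalityI subsetI)
      fix y assume "y \<in> Y'"
      then obtain p b where "y = (p, 0) + (0, (b, 0))" "p \<in> u2" "b \<in> N1" by (auto simp: Y'_def)
      then show "y \<in> {x + y | x y. x \<in> (\<lambda>p. (p, 0)) ` u2 \<and> y \<in> (\<lambda>x. (0, (x, 0))) ` N1}" by blast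
    qed (auto simp: Y'_def zero_prod_def)
    then show ?thesis using mfg_sum[OF mfg_image[OF inl(5) u(2)] mfg_image[OF inl(3) N(1)]] by simp
  qed
  have iX: "miso l2act N2 (j ` X)" unfolding miso_def
  proof (intro exI conjI)
    show "mlin l2act l2act (\<lambda>x. j ((x, 0), 0))" by (rule mlin_compose[OF j(1) inl(1)])
    show "mlin l2act l2act (\<lambda>y. fst (fst (j' y)))" by (intro mlin_fst[OF mlin_fst[OF j(2)]])
  qed (auto simp: X_def j(3))
  have iX': "miso l2act N1' (j ` X')" unfolding miso_def
  proof (intro exI conjI)
    show "mlin l2act l2act (\<lambda>x. j (0, (0, x)))" by (rule mlin_compose[OF j(1) inl(4)])
    show "mlin l2act l2act (\<lambda>y. snd (snd (j' y)))" by (intro mlin_snd[OF mlin_snd[OF j(2)]])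
  qed (auto simp: X'_def j(3))
  have iA: "miso l2act (j ` A) (j ` A')" unfolding miso_def
  proof (intro exI conjI)
    show "mlin l2act l2act (\<lambda>x. j (f (j' x)))" by (intro mlin_compose[OF j(1)] mlin_compose[OF fg(1)] j(2))
    show "mlin l2act l2act (\<lambda>x. j (g (j' x)))" by (intro mlin_compose[OF j(1)] mlin_compose[OF fg(2)] j(2))
    show "(\<lambda>x. j (f (j' x))) ` j ` A \<subseteq> j ` A'" "(\<lambda>x. j (g (j' x))) ` j ` A' \<subseteq> j ` A"
      using fg(3,4)[folded A_def A'_def] by (auto simp: j(3))
    show "\<forall>x\<in>j ` A. j (g (j' (j (f (j' x))))) = x" "\<forall>x\<in>j ` A'. j (f (j' (j (g (j' x))))) = x"
      using fg(5,6)[folded A_def A'_def] by (auto simp: j(3))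
  qed
  show ?thesis
    apply (rule exI[of _ "j ` X'"], rule exI[of _ "j ` Y'"], rule exI[of _ "j ` X"], rule exI[of _ "j ` Y"],
        rule exI[of _ "j ` A"], rule exI[of _ "j ` A'"])
    apply (intro conjI msub_embed[OF j] msub iX iX' iA mfg_image[OF j(1)] fgY fgY' embed_direct_sum(1)[OF j(1,3)] XY)
     apply (subst A, rule embed_direct_sum(2)[OF j(1,3) XY(1)])
    apply (subst A', rule embed_direct_sum(2)[OF j(1,3) XY(2)])
    done
qed

section \<open>The two concrete representations\<close>

interpretation rep1: hilbert_rep l2act ell2 l2_nth 1 1
proof
  show "bij_betw (l2_nth :: 'a l2 \<Rightarrow> _) UNIV (hcarrier ell2)"
    using type_definition_l2 by (metis (no_types) bij_betw_def type_definition.Rep_range type_definition.Rep_inject injI)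
qed (auto simp: fun_eq_iff act_ell2 norm_l2.rep_eq)

lemma hinner_ell2_self: "hinner ell2 x x = (\<Sum>n. star (x n) * x n)"
  by (simp add: ell2_def)

text \<open>Positivity is applied to the partial sums, and the inequality between norms passes to
  the limit.\<close>

lemma norm_hinner_ell2_le:
  assumes "sqsum x" "sqsum y"
  shows "norm (hinner ell2 x x) \<le> norm (hinner ell2 x x + hinner ell2 y y)"
proof (rule LIMSEQ_le)
  show "(\<lambda>n. norm (\<Sum>i<n. star (x i) * x i)) \<longlonglongrightarrow> norm (hinner ell2 x x)"
    unfolding hinner_ell2_self by (intro tendsto_norm summable_LIMSEQ assms)
  show "(\<lambda>n. norm ((\<Sum>i<n. star (x i) * x i) + (\<Sum>i<n. star (y i) * y i)))
      \<longlonglongrightarrow> norm (hinner ell2 x x + hinner ell2 y y)"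
    unfolding hinner_ell2_self by (intro tendsto_norm tendsto_add summable_LIMSEQ assms)
  have "norm (\<Sum>i<n. star (x i) * x i) \<le> norm ((\<Sum>i<n. star (x i) * x i) + (\<Sum>i<n. star (y i) * y i))" for n
    by (rule norm_mono_pos) (auto intro!: pos_sum pos_star_mult)
  then show "\<exists>N. \<forall>n\<ge>N. norm (\<Sum>i<n. star (x i) * x i)
      \<le> norm ((\<Sum>i<n. star (x i) * x i) + (\<Sum>i<n. star (y i) * y i))" by blast
qed

interpretation rep2: hilbert_rep l2mod2 "orth_sum ell2 ell2" "map_prod l2_nth l2_nth" 2 1
proof
  show "bij_betw (map_prod l2_nth l2_nth :: 'a l2 \<times> 'a l2 \<Rightarrow> _) UNIV (hcarrier (orth_sum ell2 ell2))"
    using bij_betw_map_prod[OF rep1.bij rep1.bij] by (simp add: orth_sum_def)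
  fix x y :: "'a l2 \<times> 'a l2" and a :: 'a
  show "map_prod l2_nth l2_nth (x + y) = map_prod l2_nth l2_nth x + map_prod l2_nth l2_nth y"
    by (simp add: prod_eq_iff rep1.\<phi>_add)
  show "map_prod l2_nth l2_nth (l2mod2 x a) = act (orth_sum ell2 ell2) (map_prod l2_nth l2_nth x) a"
    by (simp add: prod_eq_iff orth_sum_def pact_def rep1.\<phi>_act)
  define X where "X = hinner ell2 (l2_nth (fst x)) (l2_nth (fst x))"
  define Y where "Y = hinner ell2 (l2_nth (snd x)) (l2_nth (snd x))"
  have h: "hnorm (orth_sum ell2 ell2) (map_prod l2_nth l2_nth x) = sqrt (norm (X + Y))"
    by (simp add: hnorm_def orth_sum_def X_def Y_def)
  have n: "norm x = sqrt (norm X + norm Y)"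
    by (simp add: norm_prod_def norm_l2.rep_eq hnorm_def X_def Y_def)
  have "norm X \<le> norm (X + Y)" "norm Y \<le> norm (Y + X)"
    unfolding X_def Y_def by (intro norm_hinner_ell2_le sqsum_l2_nth)+
  \<comment> \<open>A factor 2 is what the two inequalities give; 4 is taken because its square root
    is the constant 2 of the interpretation.\<close>
  then have "norm X + norm Y \<le> 2\<^sup>2 * norm (X + Y)"
    using norm_ge_zero[of "X + Y"] unfolding add.commute[of Y X] by (simp only: power2_eq_square)
  then have "sqrt (norm X + norm Y) \<le> sqrt (2\<^sup>2 * norm (X + Y))" by (rule real_sqrt_le_mono)
  then show "norm x \<le> 2 * hnorm (orth_sum ell2 ell2) (map_prod l2_nth l2_nth x)"
    unfolding h n by (simp add: real_sqrt_mult)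
  show "hnorm (orth_sum ell2 ell2) (map_prod l2_nth l2_nth x) \<le> 1 * norm x"
    unfolding h n by (simp add: norm_triangle_ineq)
qed auto

theorem theorem3p2:
  fixes F D C :: "(nat \<Rightarrow> 'a::unital_cstar_algebra) \<Rightarrow> (nat \<Rightarrow> 'a)"
  assumes "F \<in> adjointable_ops ell2"
    and "D \<in> adjointable_ops ell2"
    and "C \<in> adjointable_ops ell2"
    and "op_matrix F C (\<lambda>_. 0) D \<in> fredholm (orth_sum ell2 ell2)"
  shows "F \<in> upper_semi_fredholm ell2 \<and> D \<in> lower_semi_fredholm ell2
    \<and> (\<forall>M\<^sub>1 N\<^sub>1 M\<^sub>2 N\<^sub>2 M\<^sub>1' N\<^sub>1' M\<^sub>2' N\<^sub>2'.
        diag_decomp ell2 F M\<^sub>1 N\<^sub>1 M\<^sub>2 N\<^sub>2 \<and> fin_gen ell2 N\<^sub>1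
        \<and> diag_decomp ell2 D M\<^sub>1' N\<^sub>1' M\<^sub>2' N\<^sub>2' \<and> fin_gen ell2 N\<^sub>2'
        \<longrightarrow> (\<exists>tN\<^sub>1' ttN\<^sub>1' tN\<^sub>2 ttN\<^sub>2 W W'.
              closed_submod ell2 tN\<^sub>1' \<and> closed_submod ell2 ttN\<^sub>1'
              \<and> closed_submod ell2 tN\<^sub>2 \<and> closed_submod ell2 ttN\<^sub>2
              \<and> isomorphic ell2 N\<^sub>2 tN\<^sub>2 \<and> isomorphic ell2 N\<^sub>1' tN\<^sub>1'
              \<and> fin_gen ell2 ttN\<^sub>2 \<and> fin_gen ell2 ttN\<^sub>1'
              \<and> direct_sum ell2 W tN\<^sub>2 ttN\<^sub>2 \<and> direct_sum ell2 W' tN\<^sub>1' ttN\<^sub>1'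
              \<and> isomorphic ell2 W W'))"
proof -
  obtain f where f: "mlin l2act l2act f" "\<forall>x. l2_nth (f x) = F (l2_nth x)"
    by (rule rep1.operator_obtain[OF assms(1)])
  obtain c where c: "mlin l2act l2act c" "\<forall>x. l2_nth (c x) = C (l2_nth x)"
    by (rule rep1.operator_obtain[OF assms(3)])
  obtain d where d: "mlin l2act l2act d" "\<forall>x. l2_nth (d x) = D (l2_nth x)"
    by (rule rep1.operator_obtain[OF assms(2)])
  let ?H2 = "orth_sum ell2 ell2 :: ('a, (nat \<Rightarrow> 'a) \<times> (nat \<Rightarrow> 'a)) hilbert_mod"
  let ?M = "op_matrix F C (\<lambda>_. 0) D"
  have T: "\<forall>p. map_prod l2_nth l2_nth (upper_tri f c d p) = ?M (map_prod l2_nth l2_nth p)"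
    by (auto simp: upper_tri_def op_matrix_def rep1.\<phi>_add f(2) c(2) d(2))
  \<comment> \<open>This one decomposition of the matrix operator serves all decompositions of
    \<open>F\<close> and \<open>D\<close> considered below.\<close>
  obtain T1 U1 T2 U2 where TU: "diag_decomp ?H2 ?M T1 U1 T2 U2" "fin_gen ?H2 U1" "fin_gen ?H2 U2"
    using assms(4) by (auto simp: fredholm_def)
  obtain t1 u1 t2 u2 where tu: "U1 = map_prod l2_nth l2_nth ` u1" "U2 = map_prod l2_nth l2_nth ` u2"
    "diag l2mod2 (upper_tri f c d) t1 u1 t2 u2"
    by (rule rep2.diag_decomp_obtain[OF mlin_upper_tri[OF f(1) c(1) d(1)] T TU(1)])
  have u: "mfg l2mod2 u1" "mfg l2mod2 u2"
    using TU(2,3) unfolding tu rep2.fin_gen_iff by auto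
  obtain m1 n1 m2 n2 where F: "diag l2act f m1 n1 m2 n2" "mfg l2act n1"
    using upper_tri_diag(1)[OF f(1) c(1) d(1) tu(3) u] by blast
  have "diag_decomp ell2 F (l2_nth ` m1) (l2_nth ` n1) (l2_nth ` m2) (l2_nth ` n2)"
    "fin_gen ell2 (l2_nth ` n1)"
    unfolding rep1.diag_iff[OF f] rep1.fin_gen_iff by (fact F)+
  then have 1: "F \<in> upper_semi_fredholm ell2" using assms(1) unfolding upper_semi_fredholm_def by blast
  obtain m1' n1' m2' n2' where D: "diag l2act d m1' n1' m2' n2'" "mfg l2act n2'"
    using upper_tri_diag(2)[OF f(1) c(1) d(1) tu(3) u] by blast
  have "diag_decomp ell2 D (l2_nth ` m1') (l2_nth ` n1') (l2_nth ` m2') (l2_nth ` n2')"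
    "fin_gen ell2 (l2_nth ` n2')"
    unfolding rep1.diag_iff[OF d] rep1.fin_gen_iff by (fact D)+
  then have 2: "D \<in> lower_semi_fredholm ell2" using assms(2) unfolding lower_semi_fredholm_def by blast
  show ?thesis
  proof (intro conjI 1 2 allI impI, elim conjE)
    fix M1 N1 M2 N2 M1' N1' M2' N2'
    assume dF: "diag_decomp ell2 F M1 N1 M2 N2" and gF: "fin_gen ell2 N1"
      and dD: "diag_decomp ell2 D M1' N1' M2' N2'" and gD: "fin_gen ell2 N2'"
    obtain m1 n1 m2 n2 where F: "N1 = l2_nth ` n1" "N2 = l2_nth ` n2" "diag l2act f m1 n1 m2 n2"
      by (rule rep1.diag_decomp_obtain[OF f dF])
    obtain m1' n1' m2' n2' where D: "N1' = l2_nth ` n1'" "N2' = l2_nth ` n2'" "diag l2act d m1' n1' m2' n2'"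
      by (rule rep1.diag_decomp_obtain[OF d dD])
    have n: "mfg l2act n1" "mfg l2act n2'" using gF gD unfolding F D rep1.fin_gen_iff by auto
    obtain tn1' ttn1' tn2 ttn2 w w' where *: "msub l2act tn1'" "msub l2act ttn1'" "msub l2act tn2" "msub l2act ttn2"
      "miso l2act n2 tn2" "miso l2act n1' tn1'" "mfg l2act ttn2" "mfg l2act ttn1'"
      "msub l2act w" "tn2 \<inter> ttn2 = {0}" "w = {x + y | x y. x \<in> tn2 \<and> y \<in> ttn2}"
      "msub l2act w'" "tn1' \<inter> ttn1' = {0}" "w' = {x + y | x y. x \<in> tn1' \<and> y \<in> ttn1'}"
      "miso l2act w w'"
      using upper_tri_index_l2[OF f(1) c(1) d(1) tu(3) u F(3) D(3) n] by (elim exE conjE) (rule that)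
    show "\<exists>tN1' ttN1' tN2 ttN2 W W'.
              closed_submod ell2 tN1' \<and> closed_submod ell2 ttN1'
              \<and> closed_submod ell2 tN2 \<and> closed_submod ell2 ttN2
              \<and> isomorphic ell2 N2 tN2 \<and> isomorphic ell2 N1' tN1'
              \<and> fin_gen ell2 ttN2 \<and> fin_gen ell2 ttN1'
              \<and> direct_sum ell2 W tN2 ttN2 \<and> direct_sum ell2 W' tN1' ttN1'
              \<and> isomorphic ell2 W W'"
    proof (intro exI conjI)
      show "closed_submod ell2 (l2_nth ` tn1')" "closed_submod ell2 (l2_nth ` ttn1')"
        "closed_submod ell2 (l2_nth ` tn2)" "closed_submod ell2 (l2_nth ` ttn2)"
        unfolding rep1.closed_submod_iff by (fact *)+
      show "fin_gen ell2 (l2_nth ` ttn2)" "fin_gen ell2 (l2_nth ` ttn1')"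
        unfolding rep1.fin_gen_iff by (fact *)+
      show "isomorphic ell2 N2 (l2_nth ` tn2)" "isomorphic ell2 N1' (l2_nth ` tn1')"
        "isomorphic ell2 (l2_nth ` w) (l2_nth ` w')"
        unfolding F D by (intro rep1.isomorphicI *)+
      show "direct_sum ell2 (l2_nth ` w) (l2_nth ` tn2) (l2_nth ` ttn2)"
        "direct_sum ell2 (l2_nth ` w') (l2_nth ` tn1') (l2_nth ` ttn1')"
        unfolding rep1.direct_sum_iff by (intro conjI *)+
    qed
  qed
qed

end
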